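(* Let $R$ be a field with $\operatorname{char} R\neq 2$, let $\delta\in R$, and let $n\geq 4$ be an integer. Let $\mathrm{TLD}_n(\delta)$ be the Temperley-Lieb algebra of type $D$ over $R$. Then $\mathrm{TLD}_n(\delta)$ is semi-simple if and only if $P_s(\delta)\neq 0$ for all integers $s$ with $1<s\leq n$ and $Q_t(\delta)\neq 0$ for all integers $t$ with $2<t\leq n$.
   Context: Type $D_n$ Dynkin graph: vertices $\bar 1,1,2,\dots,n-1$; edges $\{\bar 1,2\}$, $\{1,2\}$ and $\{i,i+1\}$ for $2\le i\le n-2$. $\mathrm{TLD}_n(\delta)$ is the associative unital $R$-algebra generated by $e_{\bar 1},e_1,e_2,\dots,e_{n-1}$ subject to: (1) $e_i^2=\delta e_i$ for all $i$; (2) $e_ie_j=e_je_i$ if $i\ne j$ are not connected by an edge of the graph; (3) $e_ie_je_i=e_i$ if $i$ and $j$ are connected by an edge. The polynomials $P_k(x)$ (Chebychev polynomials of the second kind) are defined by $P_0(x)=0$, $P_1(x)=1$, $P_{k+1}(x)=xP_k(x)-P_{k-1}(x)$ for $k\ge 1$. The polynomials $Q_k(x)$ (Chebychev polynomials of type $D$) are defined by $Q_2(x)=x^2$, $Q_3(x)=x^3-2x$, $Q_{k+1}(x)=xQ_k(x)-Q_{k-1}(x)$ for $k\geq 3$. They have integer coefficients and are evaluated at $\delta\in R$. *)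

theory Defs
  imports
    "HOL-Library.FuncSet"
    "HOL-Library.Poly_Mapping"
    "HOL-Algebra.QuotRing"
    "HOL-Computational_Algebra.Computational_Algebra"
begin

section \<open>Semisimple rings\<close>

definition left_ideal :: "('a, 'b) ring_scheme \<Rightarrow> 'a set \<Rightarrow> bool" where
  "left_ideal A J \<longleftrightarrow>
     additive_subgroup J A \<and> (\<forall>a\<in>carrier A. \<forall>x\<in>J. a \<otimes>\<^bsub>A\<^esub> x \<in> J)"

definition simple_left_ideal :: "('a, 'b) ring_scheme \<Rightarrow> 'a set \<Rightarrow> bool" where
  "simple_left_ideal A J \<longleftrightarrow>
     left_ideal A J \<and> J \<noteq> {\<zero>\<^bsub>A\<^esub>} \<and>
     (\<forall>K. left_ideal A K \<and> K \<subseteq> J \<longrightarrow> K = {\<zero>\<^bsub>A\<^esub>} \<or> K = J)"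

text \<open>
  The left regular module is an (internal) direct sum of simple submodules. Since the rings
  have a unit, a direct sum decomposition of the regular module has only finitely many nonzero
  summands, so a finite index set is no restriction.
\<close>

definition semisimple :: "('a, 'b) ring_scheme \<Rightarrow> bool" where
  "semisimple A \<longleftrightarrow>
     (\<exists>(m::nat) (L :: nat \<Rightarrow> 'a set).
        (\<forall>i<m. simple_left_ideal A (L i)) \<and>
        (\<forall>x\<in>carrier A. \<exists>!f. f \<in> (\<Pi>\<^sub>E i\<in>{..<m}. L i) \<and> x = (\<Oplus>\<^bsub>A\<^esub>i\<in>{..<m}. f i)))"

section \<open>Free associative unital algebras\<close>

text \<open>
  The free monoid is a type of its own because convolution on finitely supported functions
  needs its index type to be in class \<^class>\<open>monoid_add\<close>. The monoid is written additively
  but is not commutative.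
\<close>

datatype 'g free_monoid = Word (letters: "'g list")

instantiation free_monoid :: (type) monoid_add
begin

definition zero_free_monoid :: "'a free_monoid" where
  "0 = Word []"

definition plus_free_monoid :: "'a free_monoid \<Rightarrow> 'a free_monoid \<Rightarrow> 'a free_monoid" where
  "u + v = Word (letters u @ letters v)"

instance
  by standard (simp_all add: zero_free_monoid_def plus_free_monoid_def)

end

lemma letters_zero [simp]: "letters 0 = []"
  by (simp add: zero_free_monoid_def)

lemma letters_plus [simp]: "letters (u + v) = letters u @ letters v"
  by (simp add: plus_free_monoid_def)

text \<open>
  Noncommutative polynomials: finite linear combinations of words, with the convolution product
  of \<^theory>\<open>HOL-Library.Poly_Mapping\<close>. The free algebra on \<open>S\<close> consists of those that only
  involve letters from \<open>S\<close>.
\<close>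

type_synonym ('g, 'r) ncpoly = "'g free_monoid \<Rightarrow>\<^sub>0 'r"

definition free_algebra :: "'g set \<Rightarrow> ('g, 'r::comm_ring_1) ncpoly ring" where
  "free_algebra S =
     \<lparr>carrier = {p. \<forall>w\<in>Poly_Mapping.keys p. set (letters w) \<subseteq> S},
      monoid.mult = (*), one = 1, ring.zero = 0, add = (+)\<rparr>"

definition gen :: "'g \<Rightarrow> ('g, 'r::comm_ring_1) ncpoly" where
  "gen g = Poly_Mapping.single (Word [g]) 1"

definition scalar :: "'r \<Rightarrow> ('g, 'r::comm_ring_1) ncpoly" where
  "scalar c = Poly_Mapping.single 0 c"

lemma ring_free_algebra: "ring (free_algebra S :: ('g, 'r::comm_ring_1) ncpoly ring)"
proof -
  let ?F = "free_algebra S :: ('g, 'r) ncpoly ring"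
  have ops: "x \<oplus>\<^bsub>?F\<^esub> y = x + y" "x \<otimes>\<^bsub>?F\<^esub> y = x * y" "\<zero>\<^bsub>?F\<^esub> = 0" "\<one>\<^bsub>?F\<^esub> = 1" for x y
    by (simp_all add: free_algebra_def)
  have add: "x + y \<in> carrier ?F" if "x \<in> carrier ?F" "y \<in> carrier ?F" for x y
    using that keys_add[of x y] by (auto simp: free_algebra_def)
  have mult: "x * y \<in> carrier ?F" if "x \<in> carrier ?F" "y \<in> carrier ?F" for x y
    using that keys_mult[of x y] by (fastforce simp: free_algebra_def)
  have neg: "- x \<in> carrier ?F" if "x \<in> carrier ?F" for x
    using that by (auto simp: free_algebra_def)
  have units: "0 \<in> carrier ?F" "1 \<in> carrier ?F"
    by (simp_all add: free_algebra_def)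
  show ?thesis
  proof (rule ringI)
    show "abelian_group ?F"
    proof (rule abelian_groupI)
      show "\<exists>y\<in>carrier ?F. y \<oplus>\<^bsub>?F\<^esub> x = \<zero>\<^bsub>?F\<^esub>" if "x \<in> carrier ?F" for x
        using neg[OF that] by (intro bexI[of _ "- x"]) (simp_all add: ops)
    qed (simp_all add: ops add units ac_simps)
    show "monoid ?F"
      by (rule monoidI) (simp_all add: ops mult units mult.assoc)
  qed (simp_all add: ops distrib_left distrib_right)
qed

section \<open>The Temperley-Lieb algebra of type D\<close>

text \<open>
  The vertex \<open>1\<close> with a bar is encoded as \<open>0\<close>; the vertices \<open>1, \<dots>, n - 1\<close> are themselves.
\<close>

definition D_vertices :: "nat \<Rightarrow> nat set" where
  "D_vertices n = insert 0 {1..n - 1}"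

definition D_edges :: "nat \<Rightarrow> nat set set" where
  "D_edges n = {{0, 2}, {1, 2}} \<union> {{i, i + 1} | i. 2 \<le> i \<and> i \<le> n - 2}"

text \<open>A relation \<open>u = v\<close> is represented by the element \<open>u - v\<close>.\<close>

definition TLD_relators :: "nat \<Rightarrow> 'r::comm_ring_1 \<Rightarrow> (nat, 'r) ncpoly set" where
  "TLD_relators n \<delta> =
     {gen i * gen i - scalar \<delta> * gen i | i. i \<in> D_vertices n} \<union>
     {gen i * gen j - gen j * gen i | i j.
        i \<in> D_vertices n \<and> j \<in> D_vertices n \<and> i \<noteq> j \<and> {i, j} \<notin> D_edges n} \<union>
     {gen i * gen j * gen i - gen i | i j.
        i \<in> D_vertices n \<and> j \<in> D_vertices n \<and> {i, j} \<in> D_edges n}"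

definition TLD :: "nat \<Rightarrow> 'r::comm_ring_1 \<Rightarrow> (nat, 'r) ncpoly set ring" where
  "TLD n \<delta> =
     free_algebra (D_vertices n) Quot
       genideal (free_algebra (D_vertices n)) (TLD_relators n \<delta>)"

lemma TLD_relators_carrier:
  "TLD_relators n (\<delta>::'r::comm_ring_1) \<subseteq> carrier (free_algebra (D_vertices n))"
proof -
  let ?F = "free_algebra (D_vertices n) :: (nat, 'r) ncpoly ring"
  interpret F: ring ?F by (rule ring_free_algebra)
  have mult: "x * y \<in> carrier ?F" if "x \<in> carrier ?F" "y \<in> carrier ?F" for x y
    using F.m_closed[OF that] by (simp add: free_algebra_def)
  have diff: "x - y \<in> carrier ?F" if "x \<in> carrier ?F" "y \<in> carrier ?F" for x y
    using that keys_diff[of x y] by (auto simp: free_algebra_def)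
  have gen: "gen i \<in> carrier ?F" if "i \<in> D_vertices n" for i
    using that by (simp add: free_algebra_def gen_def)
  have scalar: "scalar c \<in> carrier ?F" for c
    by (simp add: free_algebra_def scalar_def)
  show ?thesis
    unfolding TLD_relators_def by (auto intro!: diff mult gen scalar)
qed

lemma ring_TLD: "ring (TLD n (\<delta>::'r::comm_ring_1))"
  unfolding TLD_def
  by (intro ideal.quotient_is_ring ring.genideal_ideal ring_free_algebra TLD_relators_carrier)

section \<open>Chebychev polynomials\<close>

fun chebyshev_P :: "nat \<Rightarrow> int poly" where
  "chebyshev_P 0 = 0"
| "chebyshev_P (Suc 0) = 1"
| "chebyshev_P (Suc (Suc k)) = [:0, 1:] * chebyshev_P (Suc k) - chebyshev_P k"

text \<open>The values at \<open>0\<close> and \<open>1\<close> are dummies: the family starts at index \<open>2\<close>.\<close>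

fun chebyshev_Q :: "nat \<Rightarrow> int poly" where
  "chebyshev_Q 0 = 0"
| "chebyshev_Q (Suc 0) = 0"
| "chebyshev_Q (Suc (Suc 0)) = [:0, 1:] ^ 2"
| "chebyshev_Q (Suc (Suc (Suc 0))) = [:0, 1:] ^ 3 - 2 * [:0, 1:]"
| "chebyshev_Q (Suc (Suc (Suc (Suc k)))) =
     [:0, 1:] * chebyshev_Q (Suc (Suc (Suc k))) - chebyshev_Q (Suc (Suc k))"

definition eval_int_poly :: "int poly \<Rightarrow> 'r::comm_ring_1 \<Rightarrow> 'r" where
  "eval_int_poly p x = poly (map_poly of_int p) x"

end

theory Submission
  imports Defs "HOL-Library.Function_Algebras"
begin

text \<open>
  Let \<open>I\<close> be the ideal generated by \<open>w = e\<^sub>0 e\<^sub>1\<close>. Its elements \<open>x\<close> satisfy \<open>x e\<^sub>0 = x e\<^sub>1\<close> and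
  \<open>e\<^sub>0 x = e\<^sub>1 x\<close>. If the type A Jones-Wenzl element exists, \<open>I\<close> has a unit, so the algebra is the
  product of a part in which \<open>e\<^sub>0 = e\<^sub>1\<close> (type A) and a part in which \<open>e\<^sub>0 e\<^sub>1 = 0\<close>. In both
  parts a set \<open>G\<close> of orthogonal generators (\<open>{1}\<close>, resp. \<open>{0, 1}\<close>) is attached to the chain
  \<open>e\<^sub>2, e\<^sub>3, \<dots>\<close>, and the Jones-Wenzl recursion has coefficients \<open>D (k - 1) / D k\<close>, where
  \<open>D 0 = card G\<close>, \<open>D 1 = \<delta>\<close> and \<open>D (k + 1) = \<delta> D k - D (k - 1)\<close>. Hence \<open>D k\<close> is the value at
  \<open>\<delta>\<close> of the Chebychev polynomial \<open>P\<close> of index \<open>k + 1\<close>, resp. that of \<open>Q\<close> divided by \<open>\<delta>\<close>.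

  If no \<open>D k\<close> vanishes, the elements \<open>p = u z\<close>, where \<open>u = e (n - 1) e (n - 3) \<dots>\<close> and \<open>z\<close> is the
  Jones-Wenzl element on the remaining strands, satisfy \<open>p A p = R p\<close> and \<open>p A p' = 0\<close>, and \<open>1\<close> lies
  in the sum of the \<open>A p A\<close>; hence \<open>A\<close> is semisimple. Conversely, a semisimple ring is von Neumann
  regular. If \<open>\<delta> = 0\<close>, then \<open>w A w = 0\<close> although \<open>w \<noteq> 0\<close>. If \<open>\<delta> \<noteq> 0\<close> and \<open>m\<close> is minimal with
  \<open>D m = 0\<close>, then \<open>e m z e m = 0\<close> for the Jones-Wenzl element \<open>z\<close> on \<open>m\<close> strands, and according to
  the parity of \<open>n - m\<close> the element \<open>b = z (e m) u\<close> or \<open>b = z (e m) (e (m - 1)) (e (m + 1)) u\<close>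
  satisfies \<open>b A b = 0\<close>. It is nonzero because it acts nontrivially on a tensor power.
\<close>

section \<open>Algebras generated by a chain with a fork\<close>

text \<open>The obstacle is that the algebra is known only by generators and relations: no basis of
  diagrams and no dimension formula is at hand. Semisimplicity is therefore derived from identities
  that hold in every ring satisfying the relations, and its failure is detected in explicit
  representations. Von Neumann regularity is a suitable test because it passes to homomorphic
  images, so that \<open>b\<close> only has to be nonzero in some representation, which need not be
  faithful. Two representations are needed, one for each sequence \<open>D\<close>. Both live on the
  same tensor power; they differ in how \<open>e 0\<close> is obtained from \<open>e 1\<close>, by
  twisting with a permutation of the basis of one tensor factor. The factor is larger than the usual
  two-dimensional one, since it has to provide basis vectors that no Jones-Wenzl element changes.
  Characteristic different from 2 enters when an even cap is evaluated on the constant vector, which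
  gives 4. For \<delta> = 0 both tensor representations annihilate \<open>e 0 * e 1\<close>, hence
  the separate module for that value.\<close>

inductive_set aspan :: "'a::ab_group_add set \<Rightarrow> 'a set" for B where
  aspan_zero: "0 \<in> aspan B"
| aspan_base: "b \<in> B \<Longrightarrow> b \<in> aspan B"
| aspan_add: "x \<in> aspan B \<Longrightarrow> y \<in> aspan B \<Longrightarrow> x + y \<in> aspan B"

lemma comm_left: "a * b = b * a \<Longrightarrow> a * (b * x) = b * (a * (x::'a::semigroup_mult))"
  by (simp flip: mult.assoc)

lemma aspan_mono: "B \<subseteq> C \<Longrightarrow> aspan B \<subseteq> aspan C"
proof
  fix x assume "B \<subseteq> C" "x \<in> aspan B"
  from this(2,1) show "x \<in> aspan C" by induction (auto intro: aspan.intros)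
qed

text \<open>
  The element \<open>s 1\<close> is merely an idempotent: the ambient ring need not have a unit, and the algebras
  below are also considered inside a summand \<open>A c\<close> with \<open>s' r = s r c\<close>.
\<close>

locale scalars =
  fixes s :: "'r::field \<Rightarrow> 'a::ring"
  assumes s_add: "s (c + d) = s c + s d" and s_mult: "s (c * d) = s c * s d"
begin

lemma s_zero [simp]: "s 0 = 0"
  using s_add[of 0 0] by simp

lemma s_minus: "s (- c) = - s c"
  using s_add[of c "- c"] by (simp add: minus_unique)

lemma s_diff: "s (c - d) = s c - s d"
  using s_add[of c "- d"] by (simp add: s_minus)

lemma s_one_mult [simp]: "s 1 * s c = s c" "s c * s 1 = s c"
  using s_mult[of 1 c] s_mult[of c 1] by simp_all

lemma s_one_left [simp]: "s 1 * (s c * x) = s c * x"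
  by (simp flip: mult.assoc)

lemma s_s_left: "s c * (s d * x) = s (c * d) * x"
  by (simp add: s_mult mult.assoc)

text \<open>Generators are multiplied on the right only, so rule induction is induction on the last
  letter of a word. Closure under products then becomes a lemma, which requires the scalars to
  commute with the generators.\<close>

inductive_set alg :: "'a set \<Rightarrow> 'a set" for X where
  alg_scal: "s c \<in> alg X"
| alg_add: "x \<in> alg X \<Longrightarrow> y \<in> alg X \<Longrightarrow> x + y \<in> alg X"
| alg_step: "x \<in> alg X \<Longrightarrow> y \<in> X \<Longrightarrow> x * y \<in> alg X"

lemma alg_mono: "X \<subseteq> Y \<Longrightarrow> alg X \<subseteq> alg Y"
proof
  fix x assume "X \<subseteq> Y" "x \<in> alg X"
  from this(2,1) show "x \<in> alg Y" by induction (auto intro: alg.intros)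
qed

lemma alg_zero: "0 \<in> alg X"
  using alg_scal[of 0] by simp

text \<open>The spanning sets used later absorb scalars, so an additive span is enough; stability
  under one more letter on the right covers all words.\<close>

lemma alg_sub_aspan:
  assumes "\<And>c. s c \<in> aspan B" "\<And>b y. b \<in> B \<Longrightarrow> y \<in> X \<Longrightarrow> b * y \<in> aspan B"
  shows "alg X \<subseteq> aspan B"
proof
  fix x assume "x \<in> alg X"
  then show "x \<in> aspan B"
  proof induction
    case (alg_step x y)
    from alg_step(3) show ?case
      by induction (use alg_step(2) assms(2) in \<open>auto simp: distrib_right intro: aspan.intros\<close>)
  qed (use assms in \<open>auto intro: aspan.intros\<close>)
qed

definition central_on :: "'a set \<Rightarrow> bool" where
  "central_on X \<longleftrightarrow> (\<forall>y\<in>X. s 1 * y = y \<and> (\<forall>c. s c * y = y * s c))"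

lemma alg_cent:
  assumes "central_on X" "x \<in> alg X"
  shows "s c * x = x * s c"
  using assms(2)
proof induction
  case (alg_scal d)
  then show ?case by (simp flip: s_mult add: mult.commute)
next
  case (alg_step x y)
  then show ?case using assms(1) unfolding central_on_def by (metis mult.assoc)
qed (simp add: algebra_simps)

lemma alg_unit:
  assumes "central_on X" "x \<in> alg X"
  shows "s 1 * x = x" "x * s 1 = x"
proof -
  show "s 1 * x = x"
    using assms(2)
  proof induction
    case (alg_step x y)
    then show ?case by (metis mult.assoc)
  qed (simp_all add: distrib_left)
  then show "x * s 1 = x" using alg_cent[OF assms] by metis
qed

lemma alg_mult:
  assumes "central_on X" "y \<in> alg X" "x \<in> alg X"
  shows "x * y \<in> alg X"
  using assms(2)
proof induction
  case (alg_scal c)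
  from assms(3) show ?case
  proof induction
    case (alg_step x y)
    have "x * y * s c = x * s c * y"
      using assms(1) alg_step(2) by (simp add: central_on_def mult.assoc)
    then show ?case using alg_step by (auto intro: alg.intros)
  qed (auto simp: distrib_right intro: alg.intros simp flip: s_mult)
qed (auto simp: distrib_left intro: alg.intros simp flip: mult.assoc)

lemma alg_gen:
  assumes "central_on X" "x \<in> X"
  shows "x \<in> alg X"
  using alg_step[OF alg_scal[of 1] assms(2)] assms unfolding central_on_def by metis

lemma alg_minus:
  assumes "central_on X" "x \<in> alg X"
  shows "- x \<in> alg X"
  using alg_mult[OF assms(1) assms(2) alg_scal[of "-1"]] alg_unit[OF assms] by (simp add: s_minus)

lemma alg_diff:
  assumes "central_on X" "x \<in> alg X" "y \<in> alg X"
  shows "x - y \<in> alg X"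
  using alg_add[OF assms(2) alg_minus[OF assms(1,3)]] by simp

lemma alg_sum: "(\<And>i. i \<in> I \<Longrightarrow> f i \<in> alg X) \<Longrightarrow> sum f I \<in> alg X"
  by (induction I rule: infinite_finite_induct) (auto intro: alg.intros alg_zero)

lemma alg_commute:
  assumes "\<And>c. s c * w = w * s c" "\<And>y. y \<in> X \<Longrightarrow> y * w = w * y" "x \<in> alg X"
  shows "x * w = w * x"
  using assms(3)
proof induction
  case (alg_step x y)
  then show ?case using assms(2) by (metis mult.assoc)
qed (simp_all add: assms algebra_simps)

text \<open>Only the constant term of \<open>x\<close> survives, since every word with a last letter
  kills \<open>v\<close>.\<close>

lemma alg_scalar_left:
  assumes "\<And>y. y \<in> X \<Longrightarrow> y * v = 0" "x \<in> alg X"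
  shows "\<exists>c. x * v = s c * v"
  using assms(2)
proof induction
  case (alg_add x y)
  then show ?case by (metis s_add distrib_right)
next
  case (alg_step x y)
  then show ?case using assms(1) by (intro exI[of _ 0]) (simp add: mult.assoc)
qed auto

lemma alg_scalar_right:
  assumes "central_on X" "\<And>y. y \<in> X \<Longrightarrow> v * y = 0" "x \<in> alg X"
  shows "\<exists>c. v * x = v * s c"
  using assms(3)
proof induction
  case (alg_add x y)
  then show ?case by (metis s_add distrib_left)
next
  case (alg_step x y)
  then obtain c where "v * x = v * s c" by auto
  then have "v * (x * y) = v * (y * s c)"
    using assms(1) alg_step(2) unfolding central_on_def by (metis mult.assoc)
  then show ?case using assms(2)[OF alg_step(2)] by (intro exI[of _ 0]) (simp flip: mult.assoc)
qed auto

text \<open>Meant for coordinates of vectors in a representation, which are additive but not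
  multiplicative. The letters of \<open>a\<close> are moved into the argument one by one until only
  a scalar stands before a generator, and the scalar passes it.\<close>

lemma alg_kills_ideal:
  assumes "central_on X" "\<And>i x. i \<in> X \<Longrightarrow> \<mu> (i * x) = 0" "\<And>x y. \<mu> (x + y) = \<mu> x + (\<mu> y :: 'b::ab_group_add)"
    and "a \<in> alg X" "y \<in> X"
  shows "\<mu> (a * y * x) = 0"
  using assms(4,5)
proof (induction arbitrary: y x)
  case (alg_scal c)
  have "s c * y * x = y * (s c * x)" using assms(1) alg_scal by (simp add: central_on_def mult.assoc)
  then show ?case using assms(2) alg_scal by simp
next
  case (alg_step a z)
  then show ?case using alg_step.IH[of z "y * x"] by (simp add: mult.assoc)
qed (simp add: distrib_right assms(3))

end

text \<open>
  The generators with index below \<open>k\<close>, the set \<open>G \<subseteq> {0, 1}\<close> being attached to the vertex \<open>2\<close>. There are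
  none for \<open>k \<le> 1\<close>, and \<open>G\<close> appears at \<open>k = 2\<close>, so the index \<open>k\<close> is a number of strands.
\<close>

definition gen_index :: "nat set \<Rightarrow> nat \<Rightarrow> nat set" where
  "gen_index G k = {i. 2 \<le> k \<and> i \<in> G \<or> 2 \<le> i \<and> i < k}"

text \<open>The start value \<open>g\<close> is the number of orthogonal generators at the fork:
  \<open>e 2 * jw 2 * e 2\<close> is \<open>\<delta> - g / \<delta>\<close> times
  \<open>e 2\<close>, and this has to be the ratio of the values at 2 and 1. If \<delta> = t + 1/t
  with t nonzero, then \<open>g = 2\<close> gives t^k + t^(-k).\<close>

fun cheb :: "nat \<Rightarrow> 'r::field \<Rightarrow> nat \<Rightarrow> 'r" where
  "cheb g \<delta> 0 = of_nat g"
| "cheb g \<delta> (Suc 0) = \<delta>"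
| "cheb g \<delta> (Suc (Suc k)) = \<delta> * cheb g \<delta> (Suc k) - cheb g \<delta> k"

locale TL = scalars s for s :: "'r::field \<Rightarrow> 'a::ring" +
  fixes e :: "nat \<Rightarrow> 'a" and G :: "nat set" and n :: nat and \<delta> :: 'r
  assumes G_sub: "G \<subseteq> {0, 1}"
begin

abbreviation V :: "nat \<Rightarrow> nat set" where
  "V \<equiv> gen_index G"

abbreviation D :: "nat \<Rightarrow> 'r" where
  "D \<equiv> cheb (card G) \<delta>"

abbreviation A :: "nat \<Rightarrow> 'a set" where
  "A k \<equiv> alg (e ` V k)"

end

text \<open>
  For \<open>j \<ge> 2\<close>, the neighbours of \<open>j\<close> among the smaller vertices are \<open>V j - V (j - 1)\<close>.
\<close>

locale TL_rel = TL s e G n \<delta> for s :: "'r::field \<Rightarrow> 'a::ring" and e G n \<delta> +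
  assumes unit: "i \<in> V n \<Longrightarrow> s 1 * e i = e i"
    and cent: "i \<in> V n \<Longrightarrow> s c * e i = e i * s c"
    and sq: "i \<in> V n \<Longrightarrow> e i * e i = s \<delta> * e i"
    and orth: "2 \<le> n \<Longrightarrow> i \<in> G \<Longrightarrow> j \<in> G \<Longrightarrow> i \<noteq> j \<Longrightarrow> e i * e j = 0"
    and far: "2 \<le> j \<Longrightarrow> j < n \<Longrightarrow> i \<in> V (j - 1) \<Longrightarrow> e i * e j = e j * e i"
    and braid1: "2 \<le> j \<Longrightarrow> j < n \<Longrightarrow> i \<in> V j \<Longrightarrow> i \<notin> V (j - 1) \<Longrightarrow> e i * e j * e i = e i"
    and braid2: "2 \<le> j \<Longrightarrow> j < n \<Longrightarrow> i \<in> V j \<Longrightarrow> i \<notin> V (j - 1) \<Longrightarrow> e j * e i * e j = e j"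
begin

lemma finite_G [simp]: "finite G"
  using G_sub finite_subset by blast

lemma V_mono: "k \<le> l \<Longrightarrow> V k \<subseteq> V l"
  by (auto simp: gen_index_def)

lemma V_Suc: "2 \<le> k \<Longrightarrow> V (Suc k) = insert k (V k)"
  by (auto simp: gen_index_def)

lemma V_2: "V 2 = G"
  by (auto simp: gen_index_def)

lemma V_1: "V (Suc 0) = {}" "V 0 = {}"
  by (auto simp: gen_index_def)

lemma in_V: "2 \<le> j \<Longrightarrow> j < k \<Longrightarrow> j \<in> V k"
  by (auto simp: gen_index_def)

lemma central: "k \<le> n \<Longrightarrow> central_on (e ` V k)"
  using V_mono[of k n] by (auto simp: central_on_def intro!: unit cent)

lemma A_mono: "k \<le> l \<Longrightarrow> A k \<subseteq> A l"
  by (intro alg_mono image_mono V_mono)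

lemma A_e: "k \<le> n \<Longrightarrow> i \<in> V k \<Longrightarrow> e i \<in> A k"
  by (intro alg_gen central) auto

lemmas A_mult = alg_mult[OF central]
lemmas A_unit = alg_unit[OF central]
lemmas A_cent = alg_cent[OF central]
lemmas A_diff = alg_diff[OF central]

lemma A_far:
  assumes "k < j" "2 \<le> j" "j < n" "x \<in> A k"
  shows "x * e j = e j * x"
proof (rule alg_commute[OF _ _ assms(4)])
  show "s c * e j = e j * s c" for c using assms by (intro cent in_V) auto
  show "y * e j = e j * y" if y: "y \<in> e ` V k" for y
  proof -
    obtain i where "i \<in> V k" "y = e i" using y by auto
    moreover then have "i \<in> V (j - 1)" using V_mono[of k "j - 1"] assms by (simp add: subset_iff)
    ultimately show ?thesis using far assms by auto
  qed
qed

lemma A_1: "x \<in> A (Suc 0) \<Longrightarrow> \<exists>c. x = s c"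
proof (induction rule: alg.induct)
  case (alg_add x y)
  then show ?case by (metis s_add)
qed (auto simp: V_1)

lemma A_2:
  assumes "2 \<le> n"
  shows "A 2 \<subseteq> aspan (range s \<union> {s c * e i | c i. i \<in> G})"
proof (rule alg_sub_aspan)
  fix b y assume b: "b \<in> range s \<union> {s c * e i | c i. i \<in> G}" and y: "y \<in> e ` V 2"
  then obtain j where j: "j \<in> G" "y = e j" by (auto simp: V_2)
  have jV: "j \<in> V n" using j V_mono[OF assms] V_2 by auto
  consider c where "b = s c" | c i where "b = s c * e i" "i \<in> G" "i = j"
    | c i where "b = s c * e i" "i \<in> G" "i \<noteq> j" using b by blast
  then show "b * y \<in> aspan (range s \<union> {s c * e i | c i. i \<in> G})"
  proof cases
    case 1
    then show ?thesis using j by (auto intro!: aspan_base)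
  next
    case 2
    then have "b * y = s (c * \<delta>) * e j"
      using sq[OF jV] j by (simp add: mult.assoc s_mult)
    then show ?thesis using j by (auto intro!: aspan_base)
  next
    case 3
    then show ?thesis using orth[OF assms \<open>i \<in> G\<close> \<open>j \<in> G\<close>] j by (simp add: mult.assoc aspan_zero)
  qed
qed (auto intro: aspan_base)

text \<open>Words need the largest generator at most once: the hypothesis \<open>corner\<close>
  contracts two occurrences into one. It is an assumption here because it is proved in turn from
  this description at the previous level.\<close>

lemma A_Suc:
  assumes k: "2 \<le> k" "k < n"
    and corner: "\<And>x. x \<in> A k \<Longrightarrow> \<exists>t\<in>A (k - 1). e k * x * e k = t * e k"
  shows "A (Suc k) \<subseteq> aspan (A k \<union> {a * e k * b | a b. a \<in> A k \<and> b \<in> A k})"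
    (is "_ \<subseteq> aspan ?B")
proof (rule alg_sub_aspan)
  show "s c \<in> aspan ?B" for c by (auto intro: aspan_base alg_scal)
  fix b y assume b: "b \<in> ?B" and y: "y \<in> e ` V (Suc k)"
  then obtain j where j: "y = e j" "j \<in> V k \<or> j = k" using V_Suc[OF k(1)] by auto
  have kn: "k \<le> n" and kV: "k \<in> V n" using k by (auto intro: in_V)
  have one: "s 1 \<in> A k" by (rule alg_scal)
  from b consider "b \<in> A k" | p q where "b = p * e k * q" "p \<in> A k" "q \<in> A k" by auto
  then show "b * y \<in> aspan ?B"
  proof cases
    case 1
    show ?thesis
    proof (cases "j = k")
      case True
      have "b * y = b * e k * s 1" using True j cent[OF kV, of 1] unit[OF kV] by (simp add: mult.assoc)
      then show ?thesis using 1 one by (auto intro!: aspan_base)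
    next
      case False
      then show ?thesis using 1 j A_mult[OF kn, of "e j" b] A_e[OF kn] by (auto intro!: aspan_base)
    qed
  next
    case 2
    show ?thesis
    proof (cases "j = k")
      case True
      obtain t where t: "t \<in> A (k - 1)" "e k * q * e k = t * e k" using corner 2 by auto
      have tk: "t \<in> A k" using t A_mono[of "k - 1" k] by auto
      have "b * y = p * (e k * q * e k)" using 2 j True by (simp add: mult.assoc)
      also have "\<dots> = p * t * e k * s 1" using t cent[OF kV, of 1] unit[OF kV] by (simp add: mult.assoc)
      finally show ?thesis using A_mult[OF kn tk 2(2)] one by (auto intro!: aspan_base)
    next
      case False
      then have "b * y = p * e k * (q * e j)" "q * e j \<in> A k"
        using 2 j A_mult[OF kn _ 2(3), of "e j"] A_e[OF kn] by (auto simp: mult.assoc)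
      then show ?thesis using 2 by (auto intro!: aspan_base)
    qed
  qed
qed

lemma corner_aspan:
  assumes "x \<in> aspan B" "0 \<in> T" "\<And>x y. x \<in> T \<Longrightarrow> y \<in> T \<Longrightarrow> x + y \<in> T"
    "\<And>b. b \<in> B \<Longrightarrow> \<exists>t\<in>T. p * b * q = t * r"
  shows "\<exists>t\<in>T. p * x * q = t * (r::'a)"
  using assms(1)
proof induction
  case aspan_zero
  then show ?case using assms(2) by force
next
  case (aspan_add x y)
  then show ?case using assms(3) by (metis distrib_left distrib_right)
qed (use assms in auto)

text \<open>By the spanning set for one strand less, \<open>x\<close> contains
  \<open>e (k - 1)\<close> at most once, and everything around it commutes with \<open>e k\<close>;
  the braid relation then removes it. The start \<open>k = 2\<close> is separate because two
  generators may be attached there.\<close>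

lemma corner:
  assumes "2 \<le> k" "k < n" "x \<in> A k"
  shows "\<exists>t\<in>A (k - 1). e k * x * e k = t * e k"
  using assms
proof (induction k arbitrary: x rule: nat_induct_at_least)
  case base
  have kV: "2 \<in> V n" using base by (auto intro: in_V)
  show ?case
  proof (rule corner_aspan[OF subsetD[OF A_2]])
    fix b assume "b \<in> range s \<union> {s c * e i |c i. i \<in> G}"
    then consider c where "b = s c" | c i where "b = s c * e i" "i \<in> G" by auto
    then have "\<exists>c. e 2 * b * e 2 = s c * e 2"
    proof cases
      case 1
      then have "e 2 * b * e 2 = s (c * \<delta>) * e 2"
        using sq[OF kV] cent[OF kV, of c] by (metis s_mult mult.assoc)
      then show ?thesis by auto
    next
      case 2
      then have "e 2 * b * e 2 = s c * (e 2 * e i * e 2)"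
        using cent[OF kV, of c] by (metis mult.assoc)
      moreover have "e 2 * e i * e 2 = e 2" using 2 base G_sub by (intro braid2) (auto simp: gen_index_def)
      ultimately show ?thesis by auto
    qed
    then show "\<exists>t\<in>A (2 - 1). e 2 * b * e 2 = t * e 2" by (auto intro: alg_scal)
  qed (use base in \<open>auto intro: alg_zero alg_add\<close>)
next
  case (Suc k)
  have kn: "k \<le> n" and kV: "k \<in> V n" "Suc k \<in> V n" using Suc.prems Suc.hyps by (auto intro: in_V)
  let ?f = "e (Suc k)"
  have far': "z * ?f = ?f * z" if "z \<in> A k" for z
    using A_far[OF _ _ _ that, of "Suc k"] Suc.prems Suc.hyps by auto
  show ?case
  proof (rule corner_aspan[OF subsetD[OF A_Suc]])
    fix b assume "b \<in> A k \<union> {a * e k * b |a b. a \<in> A k \<and> b \<in> A k}"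
    then consider "b \<in> A k" | p q where "b = p * e k * q" "p \<in> A k" "q \<in> A k" by auto
    then show "\<exists>t\<in>A (Suc k - 1). ?f * b * ?f = t * ?f"
    proof cases
      case 1
      then have "?f * b * ?f = b * s \<delta> * ?f" using far' sq[OF kV(2)] by (metis mult.assoc)
      then show ?thesis using A_mult[OF kn alg_scal 1] by auto
    next
      case 2
      have "?f * b * ?f = ?f * p * e k * (q * ?f)" by (simp add: 2 mult.assoc)
      also have "\<dots> = p * (?f * e k * ?f) * q" unfolding far'[OF 2(2), symmetric] far'[OF 2(3)]
        by (simp add: mult.assoc)
      also have "?f * e k * ?f = ?f"
        using braid2[of "Suc k" k] Suc.prems Suc.hyps G_sub by (force simp: gen_index_def)
      also have "p * ?f * q = p * q * ?f" using far'[OF 2(3)] by (simp add: mult.assoc)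
      finally show ?thesis using A_mult[OF kn 2(3,2)] by auto
    qed
  qed (use Suc in \<open>auto intro: alg_zero alg_add\<close>)
qed

lemmas A_Suc_corner = A_Suc[OF _ _ corner]

end

section \<open>Jones-Wenzl elements\<close>

context TL begin

text \<open>Wenzl's recursion, indexed by the number of strands: \<open>jw k\<close> involves the
  generators in \<open>V k\<close> only. Where some \<open>D j\<close> vanishes, division by zero
  still yields a value; annihilation of the generators is claimed only if no earlier
  \<open>D j\<close> vanishes.\<close>

fun jw :: "nat \<Rightarrow> 'a" where
  "jw 0 = s 1"
| "jw (Suc 0) = s 1"
| "jw (Suc (Suc 0)) = s 1 - (\<Sum>i\<in>G. s (1 / \<delta>) * e i)"
| "jw (Suc (Suc (Suc k))) = jw (Suc (Suc k)) -
     s (D (Suc k) / D (Suc (Suc k))) * (jw (Suc (Suc k)) * e (Suc (Suc k)) * jw (Suc (Suc k)))"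

lemma jw_2: "jw 2 = s 1 - (\<Sum>i\<in>G. s (1 / \<delta>) * e i)"
  by (simp add: numeral_2_eq_2)

lemma jw_Suc:
  assumes "2 \<le> k"
  shows "jw (Suc k) = jw k - s (D (k - 1) / D k) * (jw k * e k * jw k)"
proof -
  obtain j where "k = Suc (Suc j)" using assms by (metis add_2_eq_Suc le_Suc_ex)
  then show ?thesis by simp
qed

lemma jw_induct [case_names one two Suc]:
  assumes "\<And>k. k \<le> 1 \<Longrightarrow> P k" "P 2" "\<And>k. 2 \<le> k \<Longrightarrow> P k \<Longrightarrow> P (Suc k)"
  shows "P k"
proof (cases "k \<le> 1")
  case False
  then have "2 \<le> k" by simp
  then show ?thesis by (induction k rule: nat_induct_at_least) (use assms in auto)
qed (use assms in auto)

lemma jw_one: "k \<le> 1 \<Longrightarrow> jw k = s 1"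
  by (cases k) auto

end

context TL_rel begin

lemma cent_left: "i \<in> V n \<Longrightarrow> e i * (s c * x) = s c * (e i * x)"
  using cent[of i c] by (simp flip: mult.assoc)

lemma jw_mem: "k \<le> n \<Longrightarrow> jw k \<in> A k"
proof (induction k rule: jw_induct)
  case (one k)
  then show ?case by (simp add: jw_one alg_scal)
next
  case two
  then show ?case unfolding jw_2
    by (intro A_diff alg_sum A_mult alg_scal A_e) (auto simp: V_2)
next
  case (Suc k)
  then have "jw k \<in> A (Suc k)" "e k \<in> A (Suc k)"
    using A_mono[of k "Suc k"] by (auto intro: A_e in_V)
  then show ?case unfolding jw_Suc[OF Suc(1)] using Suc.prems
    by (intro A_diff A_mult alg_scal) auto
qed

text \<open>The properties of \<open>jw k\<close> used later come mostly from
  \<open>s 1 - jw k\<close> lying in the ideal generated by the generators. \<open>I\<close> is any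
  set containing 0, closed under addition, that contains the products \<open>a * e i * b\<close>, so
  it can be an annihilator, the kernel of a functional or a span.\<close>

lemma jw_ideal:
  assumes "k \<le> n" "0 \<in> I" "\<And>x y. x \<in> I \<Longrightarrow> y \<in> I \<Longrightarrow> x + y \<in> I"
    "\<And>i a b. i \<in> V k \<Longrightarrow> a \<in> A k \<Longrightarrow> b \<in> A k \<Longrightarrow> a * e i * b \<in> I"
  shows "s 1 - jw k \<in> I"
  using assms(1,4)
proof (induction k rule: jw_induct)
  case (one k)
  then show ?case by (simp add: jw_one assms)
next
  case two
  have "(\<Sum>i\<in>J. s (1 / \<delta>) * e i) \<in> I" if "finite J" "J \<subseteq> G" for J
    using that
  proof induction
    case (insert i J)
    have "i \<in> V n" using insert V_mono[OF two(1)] V_2 by auto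
    then have "s (1 / \<delta>) * e i = s (1 / \<delta>) * e i * s 1"
      using cent[of i 1] unit[of i] by (simp add: mult.assoc)
    then have "s (1 / \<delta>) * e i \<in> I"
      using two(2)[of i "s (1 / \<delta>)" "s 1"] insert by (simp add: V_2 alg_scal)
    then show ?case using insert assms(3) by simp
  qed (simp add: assms)
  then show ?case unfolding jw_2 by simp
next
  case (Suc k)
  let ?c = "s (D (k - 1) / D k)"
  have z: "jw k \<in> A (Suc k)" using jw_mem[of k] A_mono[of k "Suc k"] Suc by auto
  have "s 1 - jw k \<in> I"
  proof (rule Suc.IH)
    show "a * e i * b \<in> I" if "i \<in> V k" "a \<in> A k" "b \<in> A k" for i a b
      using that A_mono[of k "Suc k"] V_mono[of k "Suc k"] by (intro Suc.prems) auto
  qed (use Suc in simp)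
  moreover have "?c * jw k * e k * jw k \<in> I"
    using Suc z by (intro Suc.prems A_mult alg_scal in_V) auto
  ultimately have "(s 1 - jw k) + ?c * jw k * e k * jw k \<in> I" by (rule assms)
  then show ?case using Suc by (simp add: jw_Suc algebra_simps)
qed

lemma jw_left:
  assumes "k \<le> n" "\<And>i. i \<in> V k \<Longrightarrow> e i * v = 0" "s 1 * v = v"
  shows "jw k * v = v"
proof -
  have "s 1 - jw k \<in> {y. y * v = 0}"
  proof (rule jw_ideal[OF assms(1)])
    fix i a b assume i: "i \<in> V k" "b \<in> A k"
    obtain c where "b * v = s c * v" using alg_scalar_left[of "e ` V k" v b] assms(2) i by auto
    moreover have "i \<in> V n" using i V_mono[OF assms(1)] by auto
    ultimately show "a * e i * b \<in> {y. y * v = 0}" using cent_left assms(2)[OF i(1)] by (simp add: mult.assoc)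
  qed (auto simp: distrib_right)
  then show ?thesis using assms(3) by (simp add: left_diff_distrib)
qed

lemma jw_right:
  assumes "k \<le> n" "\<And>i. i \<in> V k \<Longrightarrow> v * e i = 0" "v * s 1 = v"
  shows "v * jw k = v"
proof -
  have "s 1 - jw k \<in> {y. v * y = 0}"
  proof (rule jw_ideal[OF assms(1)])
    fix i a b assume i: "i \<in> V k" "a \<in> A k"
    obtain c where c: "v * a = v * s c" using alg_scalar_right[OF central[OF assms(1)], of v a] assms(2) i by auto
    have "i \<in> V n" using i V_mono[OF assms(1)] by auto
    then have "v * (a * e i * b) = v * e i * s c * b" using c cent[of i c] by (metis mult.assoc)
    then show "a * e i * b \<in> {y. v * y = 0}" using assms(2)[OF i(1)] by simp
  qed (auto simp: distrib_left)
  then show ?thesis using assms(3) by (simp add: right_diff_distrib)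
qed

text \<open>Allows a coordinate of \<open>jw k * y\<close> to be computed without expanding the
  recursion: where the outputs of all generators vanish, \<open>jw k\<close> acts as the
  identity.\<close>

lemma jw_functional:
  assumes "k \<le> n" and add: "\<And>x y. \<mu> (x + y) = \<mu> x + (\<mu> y :: 'b::ab_group_add)"
    and "\<And>i x. i \<in> V k \<Longrightarrow> \<mu> (e i * x) = 0"
  shows "\<mu> (jw k * x) = \<mu> (s 1 * x)"
proof -
  have "\<mu> 0 = 0" using add[of 0 0] by simp
  then have "s 1 - jw k \<in> {y. \<mu> (y * x) = 0}"
  proof (intro jw_ideal[OF assms(1)])
    fix i a b assume "i \<in> V k" "a \<in> A k"
    then have "\<mu> (a * e i * (b * x)) = 0"
      using assms(3) by (intro alg_kills_ideal[OF central[OF assms(1)] _ add]) auto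
    then show "a * e i * b \<in> {y. \<mu> (y * x) = 0}" by (simp add: mult.assoc)
  qed (auto simp: distrib_right add)
  then show ?thesis using add[of "(s 1 - jw k) * x" "jw k * x"] by (simp add: left_diff_distrib)
qed

text \<open>The claims support each other. Annihilation by the new generator \<open>e k\<close>
  follows from the third claim at \<open>k\<close>; the third claim at \<open>k + 1\<close> follows
  from the recursion, because \<open>e (k + 1)\<close> commutes with \<open>jw k\<close>. In the
  third claim \<open>D k\<close> itself may vanish, which is what makes it usable at the first
  vanishing coefficient.\<close>

lemma jw_kill:
  assumes "k \<le> n" "\<And>j. 1 \<le> j \<Longrightarrow> j < k \<Longrightarrow> D j \<noteq> 0"
  shows "i \<in> V k \<Longrightarrow> e i * jw k = 0" "i \<in> V k \<Longrightarrow> jw k * e i = 0"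
    "2 \<le> k \<Longrightarrow> k < n \<Longrightarrow> e k * jw k * e k = s (D k / D (k - 1)) * (jw (k - 1) * e k)"
proof -
  have "(\<forall>i\<in>V k. e i * jw k = 0 \<and> jw k * e i = 0) \<and>
    (2 \<le> k \<longrightarrow> k < n \<longrightarrow> e k * jw k * e k = s (D k / D (k - 1)) * (jw (k - 1) * e k))"
    using assms
  proof (induction k rule: jw_induct)
    case (one k)
    then show ?case using V_1 by (cases k) auto
  next
    case two
    have d: "\<delta> \<noteq> 0" using two(2)[of 1] by simp
    have GV: "i \<in> V n" if "i \<in> G" for i using that V_mono[OF two(1)] V_2 by auto
    have *: "s (1 / \<delta>) * (s \<delta> * e i) = e i" if "i \<in> G" for i
      using d unit[OF GV[OF that]] by (simp add: s_s_left)
    have k1: "e i * jw 2 = 0" if i: "i \<in> G" for i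
    proof -
      have "e i * (\<Sum>j\<in>G. s (1 / \<delta>) * e j) = (\<Sum>j\<in>G. if j = i then e i else 0)"
        unfolding sum_distrib_left
      proof (rule sum.cong)
        fix j assume j: "j \<in> G"
        have "e i * (s (1 / \<delta>) * e j) = s (1 / \<delta>) * (e i * e j)"
          using cent[OF GV[OF i]] by (simp flip: mult.assoc)
        then show "e i * (s (1 / \<delta>) * e j) = (if j = i then e i else 0)"
          using * orth two i j sq[OF GV[OF i]] by auto
      qed simp
      then show ?thesis using i unit[OF GV[OF i]] cent[OF GV[OF i], of 1]
        by (simp add: jw_2 right_diff_distrib)
    qed
    have k2: "jw 2 * e i = 0" if i: "i \<in> G" for i
    proof -
      have "(\<Sum>j\<in>G. s (1 / \<delta>) * e j) * e i = (\<Sum>j\<in>G. if j = i then e i else 0)"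
        unfolding sum_distrib_right
      proof (rule sum.cong)
        fix j assume j: "j \<in> G"
        show "s (1 / \<delta>) * e j * e i = (if j = i then e i else 0)"
          using * orth two i j sq[OF GV[OF i]] by (auto simp: mult.assoc)
      qed simp
      then show ?thesis using i unit[OF GV[OF i]] cent[OF GV[OF i], of 1]
        by (simp add: jw_2 left_diff_distrib)
    qed
    have "e 2 * jw 2 * e 2 = s (D 2 / D (2 - 1)) * (jw (2 - 1) * e 2)" if n: "2 < n"
    proof -
      have V2: "2 \<in> V n" using n by (simp add: in_V)
      have "e 2 * jw 2 * e 2 = e 2 * s 1 * e 2 - (\<Sum>i\<in>G. e 2 * (s (1 / \<delta>) * e i) * e 2)"
        by (simp add: jw_2 algebra_simps sum_distrib_left sum_distrib_right)
      also have "(\<Sum>i\<in>G. e 2 * (s (1 / \<delta>) * e i) * e 2) = (\<Sum>i\<in>G. s (1 / \<delta>) * e 2)"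
      proof (rule sum.cong)
        fix i assume i: "i \<in> G"
        have "e 2 * (s (1 / \<delta>) * e i) * e 2 = s (1 / \<delta>) * (e 2 * e i * e 2)"
          using cent[OF V2, of "1 / \<delta>"] by (metis mult.assoc)
        also have "e 2 * e i * e 2 = e 2" using i n G_sub by (intro braid2) (auto simp: gen_index_def)
        finally show "e 2 * (s (1 / \<delta>) * e i) * e 2 = s (1 / \<delta>) * e 2" .
      qed simp
      also have "(\<Sum>i\<in>G. s (1 / \<delta>) * e 2) = s (of_nat (card G) / \<delta>) * e 2"
      proof -
        have "(\<Sum>i\<in>I. s (1 / \<delta>) * e 2) = s (of_nat (card I) / \<delta>) * e 2" if "finite I" for I :: "nat set"
          using that by induction (auto simp: add_divide_distrib s_add distrib_right)
        then show ?thesis by simp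
      qed
      also have "e 2 * s 1 * e 2 = s \<delta> * e 2"
        using cent[OF V2, of 1] unit[OF V2] sq[OF V2] by metis
      finally have "e 2 * jw 2 * e 2 = s (\<delta> - of_nat (card G) / \<delta>) * e 2"
        by (simp add: s_diff left_diff_distrib)
      moreover have "\<delta> - of_nat (card G) / \<delta> = D 2 / D (2 - 1)"
        using d by (simp add: numeral_2_eq_2 field_simps)
      ultimately show ?thesis using unit[OF V2] by simp
    qed
    then show ?case using k1 k2 by (simp add: V_2)
  next
    case (Suc k)
    have kn: "k \<le> n" "k < n" using Suc by auto
    have kV: "k \<in> V n" using Suc by (simp add: in_V)
    have nz: "D k \<noteq> 0" "D (k - 1) \<noteq> 0" using Suc.prems(2)[of k] Suc.prems(2)[of "k - 1"] Suc(1) by auto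
    have IH: "\<And>i. i \<in> V k \<Longrightarrow> e i * jw k = 0 \<and> jw k * e i = 0"
      "e k * jw k * e k = s (D k / D (k - 1)) * (jw (k - 1) * e k)"
      using Suc kn by auto
    let ?c = "D (k - 1) / D k"
    have z: "jw k \<in> A k" "jw (k - 1) \<in> A (k - 1)" using kn by (auto intro: jw_mem)
    have z1: "jw (k - 1) * jw k = jw k" "jw k * jw (k - 1) = jw k" "jw k * jw k = jw k"
    proof -
      have u: "s 1 * jw k = jw k" "jw k * s 1 = jw k" using A_unit[OF kn(1) z(1)] .
      have V': "i \<in> V k" if "i \<in> V (k - 1)" for i using that V_mono[of "k - 1" k] by auto
      show "jw k * jw k = jw k" using IH(1) u(1) kn(1) by (intro jw_left) blast+
      have "k - 1 \<le> n" using kn by simp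
      then show "jw (k - 1) * jw k = jw k" "jw k * jw (k - 1) = jw k"
        using IH(1) u V' by (blast intro!: jw_left jw_right)+
    qed
    have comm: "jw (k - 1) * e k = e k * jw (k - 1)" using A_far[of "k - 1" k] z Suc kn by auto
    have cz: "s c * jw k = jw k * s c" for c using A_cent[OF kn(1) z(1)] .
    have czl: "jw k * (s c * x) = s c * (jw k * x)" for c x using cz[of c] by (simp flip: mult.assoc)
    have one: "s 1 * (e k * x) = e k * x" for x using unit[OF kV] by (simp flip: mult.assoc)
    \<comment> \<open>This cancellation dictates the coefficient in the recursion.\<close>
    have cancel: "s ?c * (s (D k / D (k - 1)) * (e k * x)) = e k * x" for x
    proof -
      have "?c * (D k / D (k - 1)) = 1" using nz by simp
      then show ?thesis by (simp only: s_s_left one)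
    qed
    have kk: "e k * jw (Suc k) = 0"
    proof -
      have "e k * (s ?c * (jw k * e k * jw k)) = s ?c * (e k * jw k * e k * jw k)"
        by (simp add: cent_left[OF kV] mult.assoc)
      also have "\<dots> = s ?c * (s (D k / D (k - 1)) * (e k * (jw (k - 1) * jw k)))"
        unfolding IH(2) comm by (simp add: mult.assoc)
      also have "\<dots> = e k * jw k" unfolding cancel z1 ..
      finally show ?thesis using Suc(1) by (simp add: jw_Suc right_diff_distrib)
    qed
    have kk': "jw (Suc k) * e k = 0"
    proof -
      have "s ?c * (jw k * e k * jw k) * e k = jw k * (s ?c * (e k * jw k * e k))"
        by (simp add: mult.assoc czl)
      also have "\<dots> = jw k * (s ?c * (s (D k / D (k - 1)) * (e k * jw (k - 1))))"
        unfolding IH(2) comm ..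
      also have "\<dots> = jw k * e k"
        unfolding cancel unfolding comm[symmetric] mult.assoc[symmetric] z1 ..
      finally show ?thesis using Suc(1) by (simp add: jw_Suc left_diff_distrib)
    qed
    have rest: "e i * jw (Suc k) = 0 \<and> jw (Suc k) * e i = 0" if i: "i \<in> V k" for i
    proof -
      have iV: "i \<in> V n" using i V_mono[OF kn(1)] by auto
      have "e i * (s ?c * (jw k * e k * jw k)) = s ?c * (e i * jw k * e k * jw k)"
        by (simp add: cent_left[OF iV] mult.assoc)
      moreover have "s ?c * (jw k * e k * jw k) * e i = s ?c * (jw k * e k * (jw k * e i))"
        by (simp add: mult.assoc)
      ultimately show ?thesis
        using IH(1)[OF i] Suc(1) by (simp add: jw_Suc left_diff_distrib right_diff_distrib)
    qed
    have "e (Suc k) * jw (Suc k) * e (Suc k) = s (D (Suc k) / D k) * (jw k * e (Suc k))" if n: "Suc k < n"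
    proof -
      let ?f = "e (Suc k)"
      have V2: "Suc k \<in> V n" using n Suc(1) by (simp add: in_V)
      have fz: "jw k * ?f = ?f * jw k" using A_far[of k "Suc k" "jw k"] z n Suc(1) by auto
      have fzf: "?f * jw k * ?f = s \<delta> * (jw k * ?f)"
        using fz sq[OF V2] cz[of \<delta>] by (metis mult.assoc)
      have "?f * (s ?c * (jw k * e k * jw k)) * ?f = s ?c * (?f * (jw k * e k * jw k) * ?f)"
        by (simp add: cent_left[OF V2] mult.assoc)
      also have "?f * (jw k * e k * jw k) * ?f = jw k * (?f * e k * ?f) * jw k"
        using fz by (metis mult.assoc)
      also have "?f * e k * ?f = ?f"
        using Suc(1) n G_sub by (intro braid2) (auto simp: gen_index_def)
      also have "jw k * ?f * jw k = jw k * ?f" using fz z1 by (metis mult.assoc)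
      finally have "?f * jw (Suc k) * ?f = s \<delta> * (jw k * ?f) - s ?c * (jw k * ?f)"
        using Suc(1) fzf by (simp add: jw_Suc algebra_simps)
      also have "\<dots> = s (\<delta> - ?c) * (jw k * ?f)" by (simp add: s_diff left_diff_distrib)
      also have "\<delta> - ?c = D (Suc k) / D k"
        using nz Suc(1) by (cases k) (simp_all add: field_simps)
      finally show ?thesis .
    qed
    then show ?case using kk kk' rest V_Suc[OF Suc(1)] by auto
  qed
  then show "i \<in> V k \<Longrightarrow> e i * jw k = 0" "i \<in> V k \<Longrightarrow> jw k * e i = 0"
    "2 \<le> k \<Longrightarrow> k < n \<Longrightarrow> e k * jw k * e k = s (D k / D (k - 1)) * (jw (k - 1) * e k)"
    by auto
qed

end

section \<open>Orthogonal families\<close>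

context TL_rel begin

text \<open>Compression to \<open>m\<close> strands. The element \<open>q\<close> is a product of
  commuting cups at the far end of the chain; each further factor \<open>e (m - 1)\<close> uses up
  two strands.\<close>

definition Corner :: "'a \<Rightarrow> nat \<Rightarrow> bool" where
  "Corner q m \<longleftrightarrow> q \<in> A n \<and> (\<forall>x\<in>A n. \<exists>t\<in>A m. q * x * q = q * t) \<and> (\<forall>t\<in>A m. q * t = t * q)"

text \<open>Here \<open>x\<close> may itself contain \<open>e k\<close>, but only once, so that two
  ordinary corners in succession suffice.\<close>

lemma corner_Suc:
  assumes "2 \<le> k" "k < n" "x \<in> A (Suc k)"
  shows "\<exists>t\<in>A (k - 1). e k * x * e k = t * e k"
proof (rule corner_aspan[OF subsetD[OF A_Suc_corner[OF assms(1,2)] assms(3)]])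
  fix b assume "b \<in> A k \<union> {a * e k * b |a b. a \<in> A k \<and> b \<in> A k}"
  then consider "b \<in> A k" | p q where "b = p * e k * q" "p \<in> A k" "q \<in> A k" by auto
  then show "\<exists>t\<in>A (k - 1). e k * b * e k = t * e k"
  proof cases
    case 2
    obtain t t' where t: "t \<in> A (k - 1)" "t' \<in> A (k - 1)"
      "e k * p * e k = t * e k" "e k * q * e k = t' * e k"
      using corner[OF assms(1,2)] 2 by meson
    have "e k * b * e k = e k * p * e k * q * e k" by (simp add: 2 mult.assoc)
    also have "\<dots> = t * (e k * q * e k)" unfolding t(3) by (simp add: mult.assoc)
    also have "\<dots> = t * t' * e k" unfolding t(4) by (simp add: mult.assoc)
    finally show ?thesis using A_mult[OF _ t(2,1)] assms by auto
  qed (use corner[OF assms(1,2)] in auto)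
qed (use assms in \<open>auto intro: alg_zero alg_add\<close>)

lemma Corner_one: "Corner (s 1) n"
  unfolding Corner_def
  using A_unit[of n] A_mult[of n] by (auto intro: alg_scal)

lemma Corner_step:
  assumes "Corner q m" "3 \<le> m" "m \<le> n"
  shows "Corner (q * e (m - 1)) (m - 2)"
proof -
  let ?e = "e (m - 1)"
  have q: "q \<in> A n" "\<And>x. x \<in> A n \<Longrightarrow> \<exists>t\<in>A m. q * x * q = q * t" "\<And>t. t \<in> A m \<Longrightarrow> q * t = t * q"
    using assms(1) by (auto simp: Corner_def)
  have em: "?e \<in> A m" and en: "?e \<in> A n" using assms by (auto intro!: A_e in_V)
  have qe: "q * ?e = ?e * q" using q(3)[OF em] .
  have e_comm: "t * ?e = ?e * t" if "t \<in> A (m - 2)" for t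
    using A_far[OF _ _ _ that, of "m - 1"] assms by auto
  have sub: "A (m - 2) \<subseteq> A m" by (rule A_mono) simp
  show ?thesis
    unfolding Corner_def
  proof (intro conjI ballI)
    show "q * ?e \<in> A n" by (rule A_mult[OF order_refl en q(1)])
    show "q * ?e * t = t * (q * ?e)" if "t \<in> A (m - 2)" for t
      using e_comm[OF that] q(3)[of t] that sub by (metis mult.assoc subsetD)
    fix x assume "x \<in> A n"
    then obtain t where t: "t \<in> A m" "q * x * q = q * t" using q(2) by blast
    have "m = Suc (m - 1)" "2 \<le> m - 1" "m - 1 < n" "m - 1 - 1 = m - 2" using assms by auto
    then obtain t' where t': "t' \<in> A (m - 2)" "?e * t * ?e = t' * ?e"
      using corner_Suc[of "m - 1" t] t by metis
    have "q * ?e * x * (q * ?e) = ?e * (q * x * q) * ?e" by (simp add: comm_left[OF qe] mult.assoc del: One_nat_def)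
    also have "\<dots> = q * (?e * t * ?e)" unfolding t by (simp add: comm_left[OF qe] mult.assoc del: One_nat_def)
    also have "\<dots> = q * ?e * t'" unfolding t' e_comm[OF t'(1)] by (simp add: mult.assoc)
    finally show "\<exists>t\<in>A (m - 2). q * ?e * x * (q * ?e) = q * ?e * t" using t' by blast
  qed
qed

definition span2 :: "'a set \<Rightarrow> 'a set" where
  "span2 P = aspan {a * p * b | a b p. a \<in> A n \<and> b \<in> A n \<and> p \<in> P}"

lemma span2_zero: "0 \<in> span2 P"
  by (simp add: span2_def aspan_zero)

lemma span2_add: "x \<in> span2 P \<Longrightarrow> y \<in> span2 P \<Longrightarrow> x + y \<in> span2 P"
  by (simp add: span2_def aspan_add)

lemma span2_mono: "P \<subseteq> Q \<Longrightarrow> span2 P \<subseteq> span2 Q"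
  unfolding span2_def by (rule aspan_mono) blast

lemma span2_base:
  assumes "p \<in> P" "p \<in> A n"
  shows "p \<in> span2 P"
proof -
  have "p = s 1 * p * s 1" using A_unit[OF _ assms(2)] by simp
  then show ?thesis unfolding span2_def using assms(1) by (blast intro: aspan_base alg_scal)
qed

lemma span2_mult:
  assumes "x \<in> span2 P" "a \<in> A n" "b \<in> A n"
  shows "a * x * b \<in> span2 P"
  using assms(1) unfolding span2_def
proof induction
  case (aspan_base y)
  then obtain c d p where y: "y = c * p * d" "c \<in> A n" "d \<in> A n" "p \<in> P" by auto
  then have "a * y * b = (a * c) * p * (d * b)" "a * c \<in> A n" "d * b \<in> A n"
    using assms(2,3) by (auto simp: mult.assoc intro!: A_mult)
  then show ?case using y by (intro aspan.aspan_base) blast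
qed (auto simp: algebra_simps intro: aspan.intros)

text \<open>Divisibility by \<open>q\<close> on both sides is recorded for the recursion: it makes
  the members below \<open>q * e (m - 1)\<close> orthogonal to \<open>q * jw m\<close>, since
  \<open>jw m\<close> kills \<open>e (m - 1)\<close>.\<close>

definition family :: "'a set \<Rightarrow> 'a \<Rightarrow> bool" where
  "family P q \<longleftrightarrow> finite P \<and> (\<forall>p\<in>P. p \<in> A n \<and> (\<exists>y\<in>A n. p = q * y) \<and> (\<exists>y\<in>A n. p = y * q)) \<and>
    (\<forall>p\<in>P. \<forall>p'\<in>P. p \<noteq> p' \<longrightarrow> (\<forall>x\<in>A n. p * x * p' = 0)) \<and>
    (\<forall>p\<in>P. \<forall>x\<in>A n. \<exists>c. p * x * p = s c * p) \<and> q \<in> span2 P"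

text \<open>Split \<open>q\<close> as \<open>q * jw m\<close> plus \<open>q * (s 1 - jw m)\<close>;
  the second part is spanned by elements \<open>a * (q * e i) * b\<close>, because \<open>q\<close>
  commutes with \<open>A m\<close>.\<close>

lemma jw_span2:
  assumes "Corner q m" "m \<le> n" "q * jw m \<in> span2 P" "\<And>i. i \<in> V m \<Longrightarrow> q * e i \<in> span2 P"
  shows "q \<in> span2 P"
proof -
  have q: "q \<in> A n" "\<And>t. t \<in> A m \<Longrightarrow> q * t = t * q"
    using assms(1) by (auto simp: Corner_def)
  have "s 1 - jw m \<in> {y. q * y \<in> span2 P}"
  proof (rule jw_ideal[OF assms(2)])
    fix i a b assume i: "i \<in> V m" "a \<in> A m" "b \<in> A m"
    then have "q * (a * e i * b) = a * (q * e i) * b" using q(2)[of a] by (metis mult.assoc)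
    then show "a * e i * b \<in> {y. q * y \<in> span2 P}"
      using span2_mult[OF assms(4)[OF i(1)]] i A_mono[OF assms(2)] by auto
  qed (auto simp: span2_zero distrib_left intro: span2_add)
  then have "q * (s 1 - jw m) + q * jw m \<in> span2 P" by (intro span2_add assms) simp
  moreover have "q * (s 1 - jw m) + q * jw m = q"
    using A_unit[OF _ q(1)] by (simp add: right_diff_distrib)
  ultimately show ?thesis by simp
qed

lemma jw_sandwich:
  assumes "m \<le> n" "\<And>j. 1 \<le> j \<Longrightarrow> j < m \<Longrightarrow> D j \<noteq> 0" "t \<in> A m"
  obtains c where "t * jw m = s c * jw m" "jw m * t = s c * jw m" "jw m * jw m = jw m"
proof -
  have z: "jw m \<in> A m" using assms(1) by (rule jw_mem)
  have u: "s 1 * jw m = jw m" "jw m * s 1 = jw m" using A_unit[OF assms(1) z] .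
  have k: "\<And>y. y \<in> e ` V m \<Longrightarrow> y * jw m = 0" "\<And>y. y \<in> e ` V m \<Longrightarrow> jw m * y = 0"
    using jw_kill(1,2)[OF assms(1,2)] by auto
  obtain c where c: "t * jw m = s c * jw m" using alg_scalar_left[OF k(1) assms(3)] by auto
  obtain d where "jw m * t = jw m * s d"
    using alg_scalar_right[OF central[OF assms(1)] k(2) assms(3)] by auto
  then have d: "jw m * t = s d * jw m" using A_cent[OF assms(1) z, of d] by simp
  have zz: "jw m * jw m = jw m" using k(1) u(1) assms(1) by (intro jw_left) auto
  \<comment> \<open>The scalars on the two sides agree, since both are the coefficient of
    \<open>jw m * t * jw m\<close>.\<close>
  have "s c * jw m = jw m * (t * jw m)"
    unfolding c using A_cent[OF assms(1) z, of c] zz by (metis mult.assoc)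
  also have "\<dots> = s d * jw m" using d zz by (metis mult.assoc)
  finally show thesis using that c d zz by auto
qed

text \<open>
  Below \<open>q\<close> with \<open>q A q = q (A m)\<close>, the family consists of \<open>q (jw m)\<close> and of a family below
  \<open>q' = q (e (m - 1))\<close>, which satisfies \<open>q' A q' = q' A (m - 2)\<close>.
\<close>

lemma family_exists:
  assumes "Corner q m" "1 \<le> m" "m \<le> n" "\<And>j. 1 \<le> j \<Longrightarrow> j < n \<Longrightarrow> D j \<noteq> 0"
  shows "\<exists>P. family P q"
  using assms
proof (induction m arbitrary: q rule: less_induct)
  case (less m)
  have q: "q \<in> A n" "\<And>x. x \<in> A n \<Longrightarrow> \<exists>t\<in>A m. q * x * q = q * t" "\<And>t. t \<in> A m \<Longrightarrow> q * t = t * q"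
    using less.prems(1) by (auto simp: Corner_def)
  note mn = less.prems(3)
  have nz: "\<And>j. 1 \<le> j \<Longrightarrow> j < m \<Longrightarrow> D j \<noteq> 0" using less.prems(4) mn by auto
  let ?z = "jw m"
  have z: "?z \<in> A m" "?z \<in> A n" using jw_mem[OF mn] A_mono[OF mn] by auto
  have qz: "q * ?z = ?z * q" using q(3) z by auto
  have qA: "q * x \<in> A n" if "x \<in> A n" for x using A_mult[OF order_refl that q(1)] .
  have qcent: "s c * q = q * s c" for c using A_cent[OF _ q(1)] by auto
  have zz: "\<exists>c. (q * ?z) * x * (q * ?z) = s c * (q * ?z)" if x: "x \<in> A n" for x
  proof -
    obtain t where t: "t \<in> A m" "q * x * q = q * t" using q(2) x by blast
    obtain c where c: "?z * t = s c * ?z" "?z * ?z = ?z" using jw_sandwich[OF mn nz t(1)] by metis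
    have "(q * ?z) * x * (q * ?z) = ?z * (q * x * q) * ?z" by (simp add: comm_left[OF qz] mult.assoc)
    also have "\<dots> = q * (?z * t) * ?z" unfolding t by (simp add: comm_left[OF qz] mult.assoc)
    also have "\<dots> = s c * (q * ?z)"
      unfolding c(1) by (simp add: c(2) mult.assoc comm_left[OF qcent[of c, symmetric]])
    finally show ?thesis by blast
  qed
  consider "m = 1" | "m = 2" | "3 \<le> m" using less.prems(2) by linarith
  then show ?case
  proof cases
    case 1
    have "family {q} q"
      unfolding family_def
    proof (intro conjI ballI)
      fix p assume "p \<in> {q}"
      then show "p \<in> A n" "\<exists>y\<in>A n. p = q * y" "\<exists>y\<in>A n. p = y * q"
        using q(1) A_unit[OF _ q(1)] by (auto intro!: bexI[of _ "s 1"] alg_scal)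
      fix x assume x: "x \<in> A n"
      obtain c where "q * x * q = q * s c" using q(2)[OF x] 1 A_1 by auto
      then show "\<exists>c. p * x * p = s c * p" using \<open>p \<in> {q}\<close> qcent by auto
    qed (auto intro: span2_base q)
    then show ?thesis by blast
  next
    \<comment> \<open>With two strands left the generators are those of the fork. Being orthogonal,
      they contribute separate members \<open>q * e i\<close>, one for each \<open>i\<close> in
      \<open>G\<close>.\<close>
    case 2
    have n2: "2 \<le> n" using 2 mn by simp
    have GV: "i \<in> V m" "i \<in> V n" if "i \<in> G" for i using that V_2 2 V_mono[OF mn] by auto
    have eA: "e i \<in> A m" "e i \<in> A n" if "i \<in> G" for i using A_e mn GV[OF that] by auto
    have kill: "e i * ?z = 0" "?z * e i = 0" if "i \<in> G" for i
      using jw_kill(1,2)[OF mn nz] GV[OF that] by auto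
    have ee: "\<exists>c. e i * t = s c * e i" if i: "i \<in> G" and t: "t \<in> A 2" for i t
      using t
    proof (induction rule: alg.induct)
      case (alg_scal c)
      then show ?case using cent[OF GV(2)[OF i], of c] by metis
    next
      case (alg_add x y)
      then show ?case by (metis s_add distrib_left distrib_right)
    next
      case (alg_step x y)
      then obtain c j where cj: "e i * x = s c * e i" "y = e j" "j \<in> G" by (auto simp: V_2)
      have "e i * (x * y) = s c * (e i * e j)" using cj by (metis mult.assoc)
      then show ?case
        using sq[OF GV(2)[OF i]] orth[OF n2 i cj(3)] s_s_left by (cases "i = j") (metis, metis s_zero mult_zero_left mult_zero_right)
    qed
    have q_e: "q * e i * x * (q * e j) = q * (e i * t * e j)"
      if "i \<in> G" "t \<in> A m" "q * x * q = q * t" for i j x t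
    proof -
      have "q * e i * x * (q * e j) = e i * (q * x * q) * e j"
        by (simp add: mult.assoc comm_left[OF q(3)[OF eA(1)[OF that(1)]]])
      then show ?thesis unfolding that(3) by (simp add: mult.assoc comm_left[OF q(3)[OF eA(1)[OF that(1)]]])
    qed
    have "family (insert (q * ?z) ((\<lambda>i. q * e i) ` G)) q"
      unfolding family_def
    proof (intro conjI ballI impI)
      show "q \<in> span2 (insert (q * ?z) ((\<lambda>i. q * e i) ` G))"
      proof (rule jw_span2[OF less.prems(1) mn])
        fix i assume "i \<in> V m"
        then show "q * e i \<in> span2 (insert (q * ?z) ((\<lambda>i. q * e i) ` G))"
          using V_2 2 qA eA by (intro span2_base) auto
      qed (auto intro!: span2_base qA z)
    next
      fix p assume p: "p \<in> insert (q * ?z) ((\<lambda>i. q * e i) ` G)"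
      then obtain y where y: "p = q * y" "y \<in> A m" "y = ?z \<or> y \<in> e ` G" using z eA by auto
      have yn: "y \<in> A n" using y A_mono[OF mn] by auto
      show "p \<in> A n" using qA[OF yn] y by simp
      show "\<exists>y\<in>A n. p = q * y" using yn y by blast
      show "\<exists>y\<in>A n. p = y * q" using yn y q(3)[OF y(2)] by metis
      fix x assume x: "x \<in> A n"
      obtain t where t: "t \<in> A m" "q * x * q = q * t" using q(2) x by blast
      have "\<exists>c. q * e i * x * (q * e i) = s c * (q * e i)" if i: "i \<in> G" for i
      proof -
        obtain c where "e i * t = s c * e i" using ee[OF i] t 2 by auto
        then have "q * e i * x * (q * e i) = q * (s c * (e i * e i))"
          unfolding q_e[OF i t] by (simp add: mult.assoc)
        also have "\<dots> = s (c * \<delta>) * (q * e i)"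
          unfolding sq[OF GV(2)[OF i]] s_s_left by (simp add: comm_left[OF qcent[symmetric]])
        finally show ?thesis by blast
      qed
      then show "\<exists>c. p * x * p = s c * p" using p zz[OF x] by auto
      fix p' assume p': "p' \<in> insert (q * ?z) ((\<lambda>i. q * e i) ` G)" "p \<noteq> p'"
      consider i j where "p = q * e i" "p' = q * e j" "i \<in> G" "j \<in> G" "i \<noteq> j"
        | i where "p = q * e i" "p' = q * ?z" "i \<in> G"
        | i where "p = q * ?z" "p' = q * e i" "i \<in> G"
        using p p' by blast
      then show "p * x * p' = 0"
      proof cases
        case 1
        obtain c where "e i * t = s c * e i" using ee[OF 1(3)] t 2 by auto
        then have "p * x * p' = q * (s c * (e i * e j))" using 1 q_e[OF 1(3) t] by (simp add: mult.assoc)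
        then show ?thesis using orth[OF n2] 1 by simp
      next
        case (2 i)
        obtain c where c: "e i * t = s c * e i" using ee[OF 2(3)] t \<open>m = 2\<close> by auto
        have "p * x * p' = e i * (q * x * q) * ?z"
          unfolding 2 by (simp add: mult.assoc comm_left[OF q(3)[OF eA(1)[OF 2(3)]]])
        also have "\<dots> = q * (e i * t) * ?z"
          unfolding t by (simp add: mult.assoc comm_left[OF q(3)[OF eA(1)[OF 2(3)]]])
        also have "\<dots> = 0" unfolding c by (simp add: mult.assoc kill 2)
        finally show ?thesis .
      next
        case (3 i)
        obtain c where c: "?z * t = s c * ?z" using jw_sandwich[OF mn nz t(1)] by metis
        have "p * x * p' = ?z * (q * x * q) * e i"
          unfolding 3 by (simp add: mult.assoc comm_left[OF qz])
        also have "\<dots> = q * (?z * t) * e i" unfolding t by (simp add: mult.assoc comm_left[OF qz])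
        also have "\<dots> = 0" unfolding c by (simp add: mult.assoc kill 3)
        finally show ?thesis .
      qed
    qed auto
    then show ?thesis by blast
  next
    case 3
    let ?e = "e (m - 1)"
    have eA: "?e \<in> A m" "?e \<in> A n" and eV: "m - 1 \<in> V m" using mn 3 by (auto intro!: A_e in_V)
    have kill: "?e * ?z = 0" "?z * ?e = 0" using jw_kill(1,2)[OF mn nz eV] by auto
    have qe: "q * ?e = ?e * q" using q(3) eA by auto
    have "\<exists>P. family P (q * ?e)"
      by (rule less.IH[OF _ Corner_step[OF less.prems(1) 3 mn] _ _ less.prems(4)]) (use 3 mn in simp_all)
    then obtain P where P: "family P (q * ?e)" ..
    let ?P = "insert (q * ?z) P"
    have PA: "p \<in> A n" "\<exists>y\<in>A n. p = q * ?e * y" "\<exists>y\<in>A n. p = y * (q * ?e)" if "p \<in> P" for p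
      using P that by (auto simp: family_def)
    have "family ?P q"
      unfolding family_def
    proof (intro conjI ballI impI)
      show "finite ?P" using P by (simp add: family_def)
      show "q \<in> span2 ?P"
      proof (rule jw_span2[OF less.prems(1) mn])
        show "q * ?z \<in> span2 ?P" by (auto intro!: span2_base qA z)
        have top: "q * ?e \<in> span2 ?P" using P span2_mono[of P ?P] by (auto simp: family_def)
        \<comment> \<open>The relation \<open>e i * e j * e i = e i\<close> carries membership to a
          neighbour, hence from \<open>e (m - 1)\<close> down the chain and finally into the
          fork.\<close>
        have step: "q * e i \<in> span2 ?P"
          if "q * e j \<in> span2 ?P" "2 \<le> j" "j < m" "i \<in> V j" "i \<notin> V (j - 1)" for i j
        proof -
          have i: "e i \<in> A m" using A_e[OF mn] that V_mono[of j m] by (simp add: subset_iff)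
          have "q * e i = q * (e i * e j * e i)"
            using braid1[of j i] that mn by simp
          also have "\<dots> = e i * (q * e j) * e i" using q(3)[OF i] by (metis mult.assoc)
          finally show ?thesis using span2_mult[OF that(1)] i A_mono[OF mn] by auto
        qed
        have low: "q * e j \<in> span2 ?P" if "2 \<le> j" "j \<le> m - 1" for j
          using that(2,1)
        proof (induction rule: inc_induct)
          case (step j)
          then show ?case using \<open>\<And>i j. \<lbrakk>q * e j \<in> span2 ?P; 2 \<le> j; j < m; i \<in> V j; i \<notin> V (j - 1)\<rbrakk> \<Longrightarrow> q * e i \<in> span2 ?P\<close>[of "Suc j" j]
            G_sub by (force simp: gen_index_def)
        qed (rule top)
        fix i assume i: "i \<in> V m"
        show "q * e i \<in> span2 ?P"
        proof (cases "2 \<le> i")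
          case True
          then show ?thesis using i G_sub by (intro low) (auto simp: gen_index_def)
        next
          case False
          then show ?thesis using i 3 by (intro step[OF low[of 2]]) (auto simp: gen_index_def)
        qed
      qed
      fix p assume p: "p \<in> ?P"
      show "p \<in> A n" using p PA qA z by auto
      show "\<exists>y\<in>A n. p = q * y"
      proof (cases "p \<in> P")
        case True
        then obtain y where "y \<in> A n" "p = q * (?e * y)" using PA by (metis mult.assoc)
        then show ?thesis using A_mult[OF order_refl _ eA(2)] by auto
      qed (use p z in auto)
      show "\<exists>y\<in>A n. p = y * q"
      proof (cases "p \<in> P")
        case True
        then obtain y where "y \<in> A n" "p = y * ?e * q" using PA qe by (metis mult.assoc)
        then show ?thesis using A_mult[OF order_refl eA(2)] by auto
      qed (use p z qz in auto)
      fix x assume x: "x \<in> A n"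
      show "\<exists>c. p * x * p = s c * p" using p P zz[OF x] x by (auto simp: family_def)
      obtain t where t: "t \<in> A m" "q * x * q = q * t" using q(2) x by blast
      obtain c where c: "t * ?z = s c * ?z" "?z * t = s c * ?z" using jw_sandwich[OF mn nz t(1)] by metis
      fix p' assume p': "p' \<in> ?P" "p \<noteq> p'"
      consider "p \<in> P" "p' \<in> P" | "p \<in> P" "p' = q * ?z" | "p = q * ?z" "p' \<in> P" using p p' by blast
      then show "p * x * p' = 0"
      proof cases
        case 1
        then show ?thesis using P x p' by (simp add: family_def)
      next
        case 2
        \<comment> \<open>The recorded factorisation is used here: after compression
          \<open>t\<close> acts on \<open>jw m\<close> as a scalar, and \<open>e (m - 1)\<close>
          meets \<open>jw m\<close>.\<close>
        then obtain y where y: "p = y * (q * ?e)" using PA by blast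
        have "p * x * p' = y * ?e * (q * x * q) * ?z" unfolding y 2 by (simp add: mult.assoc comm_left[OF qe] del: One_nat_def)
        also have "\<dots> = y * ?e * q * (t * ?z)" unfolding t by (simp add: mult.assoc)
        also have "\<dots> = y * q * (?e * (s c * ?z))" unfolding c by (simp add: mult.assoc comm_left[OF qe] del: One_nat_def)
        also have "\<dots> = 0" using cent_left[of "m - 1"] eV V_mono[OF mn] kill by auto
        finally show ?thesis .
      next
        case 3
        then obtain y where y: "p' = q * ?e * y" using PA by blast
        have "p * x * p' = ?z * (q * x * q) * ?e * y" unfolding y 3 by (simp add: mult.assoc comm_left[OF qz])
        also have "\<dots> = q * (?z * t) * ?e * y" unfolding t by (simp add: mult.assoc comm_left[OF qz])
        also have "\<dots> = q * (s c * (?z * ?e)) * y" unfolding c by (simp add: mult.assoc)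
        finally show ?thesis using kill by simp
      qed
    qed
    then show ?thesis by blast
  qed
qed

end

section \<open>The ideal generated by \<open>e\<^sub>0 e\<^sub>1\<close>\<close>

definition D_adj :: "nat \<Rightarrow> nat \<Rightarrow> bool" where
  "D_adj i j \<longleftrightarrow> i < 2 \<and> j = 2 \<or> j < 2 \<and> i = 2 \<or> 2 \<le> i \<and> j = Suc i \<or> 2 \<le> j \<and> i = Suc j"

locale TLD_rel = scalars s for s :: "'r::field \<Rightarrow> 'a::ring" +
  fixes e :: "nat \<Rightarrow> 'a" and n :: nat and \<delta> :: 'r
  assumes n4: "4 \<le> n"
    and unit: "i < n \<Longrightarrow> s 1 * e i = e i"
    and cent: "i < n \<Longrightarrow> s c * e i = e i * s c"
    and sq: "i < n \<Longrightarrow> e i * e i = s \<delta> * e i"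
    and far: "i < n \<Longrightarrow> j < n \<Longrightarrow> i \<noteq> j \<Longrightarrow> \<not> D_adj i j \<Longrightarrow> e i * e j = e j * e i"
    and braid: "i < n \<Longrightarrow> j < n \<Longrightarrow> D_adj i j \<Longrightarrow> e i * e j * e i = e i"
begin

abbreviation S :: "'a set" where "S \<equiv> alg (e ` {..<n})"

lemma central: "central_on (e ` {..<n})"
  by (auto simp: central_on_def unit intro: cent)

lemmas S_mult = alg_mult[OF central]
lemmas S_cent = alg_cent[OF central]
lemmas S_unit = alg_unit[OF central]
lemmas S_diff = alg_diff[OF central]

lemma S_e: "i < n \<Longrightarrow> e i \<in> S"
  by (rule alg_gen[OF central]) simp

lemma sub_S: "X \<subseteq> e ` {..<n} \<Longrightarrow> alg X \<subseteq> S"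
  by (rule alg_mono)

text \<open>
  The numbering is reversed so that \<open>e\<^sub>2\<close> becomes the last and \<open>e (n - 1)\<close> the first
  generator of a chain of type A.
\<close>

interpretation R: TL_rel s "\<lambda>j. e (n - j)" "{Suc 0}" "n - 1" \<delta>
proof
  have lt: "n - i < n" if "i \<in> gen_index {Suc 0} (n - 1)" for i
    using that n4 by (auto simp: gen_index_def)
  show "s 1 * e (n - i) = e (n - i)" "s c * e (n - i) = e (n - i) * s c"
    "e (n - i) * e (n - i) = s \<delta> * e (n - i)" if "i \<in> gen_index {Suc 0} (n - 1)" for i c
    using lt[OF that] by (auto intro: unit cent sq)
qed (auto simp: gen_index_def D_adj_def intro!: far braid)

interpretation L: TL_rel s e "{Suc 0}" n \<delta>
  by standard (auto simp: gen_index_def D_adj_def intro!: far braid unit cent sq)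

text \<open>In the original numbering \<open>U2\<close> is generated by
  \<open>e 2, ..., e (n - 1)\<close> and \<open>U3\<close> by \<open>e 3, ..., e (n - 1)\<close>. So
  \<open>U3\<close> commutes with \<open>e 0\<close> and \<open>e 1\<close>, and the passage from
  \<open>U3\<close> to \<open>U2\<close> adjoins \<open>e 2\<close>, which makes the spanning set
  for type A applicable.\<close>

abbreviation "U3 \<equiv> R.A (n - 2)"
abbreviation "U2 \<equiv> R.A (n - 1)"
abbreviation "w \<equiv> e 0 * e 1"

lemma U_sub: "U3 \<subseteq> U2" "U2 \<subseteq> S" "U2 \<subseteq> L.A n"
proof -
  show "U3 \<subseteq> U2" by (rule R.A_mono) simp
  show "U2 \<subseteq> S" using n4 by (intro sub_S) (auto simp: gen_index_def)
  show "U2 \<subseteq> L.A n" using n4 by (intro alg_mono) (auto simp: gen_index_def gen_index_def)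
qed

lemma e_U2:
  assumes "2 \<le> i" "i < n"
  shows "e i \<in> U2"
proof -
  have "n - i \<in> R.V (n - 1)" "n - (n - i) = i" using assms n4 by (auto simp: gen_index_def)
  then show ?thesis using R.A_e[of "n - 1" "n - i"] by simp
qed

lemma U3_comm:
  assumes "t \<in> U3" "i < 2"
  shows "t * e i = e i * t"
proof (rule alg_commute[OF _ _ assms(1)])
  show "s c * e i = e i * s c" for c using assms n4 by (intro cent) auto
  show "y * e i = e i * y" if "y \<in> (\<lambda>j. e (n - j)) ` R.V (n - 2)" for y
    using that assms n4 by (auto simp: gen_index_def D_adj_def intro!: far)
qed

lemma w_comm: "e 0 * e 1 = e 1 * e 0"
  using n4 by (intro far) (auto simp: D_adj_def)

lemma U3_w: "t \<in> U3 \<Longrightarrow> t * w = w * t"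
  using U3_comm[of t 0] U3_comm[of t 1] by (metis mult.assoc zero_less_numeral one_less_numeral_iff semiring_norm(76))

lemma w_s: "s c * w = w * s c"
  using S_cent[OF S_mult[OF S_e S_e], of 1 0 c] n4 by simp

lemma w_e: "w * e 0 = s \<delta> * w" "w * e 1 = s \<delta> * w" "e 0 * w = s \<delta> * w" "e 1 * w = s \<delta> * w"
proof -
  have "e 0 * e 0 = s \<delta> * e 0" "e 1 * e 1 = s \<delta> * e 1" "s \<delta> * e 0 = e 0 * s \<delta>" "s \<delta> * e 1 = e 1 * s \<delta>"
    using sq[of 0] sq[of 1] cent[of 0 \<delta>] cent[of 1 \<delta>] n4 by auto
  then show "w * e 0 = s \<delta> * w" "w * e 1 = s \<delta> * w" "e 0 * w = s \<delta> * w" "e 1 * w = s \<delta> * w"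
    using w_comm by (metis mult.assoc)+
qed

lemma w_2: "w * e 2 * e 0 = w" "w * e 2 * e 1 = w" "e 0 * e 2 * w = w" "e 1 * e 2 * w = w"
proof -
  have "e 0 * e 2 * e 0 = e 0" "e 1 * e 2 * e 1 = e 1"
    using n4 by (auto intro!: braid simp: D_adj_def)
  then show "w * e 2 * e 0 = w" "w * e 2 * e 1 = w" "e 0 * e 2 * w = w" "e 1 * e 2 * w = w"
    using w_comm by (metis mult.assoc)+
qed

lemma U2_aspan: "U2 \<subseteq> aspan (U3 \<union> {a * e 2 * b | a b. a \<in> U3 \<and> b \<in> U3})"
proof -
  have "Suc (n - 2) = n - 1" "n - (n - 2) = 2" using n4 by auto
  then show ?thesis using R.A_Suc_corner[of "n - 2"] n4 by auto
qed

lemma U3_n: "n - 2 \<le> n - 1"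
  by simp

text \<open>Source of the equality of \<open>e 0\<close> and \<open>e 1\<close> on the ideal. An
  element of \<open>U2\<close> contains \<open>e 2\<close> at most once; without it
  \<open>w * e i = s \<delta> * w\<close>, and with it \<open>w * e 2 * e i = w\<close>. Neither
  result depends on which of 0 and 1 the index \<open>i\<close> is.\<close>

lemma w_U2_e:
  assumes "b \<in> U2"
  shows "\<exists>t\<in>U3. w * b * e 0 = w * t \<and> w * b * e 1 = w * t"
  using subsetD[OF U2_aspan assms]
proof induction
  case aspan_zero
  then show ?case by (intro bexI[of _ 0]) (auto intro: alg_zero)
next
  case (aspan_add x y)
  then obtain t t' where "t \<in> U3" "t' \<in> U3" "w * x * e 0 = w * t" "w * x * e 1 = w * t"
    "w * y * e 0 = w * t'" "w * y * e 1 = w * t'" by blast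
  then show ?case by (intro bexI[of _ "t + t'"]) (simp_all add: distrib_left distrib_right alg_add)
next
  case (aspan_base b)
  then consider "b \<in> U3" | p q where "b = p * e 2 * q" "p \<in> U3" "q \<in> U3" by blast
  then show ?case
  proof cases
    case 1
    have "w * b * e i = w * (s \<delta> * b)" if "i < 2" "w * e i = s \<delta> * w" for i
    proof -
      have "w * b * e i = w * e i * b" using U3_comm[OF 1 that(1)] by (simp add: mult.assoc)
      also have "\<dots> = w * s \<delta> * b" unfolding that(2) w_s ..
      also have "\<dots> = w * (s \<delta> * b)" by (rule mult.assoc)
      finally show ?thesis .
    qed
    then show ?thesis using w_e R.A_mult[OF U3_n 1 alg_scal[of \<delta>]] by auto
  next
    case 2
    have "w * b * e i = w * (p * q)" if "i < 2" "w * e 2 * e i = w" for i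
    proof -
      have "w * b * e i = (w * p) * e 2 * (q * e i)" unfolding 2 by (simp add: mult.assoc)
      also have "\<dots> = p * (w * e 2 * e i) * q"
        unfolding U3_comm[OF 2(3) that(1)] U3_w[OF 2(2), symmetric] by (simp add: mult.assoc)
      also have "\<dots> = w * (p * q)" unfolding that(2) U3_w[OF 2(2)] by (simp add: mult.assoc)
      finally show ?thesis .
    qed
    then show ?thesis using w_2 R.A_mult[OF U3_n 2(3,2)] by auto
  qed
qed

lemma e_U2_w:
  assumes "b \<in> U2"
  shows "\<exists>t\<in>U3. e 0 * b * w = t * w \<and> e 1 * b * w = t * w"
  using subsetD[OF U2_aspan assms]
proof induction
  case aspan_zero
  then show ?case by (intro bexI[of _ 0]) (auto intro: alg_zero)
next
  case (aspan_add x y)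
  then obtain t t' where "t \<in> U3" "t' \<in> U3" "e 0 * x * w = t * w" "e 1 * x * w = t * w"
    "e 0 * y * w = t' * w" "e 1 * y * w = t' * w" by blast
  then show ?case by (intro bexI[of _ "t + t'"]) (simp_all add: distrib_left distrib_right alg_add)
next
  case (aspan_base b)
  then consider "b \<in> U3" | p q where "b = p * e 2 * q" "p \<in> U3" "q \<in> U3" by blast
  then show ?case
  proof cases
    case 1
    have "e i * b * w = b * s \<delta> * w" if "i < 2" "e i * w = s \<delta> * w" for i
    proof -
      have "e i * b * w = b * (e i * w)" unfolding U3_comm[OF 1 that(1), symmetric] by (simp add: mult.assoc)
      then show ?thesis unfolding that(2) by (simp add: mult.assoc)
    qed
    then show ?thesis using w_e R.A_mult[OF U3_n alg_scal[of \<delta>] 1] by auto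
  next
    case 2
    have "e i * b * w = p * q * w" if "i < 2" "e i * e 2 * w = w" for i
    proof -
      have "e i * b * w = (e i * p) * e 2 * (q * w)" unfolding 2 by (simp add: mult.assoc)
      also have "\<dots> = p * (e i * e 2 * w) * q"
        unfolding U3_comm[OF 2(2) that(1), symmetric] U3_w[OF 2(3)] by (simp add: mult.assoc)
      also have "\<dots> = p * q * w" unfolding that(2) using U3_w[OF 2(3)] by (simp add: mult.assoc)
      finally show ?thesis .
    qed
    then show ?thesis using w_2 R.A_mult[OF U3_n 2(3,2)] by auto
  qed
qed

text \<open>Only \<open>U2\<close> stands around \<open>w\<close>: by the two preceding lemmas a
  further factor \<open>e 0\<close> or \<open>e 1\<close> is absorbed, so this is already a
  two-sided ideal of the whole algebra.\<close>

definition I :: "'a set" where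
  "I = aspan {b * w * b' | b b'. b \<in> U2 \<and> b' \<in> U2}"

lemma I_add: "x \<in> I \<Longrightarrow> y \<in> I \<Longrightarrow> x + y \<in> I"
  by (simp add: I_def aspan_add)

lemma I_zero: "0 \<in> I"
  by (simp add: I_def aspan_zero)

lemma I_base: "b \<in> U2 \<Longrightarrow> b' \<in> U2 \<Longrightarrow> b * w * b' \<in> I"
  unfolding I_def by (rule aspan_base) blast

lemma I_induct [consumes 1, case_names zero base add]:
  assumes "x \<in> I" "P 0" "\<And>b b'. b \<in> U2 \<Longrightarrow> b' \<in> U2 \<Longrightarrow> P (b * w * b')" "\<And>x y. P x \<Longrightarrow> P y \<Longrightarrow> P (x + y)"
  shows "P x"
  using assms(1) unfolding I_def by induction (use assms in auto)

lemma I_sub: "x \<in> I \<Longrightarrow> x \<in> S"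
  by (induction rule: I_induct)
    (use n4 U_sub in \<open>auto intro!: alg_zero alg_add S_mult S_e\<close>)

lemma I_right_e:
  assumes "x \<in> I" "i < n"
  shows "x * e i \<in> I \<and> x * e 0 = x * e 1"
  using assms(1)
proof (induction rule: I_induct)
  case (base b b')
  obtain t where t: "t \<in> U3" "w * b' * e 0 = w * t" "w * b' * e 1 = w * t"
    using w_U2_e[OF base(2)] by blast
  have *: "b * w * b' * e j = b * w * t" if "j = 0 \<or> j = 1" for j
    using t that by (auto simp: mult.assoc)
  show ?case
  proof (cases "2 \<le> i")
    case True
    have "b * w * b' * e i = b * w * (b' * e i)" by (simp add: mult.assoc)
    moreover have "b' * e i \<in> U2" using R.A_mult[OF _ e_U2 base(2)] True assms by auto
    ultimately show ?thesis using * I_base base by auto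
  next
    case False
    then have "i = 0 \<or> i = 1" by auto
    then show ?thesis using * I_base[OF base(1)] t U_sub by auto
  qed
qed (auto simp: I_zero distrib_right intro: I_add)

lemma I_left_e:
  assumes "x \<in> I" "i < n"
  shows "e i * x \<in> I \<and> e 0 * x = e 1 * x"
  using assms(1)
proof (induction rule: I_induct)
  case (base b b')
  obtain t where t: "t \<in> U3" "e 0 * b * w = t * w" "e 1 * b * w = t * w"
    using e_U2_w[OF base(1)] by blast
  have *: "e j * (b * w * b') = t * w * b'" if "j = 0 \<or> j = 1" for j
  proof -
    have "e j * (b * w * b') = e j * b * w * b'" by (simp add: mult.assoc)
    then show ?thesis using t that by auto
  qed
  show ?case
  proof (cases "2 \<le> i")
    case True
    have "e i * (b * w * b') = e i * b * w * b'" by (simp add: mult.assoc)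
    moreover have "e i * b \<in> U2" using R.A_mult[OF _ base(1) e_U2] True assms by auto
    ultimately show ?thesis using * I_base base by auto
  next
    case False
    then have "i = 0 \<or> i = 1" by auto
    then show ?thesis using * I_base[OF _ base(2)] t U_sub by auto
  qed
qed (auto simp: I_zero distrib_left intro: I_add)

lemma I_right:
  assumes "x \<in> I" "a \<in> S"
  shows "x * a \<in> I"
  using assms(2)
proof (induction rule: alg.induct)
  case (alg_scal c)
  from assms(1) show ?case
  proof (induction rule: I_induct)
    case (base b b')
    have "b' * s c \<in> U2" by (rule R.A_mult[OF order_refl alg.alg_scal base(2)])
    then show ?case using I_base[OF base(1)] by (simp add: mult.assoc)
  qed (auto simp: I_zero distrib_right intro: I_add)
qed (use I_right_e in \<open>auto simp: distrib_left I_add simp flip: mult.assoc\<close>)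

lemma I_left_scal:
  assumes "x \<in> I"
  shows "s c * x \<in> I"
  using I_right[OF assms alg_scal] S_cent[OF I_sub[OF assms]] by metis

lemma I_left:
  assumes "x \<in> I" "a \<in> S"
  shows "a * x \<in> I"
  using assms(2,1)
proof (induction arbitrary: x rule: alg.induct)
  case (alg_step a y)
  then obtain i where "i < n" "y = e i" by auto
  then show ?case using alg_step.IH[of "y * x"] I_left_e[OF alg_step.prems] by (simp add: mult.assoc)
qed (auto simp: distrib_right I_add I_left_scal)

lemma w_I: "w \<in> I"
proof -
  have "w = s 1 * w * s 1" using S_unit[OF S_mult[OF S_e S_e], of 1 0] n4 by simp
  then show ?thesis using I_base[OF alg_scal alg_scal] by metis
qed

text \<open>Behind \<open>w * a\<close> the letter \<open>e 0\<close> may be replaced by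
  \<open>e 1\<close>, so the final \<open>w\<close> becomes \<open>e 1 * e 1\<close>, which vanishes
  for \<delta> = 0.\<close>

lemma w_S_w:
  assumes "\<delta> = 0" "a \<in> S"
  shows "w * a * w = 0"
proof -
  have x: "w * a \<in> I" by (rule I_right[OF w_I assms(2)])
  have "w * a * w = (w * a * e 0) * e 1" by (simp add: mult.assoc)
  also have "\<dots> = w * a * (e 1 * e 1)" using I_right_e[OF x, of 0] n4 by (simp add: mult.assoc)
  also have "\<dots> = 0" using sq[of 1] n4 by (simp add: assms)
  finally show ?thesis .
qed

text \<open>For \<open>i = 1\<close> take \<open>w\<close> divided by \<delta>: on the ideal
  \<open>w\<close> acts like \<open>e 1 * e 1\<close>. Conjugating the element for \<open>i\<close>
  by \<open>e (i + 1)\<close> gives the one for \<open>i + 1\<close>, by the braid relation.\<close>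

lemma I_e_match:
  assumes d: "\<delta> \<noteq> 0" and i: "1 \<le> i" "i < n"
  shows "\<exists>y\<in>I. \<forall>x\<in>I. x * y = x * e i \<and> y * x = e i * x"
  using i
proof (induction i rule: nat_induct_at_least)
  case base
  have dd: "s (1 / \<delta>) * (s \<delta> * y) = s 1 * y" for y using d by (simp add: s_s_left)
  show ?case
  proof (intro bexI[of _ "s (1 / \<delta>) * w"] ballI)
    show "s (1 / \<delta>) * w \<in> I" by (rule I_left_scal[OF w_I])
    fix x assume x: "x \<in> I"
    have u: "s 1 * e 1 = e 1" "e 1 * s (1 / \<delta>) = s (1 / \<delta>) * e 1" using unit[of 1] cent[of 1 "1 / \<delta>"] n4 by auto
    have "x * e 0 = x * e 1" "e 0 * x = e 1 * x"
      using I_right_e[OF x, of 0] I_left_e[OF x, of 0] n4 by auto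
    then have "x * w = x * (e 1 * e 1)" "w * x = e 1 * e 1 * x"
      using w_comm by (metis mult.assoc)+
    then have xw: "x * w = x * (s \<delta> * e 1)" "w * x = s \<delta> * e 1 * x" using sq[of 1] n4 by auto
    have "x * (s (1 / \<delta>) * w) = s (1 / \<delta>) * (x * w)"
      using S_cent[OF I_sub[OF x], of "1 / \<delta>"] by (simp flip: mult.assoc)
    also have "\<dots> = x * (s (1 / \<delta>) * (s \<delta> * e 1))"
      unfolding xw using S_cent[OF I_sub[OF x], of "1 / \<delta>"] by (simp flip: mult.assoc)
    finally have 1: "x * (s (1 / \<delta>) * w) = x * e 1" using dd u by simp
    have "s (1 / \<delta>) * w * x = e 1 * x" using xw dd u by (metis mult.assoc)
    then show "x * (s (1 / \<delta>) * w) = x * e 1 \<and> s (1 / \<delta>) * w * x = e 1 * x" using 1 by simp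
  qed
next
  case (Suc i)
  then obtain y where y: "y \<in> I" "\<And>x. x \<in> I \<Longrightarrow> x * y = x * e i \<and> y * x = e i * x" by auto
  let ?f = "e (Suc i)"
  have b: "?f * e i * ?f = ?f" using Suc by (intro braid) (auto simp: D_adj_def)
  have fS: "?f \<in> S" using Suc by (intro S_e) auto
  show ?case
  proof (intro bexI[of _ "?f * y * ?f"] ballI)
    show "?f * y * ?f \<in> I" by (intro I_right I_left y fS)
    fix x assume x: "x \<in> I"
    have "x * (?f * y * ?f) = (x * ?f * y) * ?f" by (simp add: mult.assoc)
    also have "\<dots> = x * (?f * e i * ?f)" using y(2)[OF I_right[OF x fS]] by (simp add: mult.assoc)
    finally have 1: "x * (?f * y * ?f) = x * ?f" unfolding b .
    have "(?f * y * ?f) * x = ?f * (y * (?f * x))" by (simp add: mult.assoc)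
    also have "\<dots> = (?f * e i * ?f) * x" using y(2)[OF I_left[OF x fS]] by (simp add: mult.assoc)
    finally show "x * (?f * y * ?f) = x * ?f \<and> ?f * y * ?f * x = ?f * x" using 1 unfolding b by simp
  qed
qed

text \<open>
  Every generator \<open>e\<^sub>i\<close> acts on \<open>I\<close> from both sides like some element of \<open>I\<close>, hence so does \<open>1 - z\<close>
  with \<open>z\<close> the type A Jones-Wenzl element. As \<open>z\<close> annihilates \<open>I\<close>, this element of \<open>I\<close> is a unit.
\<close>

lemma I_unit:
  assumes "\<And>j. 1 \<le> j \<Longrightarrow> j < n \<Longrightarrow> cheb 1 \<delta> j \<noteq> 0"
  obtains c where "c \<in> I" "\<And>x. x \<in> I \<Longrightarrow> x * c = x" "\<And>x. x \<in> I \<Longrightarrow> c * x = x"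
proof -
  have d: "\<delta> \<noteq> 0" using assms[of 1] n4 by simp
  have nz: "cheb (card {Suc 0}) \<delta> j \<noteq> 0" if "1 \<le> j" "j < n" for j using assms[OF that] by simp
  let ?z = "L.jw n"
  have LS: "L.A n \<subseteq> S" by (rule alg_mono) (auto simp: gen_index_def)
  have kill: "e 1 * ?z = 0" "?z * e 1 = 0"
    using L.jw_kill(1,2)[of n 1] nz n4 by (auto simp: gen_index_def)
  \<comment> \<open>The factors \<open>b\<close> and \<open>b'\<close> lie in the type A algebra, so
    next to the Jones-Wenzl element they are scalars; the adjacent \<open>e 1\<close> of
    \<open>w\<close> is then killed. The commuting factors of \<open>w\<close> are ordered as
    required.\<close>
  have z0: "x * ?z = 0 \<and> ?z * x = 0" if "x \<in> I" for x
    using that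
  proof (induction rule: I_induct)
    case (base b b')
    have bb: "b \<in> L.A n" "b' \<in> L.A n" using base U_sub by auto
    obtain c where c: "?z * b = s c * ?z" using L.jw_sandwich[OF order_refl nz bb(1)] by metis
    obtain c' where c': "b' * ?z = s c' * ?z" using L.jw_sandwich[OF order_refl nz bb(2)] by metis
    have "b * w * b' * ?z = b * e 0 * (e 1 * (s c' * ?z))" using c' by (simp add: mult.assoc)
    also have "\<dots> = 0" using L.cent_left[of 1] kill n4 by (simp add: gen_index_def)
    finally have 1: "b * w * b' * ?z = 0" .
    have "?z * (b * w * b') = s c * ?z * (e 1 * e 0) * b'" using c w_comm by (metis mult.assoc)
    also have "\<dots> = s c * (?z * e 1) * e 0 * b'" by (simp add: mult.assoc)
    finally show ?case using 1 kill by simp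
  qed (simp_all add: algebra_simps)
  let ?T = "{a. \<exists>y\<in>I. \<forall>x\<in>I. x * y = x * a \<and> y * x = a * x}"
  have "s 1 - ?z \<in> ?T"
  proof (rule L.jw_ideal)
    show "0 \<in> ?T"
      using I_zero by (auto intro!: bexI[of _ 0])
    fix a b assume "a \<in> ?T"
      "b \<in> ?T"
    then obtain y y' where "y \<in> I" "y' \<in> I" "\<forall>x\<in>I. x * y = x * a \<and> y * x = a * x"
      "\<forall>x\<in>I. x * y' = x * b \<and> y' * x = b * x" by blast
    then show "a + b \<in> ?T"
      by (auto intro!: bexI[of _ "y + y'"] I_add simp: algebra_simps)
  next
    fix i a b assume i: "i \<in> L.V n" and "a \<in> L.A n" "b \<in> L.A n"
    then have ab: "a \<in> S" "b \<in> S" using LS by auto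
    obtain y where y: "y \<in> I" "\<And>x. x \<in> I \<Longrightarrow> x * y = x * e i \<and> y * x = e i * x"
      using I_e_match[OF d, of i] i by (force simp: gen_index_def)
    have "x * (a * y * b) = x * (a * e i * b) \<and> a * y * b * x = a * e i * b * x" if x: "x \<in> I" for x
    proof
      show "x * (a * y * b) = x * (a * e i * b)"
        using y(2)[OF I_right[OF x ab(1)]] by (metis mult.assoc)
      show "a * y * b * x = a * e i * b * x"
        using y(2)[OF I_left[OF x ab(2)]] by (metis mult.assoc)
    qed
    then show "a * e i * b \<in> ?T"
      using I_right[OF I_left[OF y(1) ab(1)] ab(2)] by blast
  qed simp
  then obtain c where c: "c \<in> I" "\<And>x. x \<in> I \<Longrightarrow> x * c = x * (s 1 - ?z) \<and> c * x = (s 1 - ?z) * x" by blast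
  show thesis
    using c(2) z0 S_unit[OF I_sub] by (intro that[OF c(1)]) (auto simp: algebra_simps)
qed

end

section \<open>The two central summands and their families\<close>

context TLD_rel begin

definition central_idem :: "'a \<Rightarrow> bool" where
  "central_idem f \<longleftrightarrow> f \<in> S \<and> f * f = f \<and> (\<forall>x\<in>S. f * x = x * f)"

lemma summand_mult:
  assumes "central_idem f" "y \<in> S"
  shows "x * f * (y * f) = x * y * f"
proof -
  have "x * f * (y * f) = x * (f * y) * f" by (simp add: mult.assoc)
  also have "\<dots> = x * y * (f * f)" using assms by (simp add: central_idem_def mult.assoc)
  finally show ?thesis using assms by (simp add: central_idem_def)
qed

lemma gen_index_less: "G \<subseteq> {0, 1} \<Longrightarrow> k \<le> n \<Longrightarrow> i \<in> gen_index G k \<Longrightarrow> i < n"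
  using n4 by (auto simp: gen_index_def)

lemma summand_TL_rel:
  assumes f: "central_idem f" and G: "G \<subseteq> {0, 1}"
    and orth: "\<And>i j. i \<in> G \<Longrightarrow> j \<in> G \<Longrightarrow> i \<noteq> j \<Longrightarrow> e i * e j * f = 0"
  shows "TL_rel (\<lambda>x. s x * f) (\<lambda>i. e i * f) G n \<delta>"
proof -
  note lt = gen_index_less[OF G]
  note m = summand_mult[OF f]
  have l1: "i < n" if "i \<in> gen_index G (j - 1)" "j < n" for i j using lt[of "j - 1"] that by auto
  have l2: "i < n" if "i \<in> gen_index G j" "j < n" for i j using lt[of j] that by auto
  show ?thesis
  proof
    show "s (c + d) * f = s c * f + s d * f" for c d by (simp add: s_add distrib_right)
    show "s (c * d) * f = s c * f * (s d * f)" for c d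
      using m[OF alg_scal[of d]] by (simp add: s_mult)
    show "s 1 * f * (e i * f) = e i * f" "s c * f * (e i * f) = e i * f * (s c * f)"
      "e i * f * (e i * f) = s \<delta> * f * (e i * f)" if i: "i \<in> gen_index G n" for i c
      using m[OF S_e[of i]] m[OF alg_scal[of c]] lt[OF order_refl i] cent S_unit(2)[OF S_e[of i]]
      by (simp_all add: sq)
    show "e i * f * (e j * f) = 0" if "i \<in> G" "j \<in> G" "i \<noteq> j" for i j
      using m[OF S_e[of j]] orth[OF that] that G n4 by auto
    show "e i * f * (e j * f) = e j * f * (e i * f)"
      if "2 \<le> j" "j < n" "i \<in> gen_index G (j - 1)" for i j
    proof -
      have "\<not> D_adj i j" "i \<noteq> j" using that G by (auto simp: gen_index_def D_adj_def)
      then show ?thesis using m[OF S_e[of j]] m[OF S_e[of i]] l1[OF that(3,2)] that far[of i j] by simp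
    qed
    show "e i * f * (e j * f) * (e i * f) = e i * f" "e j * f * (e i * f) * (e j * f) = e j * f"
      if "2 \<le> j" "j < n" "i \<in> gen_index G j" "i \<notin> gen_index G (j - 1)" for i j
    proof -
      have "D_adj i j" "D_adj j i" using that G by (auto simp: gen_index_def D_adj_def)
      then show "e i * f * (e j * f) * (e i * f) = e i * f" "e j * f * (e i * f) * (e j * f) = e j * f"
        using m[OF S_e[of j]] m[OF S_e[of i]] l2[OF that(3,2)] that braid by simp_all
    qed
  qed (use G in auto)
qed

definition full_family :: "'a set \<Rightarrow> 'a \<Rightarrow> bool" where
  "full_family P f \<longleftrightarrow> finite P \<and> (\<forall>p\<in>P. p \<in> S \<and> p * f = p \<and> f * p = p) \<and>
    (\<forall>p\<in>P. \<forall>p'\<in>P. p \<noteq> p' \<longrightarrow> (\<forall>x\<in>S. p * x * p' = 0)) \<and>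
    (\<forall>p\<in>P. \<forall>x\<in>S. \<exists>c. p * x * p = s c * p) \<and>
    f \<in> aspan {a * p * b | a b p. a \<in> S \<and> b \<in> S \<and> p \<in> P}"

text \<open>By \<open>gens\<close> every generator coincides in the summand with one of the chain,
  so the chain algebra with unit \<open>f\<close> is all of \<open>S f\<close>. Orthogonality
  extends to \<open>S\<close> because \<open>p * x * p' = p * (x * f) * p'\<close> for members of
  the family.\<close>

lemma summand_family:
  assumes f: "central_idem f" and G: "G \<subseteq> {0, 1}"
    and orth: "\<And>i j. i \<in> G \<Longrightarrow> j \<in> G \<Longrightarrow> i \<noteq> j \<Longrightarrow> e i * e j * f = 0"
    and gens: "\<And>i. i < n \<Longrightarrow> \<exists>j\<in>gen_index G n. e i * f = e j * f"
    and nz: "\<And>j. 1 \<le> j \<Longrightarrow> j < n \<Longrightarrow> cheb (card G) \<delta> j \<noteq> 0"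
  shows "\<exists>P. full_family P f"
proof -
  interpret Q: TL_rel "\<lambda>x. s x * f" "\<lambda>i. e i * f" G n \<delta>
    by (rule summand_TL_rel[OF f G orth])
  have fS: "f \<in> S" "f * f = f" "\<And>x. x \<in> S \<Longrightarrow> f * x = x * f" using f by (auto simp: central_idem_def)
  have QS: "x \<in> S \<and> x * f = x" if "x \<in> Q.A n" for x
    using that
  proof (induction rule: Q.alg.induct)
    case (alg_step x y)
    then obtain i where i: "y = e i * f" "i < n" using gen_index_less[OF G order_refl] by auto
    then have "x * y \<in> S" using S_mult[OF S_mult[OF fS(1) S_e]] alg_step by simp
    then show ?case using i fS(2) by (simp add: mult.assoc)
  next
    case (alg_scal c)
    have "s c * f \<in> S" by (rule S_mult[OF fS(1) alg.alg_scal])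
    then show ?case using fS(2) by (simp add: mult.assoc)
  qed (simp add: alg_add distrib_right)
  have SQ: "x * f \<in> Q.A n" if "x \<in> S" for x
    using that
  proof (induction rule: alg.induct)
    case (alg_step x y)
    then obtain i where i: "y = e i" "i < n" by auto
    then obtain j where j: "j \<in> gen_index G n" "e i * f = e j * f" using gens by blast
    have "x * y * f = x * f * (e j * f)" using summand_mult[OF f S_e[OF i(2)], of x] i j by simp
    then show ?case using Q.alg_step[OF alg_step.IH] j by auto
  qed (auto simp: distrib_right intro: Q.alg.intros)
  obtain P where P: "Q.family P (s 1 * f)"
    using Q.family_exists[OF Q.Corner_one _ order_refl nz] n4 by auto
  have sf: "s 1 * f = f" using S_unit[OF fS(1)] by simp
  have PQ: "p \<in> Q.A n" if "p \<in> P" for p using P that by (auto simp: Q.family_def)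
  have pf: "p \<in> S" "p * f = p" "f * p = p" if "p \<in> P" for p
    using QS[OF PQ[OF that]] fS(3) by metis+
  have "full_family P f"
    unfolding full_family_def
  proof (intro conjI ballI impI)
    show "finite P" using P by (simp add: Q.family_def)
    fix p assume p: "p \<in> P"
    then show "p \<in> S" "p * f = p" "f * p = p" using pf by auto
    fix x assume x: "x \<in> S"
    have px: "p * x * y = p * (x * f) * y" if "y \<in> P" for y
    proof -
      have "p * (x * f) * y = p * x * (f * y)" by (simp add: mult.assoc)
      then show ?thesis using pf[OF that] by simp
    qed
    obtain c where "p * (x * f) * p = s c * f * p" using P p SQ[OF x] unfolding Q.family_def by blast
    then show "\<exists>c. p * x * p = s c * p" using px[OF p] pf[OF p] by (auto simp: mult.assoc)
    fix p' assume "p' \<in> P" "p \<noteq> p'"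
    then show "p * x * p' = 0" using px P p SQ[OF x] unfolding Q.family_def by metis
  next
    have "aspan {a * p * b |a b p. a \<in> Q.A n \<and> b \<in> Q.A n \<and> p \<in> P}
      \<subseteq> aspan {a * p * b |a b p. a \<in> S \<and> b \<in> S \<and> p \<in> P}"
      using QS by (intro aspan_mono) blast
    then show "f \<in> aspan {a * p * b |a b p. a \<in> S \<and> b \<in> S \<and> p \<in> P}"
      using P sf by (auto simp: Q.family_def Q.span2_def)
  qed
  then show ?thesis by blast
qed

lemma full_family_union:
  assumes f: "central_idem f" and g: "central_idem g" and fg: "f * g = 0"
    and P: "full_family P f" and Q: "full_family Q g"
  shows "full_family (P \<union> Q) (f + g)"
proof -
  have gf: "g * f = 0" using f g fg unfolding central_idem_def by metis
  have comm: "f * x = x * f" "g * x = x * g" if "x \<in> S" for x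
    using f g that unfolding central_idem_def by blast+
  have p: "p \<in> S" "p * f = p" "f * p = p" "p * g = 0" "g * p = 0" if "p \<in> P" for p
  proof -
    show 1: "p \<in> S" "p * f = p" "f * p = p" using P that by (auto simp: full_family_def)
    show "p * g = 0" "g * p = 0" using 1 fg gf by (metis mult.assoc mult_zero_left mult_zero_right)+
  qed
  have q: "p \<in> S" "p * g = p" "g * p = p" "p * f = 0" "f * p = 0" if "p \<in> Q" for p
  proof -
    show 1: "p \<in> S" "p * g = p" "g * p = p" using Q that by (auto simp: full_family_def)
    show "p * f = 0" "f * p = 0" using 1 fg gf by (metis mult.assoc mult_zero_left mult_zero_right)+
  qed
  have cross: "p * x * r = 0 \<and> r * x * p = 0" if "p \<in> P" "r \<in> Q" "x \<in> S" for p r x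
  proof
    have "p * x * r = p * (f * x) * r" using p(2)[OF that(1)] by (simp flip: mult.assoc)
    also have "\<dots> = p * x * (f * r)" using comm[OF that(3)] by (simp add: mult.assoc)
    finally show "p * x * r = 0" using q[OF that(2)] by simp
    have "r * x * p = r * (g * x) * p" using q(2)[OF that(2)] by (simp flip: mult.assoc)
    also have "\<dots> = r * x * (g * p)" using comm[OF that(3)] by (simp add: mult.assoc)
    finally show "r * x * p = 0" using p[OF that(1)] by simp
  qed
  show ?thesis
    unfolding full_family_def
  proof (intro conjI ballI impI)
    show "finite (P \<union> Q)" using P Q by (simp add: full_family_def)
    fix r assume r: "r \<in> P \<union> Q"
    then show "r \<in> S" "r * (f + g) = r" "(f + g) * r = r" using p q by (auto simp: distrib_left distrib_right)
    fix x assume x: "x \<in> S"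
    show "\<exists>c. r * x * r = s c * r" using r x P Q by (auto simp: full_family_def)
    fix r' assume r': "r' \<in> P \<union> Q" "r \<noteq> r'"
    show "r * x * r' = 0" using r r' x P Q cross by (auto simp: full_family_def)
  next
    let ?B = "\<lambda>P. {a * p * b |a b p. a \<in> S \<and> b \<in> S \<and> p \<in> P}"
    have "f \<in> aspan (?B (P \<union> Q))" using P aspan_mono[of "?B P" "?B (P \<union> Q)"] by (auto simp: full_family_def)
    moreover have "g \<in> aspan (?B (P \<union> Q))" using Q aspan_mono[of "?B Q" "?B (P \<union> Q)"] by (auto simp: full_family_def)
    ultimately show "f + g \<in> aspan (?B (P \<union> Q))" by (rule aspan_add)
  qed
qed

lemma full_family_exists:
  assumes nz: "\<And>j. 1 \<le> j \<Longrightarrow> j < n \<Longrightarrow> cheb 1 \<delta> j \<noteq> 0 \<and> cheb 2 \<delta> j \<noteq> 0"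
  shows "\<exists>P. full_family P (s 1)"
proof -
  obtain c where c: "c \<in> I" "\<And>x. x \<in> I \<Longrightarrow> x * c = x" "\<And>x. x \<in> I \<Longrightarrow> c * x = x"
    using I_unit nz by blast
  have cS: "c \<in> S" by (rule I_sub[OF c(1)])
  have cc: "central_idem c"
    unfolding central_idem_def using c cS I_right[OF c(1)] I_left[OF c(1)] by (metis mult.assoc)
  let ?d = "s 1 - c"
  have u: "s 1 * x = x" "x * s 1 = x" if "x \<in> S" for x using S_unit[OF that] .
  have dS: "?d \<in> S" by (intro S_diff alg_scal cS)
  have dd: "central_idem ?d"
    unfolding central_idem_def using cc u dS u[OF cS] by (auto simp: central_idem_def algebra_simps)
  have cd: "c * ?d = 0" using cc u[OF cS] by (simp add: central_idem_def right_diff_distrib)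
  have ec: "e 0 * c = e 1 * c" using I_left_e[OF c(1), of 0] n4 by simp
  have "\<exists>P. full_family P c"
  proof (rule summand_family[OF cc])
    show "\<exists>j\<in>gen_index {1} n. e i * c = e j * c" if "i < n" for i
    proof (cases "i = 0")
      case True
      then show ?thesis using ec n4 by (auto simp: gen_index_def intro!: bexI[of _ "Suc 0"])
    qed (use that n4 in \<open>intro bexI[of _ i]; auto simp: gen_index_def\<close>)
  qed (use nz in auto)
  moreover have "\<exists>P. full_family P ?d"
  proof (rule summand_family[OF dd, of "{0, 1}"])
    have "w * ?d = 0" using c(2)[OF w_I] u[OF I_sub[OF w_I]] by (simp add: right_diff_distrib)
    then show "e i * e j * ?d = 0" if "i \<in> {0, 1}" "j \<in> {0, 1}" "i \<noteq> j" for i j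
      using that w_comm by auto
    show "\<exists>j\<in>gen_index {0, 1} n. e i * ?d = e j * ?d" if "i < n" for i
      using that n4 by (intro bexI[of _ i]) (auto simp: gen_index_def)
  qed (use nz in \<open>auto simp: numeral_2_eq_2\<close>)
  ultimately obtain P Q where "full_family P c" "full_family Q ?d" by blast
  from full_family_union[OF cc dd cd this] show ?thesis by auto
qed

end

section \<open>Simple left ideals\<close>

text \<open>The unit \<open>u\<close> is not that of an ambient type: in the faithful realisation
  below it is an idempotent endomorphism, in general different from the identity.\<close>

locale unital_subset =
  fixes S :: "'a::ring set" and u :: 'a
  assumes unit_mem: "u \<in> S"
    and add_mem: "x \<in> S \<Longrightarrow> y \<in> S \<Longrightarrow> x + y \<in> S"
    and minus_mem: "x \<in> S \<Longrightarrow> - x \<in> S"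
    and mult_mem: "x \<in> S \<Longrightarrow> y \<in> S \<Longrightarrow> x * y \<in> S"
    and unit_left: "x \<in> S \<Longrightarrow> u * x = x"
    and unit_right: "x \<in> S \<Longrightarrow> x * u = x"
begin

definition lideal :: "'a set \<Rightarrow> bool" where
  "lideal T \<longleftrightarrow> T \<subseteq> S \<and> 0 \<in> T \<and> (\<forall>x\<in>T. \<forall>y\<in>T. x + y \<in> T) \<and> (\<forall>a\<in>S. \<forall>x\<in>T. a * x \<in> T)"

definition simple_lideal :: "'a set \<Rightarrow> bool" where
  "simple_lideal T \<longleftrightarrow> lideal T \<and> T \<noteq> {0} \<and> (\<forall>K. lideal K \<and> K \<subseteq> T \<longrightarrow> K = {0} \<or> K = T)"

lemma zero_mem: "0 \<in> S"
  using add_mem[OF unit_mem minus_mem[OF unit_mem]] by simp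

lemma lidealD:
  assumes "lideal T"
  shows "x \<in> T \<Longrightarrow> x \<in> S" "0 \<in> T" "x \<in> T \<Longrightarrow> y \<in> T \<Longrightarrow> x + y \<in> T"
    "a \<in> S \<Longrightarrow> x \<in> T \<Longrightarrow> a * x \<in> T" "x \<in> T \<Longrightarrow> - x \<in> T"
proof -
  show *: "x \<in> T \<Longrightarrow> x \<in> S" "0 \<in> T" "x \<in> T \<Longrightarrow> y \<in> T \<Longrightarrow> x + y \<in> T"
    "a \<in> S \<Longrightarrow> x \<in> T \<Longrightarrow> a * x \<in> T" for a x y
    using assms by (auto simp: lideal_def)
  show "- x \<in> T" if "x \<in> T"
    using *(4)[OF minus_mem[OF unit_mem] that] unit_left[OF *(1)[OF that]] by simp
qed

lemma lideal_Int: "lideal T \<Longrightarrow> lideal K \<Longrightarrow> lideal (T \<inter> K)"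
  unfolding lideal_def by blast

lemma lideal_zero: "lideal {0}"
  by (simp add: lideal_def zero_mem)

lemma lideal_principal: "a \<in> S \<Longrightarrow> lideal {x * a | x. x \<in> S}"
  unfolding lideal_def
proof (intro conjI ballI)
  assume a: "a \<in> S"
  show "{x * a | x. x \<in> S} \<subseteq> S" using mult_mem a by auto
  show "0 \<in> {x * a |x. x \<in> S}" using zero_mem by (auto intro!: exI[of _ 0])
  show "x + y \<in> {x * a |x. x \<in> S}" if "x \<in> {x * a |x. x \<in> S}" "y \<in> {x * a |x. x \<in> S}" for x y
    using that add_mem by (auto simp flip: distrib_right)
  show "b * x \<in> {x * a |x. x \<in> S}" if "b \<in> S" "x \<in> {x * a |x. x \<in> S}" for b x
    using that mult_mem by (auto simp flip: mult.assoc)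
qed

text \<open>The set \<open>J\<close> is a distinguished summand: a principal left ideal when
  regularity is proved, and \<open>{0}\<close> when a direct decomposition is extracted.\<close>

definition lsum :: "'a set \<Rightarrow> ('i \<Rightarrow> 'a set) \<Rightarrow> 'i set \<Rightarrow> 'a set" where
  "lsum J L T = {y + (\<Sum>i\<in>T. f i) | y f. y \<in> J \<and> (\<forall>i\<in>T. f i \<in> L i)}"

definition indep :: "'a set \<Rightarrow> ('i \<Rightarrow> 'a set) \<Rightarrow> 'i set \<Rightarrow> bool" where
  "indep J L T \<longleftrightarrow> (\<forall>y\<in>J. \<forall>f. (\<forall>i\<in>T. f i \<in> L i) \<longrightarrow> y + (\<Sum>i\<in>T. f i) = 0 \<longrightarrow> y = 0 \<and> (\<forall>i\<in>T. f i = 0))"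

lemma lsumI: "y \<in> J \<Longrightarrow> (\<And>i. i \<in> T \<Longrightarrow> f i \<in> L i) \<Longrightarrow> y + (\<Sum>i\<in>T. f i) \<in> lsum J L T"
  unfolding lsum_def by blast

lemma indepD:
  "indep J L T \<Longrightarrow> y \<in> J \<Longrightarrow> (\<And>i. i \<in> T \<Longrightarrow> f i \<in> L i) \<Longrightarrow> y + (\<Sum>i\<in>T. f i) = 0 \<Longrightarrow>
    y = 0 \<and> (\<forall>i\<in>T. f i = 0)"
  unfolding indep_def by blast

lemma lideal_lsum:
  assumes "lideal J" "\<And>i. i \<in> T \<Longrightarrow> lideal (L i)"
  shows "lideal (lsum J L T)"
  unfolding lideal_def
proof (intro conjI ballI subsetI)
  note J = lidealD[OF assms(1)] and L = lidealD[OF assms(2)]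
  show "0 \<in> lsum J L T" using lsumI[of 0 J T "\<lambda>_. 0" L] J L by simp
  fix x assume "x \<in> lsum J L T"
  then obtain y f where x: "x = y + (\<Sum>i\<in>T. f i)" "y \<in> J" "\<And>i. i \<in> T \<Longrightarrow> f i \<in> L i"
    unfolding lsum_def by blast
  have "sum f T \<in> S" using L(1) x(3)
    by (induction T rule: infinite_finite_induct) (auto simp: zero_mem intro: add_mem)
  then show "x \<in> S" using x J(1) add_mem by auto
  show "a * x \<in> lsum J L T" if "a \<in> S" for a
    unfolding x distrib_left sum_distrib_left using J L x that by (intro lsumI) auto
  fix x' assume "x' \<in> lsum J L T"
  then obtain y' f' where x': "x' = y' + (\<Sum>i\<in>T. f' i)" "y' \<in> J" "\<And>i. i \<in> T \<Longrightarrow> f' i \<in> L i"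
    unfolding lsum_def by blast
  have "x + x' = (y + y') + (\<Sum>i\<in>T. f i + f' i)" by (simp add: x x' sum.distrib)
  also have "\<dots> \<in> lsum J L T" using x x' J L by (intro lsumI) auto
  finally show "x + x' \<in> lsum J L T" .
qed

text \<open>If \<open>T\<close> is maximal, adding \<open>j\<close> destroys independence, so
  \<open>L j\<close> meets the sum nontrivially; being simple, it is contained in the sum.\<close>

lemma maximal_indep:
  assumes J: "lideal J" and L: "\<And>i. i \<in> A \<Longrightarrow> simple_lideal (L i)" and fin: "finite A"
  obtains T where "T \<subseteq> A" "indep J L T" "\<forall>j\<in>A. L j \<subseteq> lsum J L T"
proof -
  have "{} \<in> {T. T \<subseteq> A \<and> indep J L T}" "finite {T. T \<subseteq> A \<and> indep J L T}"
    using fin by (auto simp: indep_def)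
  then have "\<exists>T\<in>{T. T \<subseteq> A \<and> indep J L T}. \<forall>T'\<in>{T. T \<subseteq> A \<and> indep J L T}. T \<subseteq> T' \<longrightarrow> T = T'"
    by (intro finite_has_maximal) blast+
  then obtain T where T': "T \<in> {T. T \<subseteq> A \<and> indep J L T}"
    "\<forall>T'\<in>{T. T \<subseteq> A \<and> indep J L T}. T \<subseteq> T' \<longrightarrow> T = T'" ..
  then have T: "T \<subseteq> A" "indep J L T" by simp_all
  have max: "T = T'" if "T' \<subseteq> A" "indep J L T'" "T \<subseteq> T'" for T'
    using bspec[OF T'(2), of T'] that by simp
  have finT: "finite T" using T fin finite_subset by blast
  have Ll: "lideal (L i)" if "i \<in> A" for i using L[OF that] by (simp add: simple_lideal_def)
  have Tl: "lideal (lsum J L T)" using J Ll T by (intro lideal_lsum) auto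
  have "L j \<subseteq> lsum J L T" if j: "j \<in> A" for j
  proof (cases "j \<in> T")
    case True
    show ?thesis
    proof
      fix x assume x: "x \<in> L j"
      have "(\<Sum>i\<in>T. if i = j then x else 0) = x" using True finT by simp
      moreover have "(if i = j then x else 0) \<in> L i" if "i \<in> T" for i
        using x lidealD(2)[OF Ll[of i]] that T by auto
      ultimately show "x \<in> lsum J L T"
        using lsumI[OF lidealD(2)[OF J], of T "\<lambda>i. if i = j then x else 0" L] by simp
    qed
  next
    case False
    then have "\<not> indep J L (insert j T)" using max[of "insert j T"] j T by auto
    then obtain y f where yf: "y \<in> J" "\<And>i. i \<in> insert j T \<Longrightarrow> f i \<in> L i"
      "y + sum f (insert j T) = 0" "\<not> (y = 0 \<and> (\<forall>i\<in>insert j T. f i = 0))"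
      unfolding indep_def by blast
    have s: "y + sum f T + f j = 0" using yf(3) False finT by (simp add: ac_simps)
    have "f j \<noteq> 0"
      using yf s T(2) unfolding indep_def by auto
    moreover have "f j \<in> lsum J L T"
    proof -
      have "f j = - (y + sum f T)" using minus_unique[OF s] by simp
      moreover have "y + sum f T \<in> lsum J L T" using yf by (intro lsumI) auto
      ultimately show ?thesis using lidealD(5)[OF Tl] by metis
    qed
    moreover have "lideal (L j \<inter> lsum J L T)" using Ll[OF j] Tl by (rule lideal_Int)
    ultimately have "L j \<inter> lsum J L T = L j"
      using L[OF j] yf(2)[of j] unfolding simple_lideal_def by blast
    then show ?thesis by blast
  qed
  then show thesis using that T by blast
qed

text \<open>
  A maximal set of simple summands independent of \<open>S a\<close> spans a complement of \<open>S a\<close>; the required \<open>x\<close>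
  is read off the component of the unit in \<open>S a\<close>.
\<close>

lemma simple_sum_regular:
  fixes m :: nat
  assumes L: "\<And>i. i < m \<Longrightarrow> simple_lideal (L i)" and f: "\<And>i. i < m \<Longrightarrow> f i \<in> L i" "u = (\<Sum>i<m. f i)"
    and a: "a \<in> S"
  shows "\<exists>x\<in>S. a * x * a = a"
proof -
  define J where "J = {x * a | x. x \<in> S}"
  have J: "lideal J" unfolding J_def by (rule lideal_principal[OF a])
  obtain T where T: "T \<subseteq> {..<m}" "indep J L T" "\<forall>j\<in>{..<m}. L j \<subseteq> lsum J L T"
    using maximal_indep[OF J, of "{..<m}" L] L by auto
  have Ll: "lideal (L i)" if "i < m" for i using L[OF that] by (simp add: simple_lideal_def)
  have Tl: "lideal (lsum J L T)" using J Ll T by (intro lideal_lsum) auto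
  have "sum f B \<in> lsum J L T" if "finite B" "B \<subseteq> {..<m}" for B
    using that
  proof (induction)
    case (insert i B)
    then have "f i \<in> lsum J L T" using f T(3) by auto
    then show ?case using insert lidealD(3)[OF Tl] by auto
  qed (use lidealD(2)[OF Tl] in simp)
  then have "u \<in> lsum J L T" using f(2) by simp
  then obtain y h where h: "u = y + (\<Sum>i\<in>T. h i)" "y \<in> J" "\<forall>i\<in>T. h i \<in> L i"
    unfolding lsum_def by blast
  then obtain x where xh: "u = x * a + (\<Sum>i\<in>T. h i)" "x \<in> S" "\<And>i. i \<in> T \<Longrightarrow> h i \<in> L i"
    unfolding J_def by blast
  have aJ: "a \<in> J" unfolding J_def using unit_left[OF a] unit_mem by force
  have "x * a \<in> J" unfolding J_def using xh(2) by blast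
  then have 1: "- a + a * (x * a) \<in> J"
    by (rule lidealD(3)[OF J lidealD(5)[OF J aJ] lidealD(4)[OF J a]])
  \<comment> \<open>Multiplying the decomposition of \<open>u\<close> by \<open>a\<close> exhibits
    \<open>- a + a * x * a\<close>, an element of \<open>S a\<close>, as minus an element of the
    complement. Independence forces it to be zero.\<close>
  have "a = a * (x * a) + (\<Sum>i\<in>T. a * h i)"
    using xh(1) unit_right[OF a] by (metis distrib_left sum_distrib_left)
  then have "- a + a * (x * a) + (\<Sum>i\<in>T. a * h i) = 0"
    by (metis add.assoc left_minus)
  moreover have "a * h i \<in> L i" if "i \<in> T" for i
    using lidealD(4)[OF Ll a xh(3)[OF that]] that T by auto
  ultimately have "- a + a * (x * a) = 0" using indepD[OF T(2) 1, of "\<lambda>i. a * h i"] by blast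
  then show ?thesis using xh(2) by (auto simp: mult.assoc)
qed

text \<open>A maximal independent subfamily over \<open>J = {0}\<close> already spans. What remains
  is to renumber it by an initial segment, the form in which \<open>semisimple\<close> asks for
  it.\<close>

lemma simple_sum_direct:
  assumes L: "\<And>i. i \<in> A \<Longrightarrow> simple_lideal (L i)" and fin: "finite A"
    and f: "\<And>i. i \<in> A \<Longrightarrow> f i \<in> L i" "u = sum f A"
  shows "\<exists>(m::nat) M. (\<forall>i<m. simple_lideal (M i)) \<and> indep {0} M {..<m} \<and> S \<subseteq> lsum {0} M {..<m}"
proof -
  obtain T where T: "T \<subseteq> A" "indep {0} L T" "\<forall>j\<in>A. L j \<subseteq> lsum {0} L T"
    by (rule maximal_indep[OF lideal_zero L fin]) (assumption | rule that)+
  have Ll: "lideal (L i)" if "i \<in> A" for i using L[OF that] by (simp add: simple_lideal_def)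
  have Tl: "lideal (lsum {0} L T)" using lideal_zero Ll T by (intro lideal_lsum) auto
  have finT: "finite T" using T fin finite_subset by blast
  have "sum f B \<in> lsum {0} L T" if "finite B" "B \<subseteq> A" for B
    using that
  proof (induction)
    case (insert i B)
    then have "f i \<in> lsum {0} L T" using f T(3) by auto
    then show ?case using insert lidealD(3)[OF Tl] by auto
  qed (use lidealD(2)[OF Tl] in simp)
  then have uT: "u \<in> lsum {0} L T" using f(2) fin by simp
  obtain h where h: "bij_betw h {..<card T} T"
    using ex_bij_betw_nat_finite[OF finT] by (auto simp: lessThan_atLeast0)
  have hT: "h k \<in> T" if "k < card T" for k using h that by (auto simp: bij_betw_def)
  define k where "k = the_inv_into {..<card T} h"
  have k: "k i < card T" "h (k i) = i" if "i \<in> T" for i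
  proof -
    have "k i \<in> {..<card T}"
      unfolding k_def by (rule the_inv_into_into) (use h that in \<open>auto simp: bij_betw_def\<close>)
    then show "k i < card T" by simp
    show "h (k i) = i" unfolding k_def by (rule f_the_inv_into_f_bij_betw[OF h]) (use that in auto)
  qed
  have kh: "k (h j) = j" if "j < card T" for j
    unfolding k_def by (rule the_inv_into_f_f) (use h that in \<open>auto simp: bij_betw_def\<close>)
  have reindex: "(\<Sum>j<card T. g j) = (\<Sum>i\<in>T. g (k i))" for g :: "nat \<Rightarrow> 'a"
    using sum.reindex_bij_betw[OF h, of "\<lambda>i. g (k i)"] kh by simp
  have "indep {0} (L \<circ> h) {..<card T}"
    unfolding indep_def
  proof (intro ballI allI impI conjI)
    fix y g j assume y: "y \<in> {0}" and g: "\<forall>i\<in>{..<card T}. g i \<in> (L \<circ> h) i" "y + sum g {..<card T} = 0"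
    then show "y = 0" by simp
    have "g (k i) \<in> L i" if "i \<in> T" for i using bspec[OF g(1), of "k i"] k[OF that] by simp
    then have "\<forall>i\<in>T. g (k i) = 0"
      by (intro conjunct2[OF indepD[OF T(2) singletonI, where f = "\<lambda>i. g (k i)"]]) (use g(2) y reindex in auto)
    moreover assume "j \<in> {..<card T}"
    ultimately show "g j = 0" using hT kh by fastforce
  qed
  moreover have "S \<subseteq> lsum {0} (L \<circ> h) {..<card T}"
  proof
    fix x assume x: "x \<in> S"
    have "x * u \<in> lsum {0} L T" by (rule lidealD(4)[OF Tl x uT])
    then obtain g where g: "x = (\<Sum>i\<in>T. g i)" "\<And>i. i \<in> T \<Longrightarrow> g i \<in> L i"
      using unit_right[OF x] unfolding lsum_def by auto
    have "x = 0 + (\<Sum>j<card T. g (h j))" using g(1) sum.reindex_bij_betw[OF h, of g] by simp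
    then show "x \<in> lsum {0} (L \<circ> h) {..<card T}"
      using lsumI[of 0 "{0}" "{..<card T}" "g \<circ> h" "L \<circ> h"] g(2) hT by auto
  qed
  ultimately show ?thesis using L T(1) hT by (intro exI[of _ "card T"] exI[of _ "L \<circ> h"]) auto
qed

text \<open>The left ideals generated by \<open>p i * y i\<close> are zero or simple, and their sum
  contains \<open>u\<close>. The same \<open>p\<close> may occur at several indices, since the
  expansion of \<open>u\<close> can use it repeatedly.\<close>

lemma orthogonal_family_direct:
  fixes N :: nat
  assumes P: "\<And>i. i < N \<Longrightarrow> p i \<in> S" "\<And>i. i < N \<Longrightarrow> x i \<in> S" "\<And>i. i < N \<Longrightarrow> y i \<in> S"
    and orth: "\<And>i j a. i < N \<Longrightarrow> j < N \<Longrightarrow> p i \<noteq> p j \<Longrightarrow> a \<in> S \<Longrightarrow> p i * a * p j = 0"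
    and inv: "\<And>i a. i < N \<Longrightarrow> a \<in> S \<Longrightarrow> p i * a * p i \<noteq> 0 \<Longrightarrow> \<exists>z\<in>S. z * (p i * a * p i) = p i"
    and u: "u = (\<Sum>i<N. x i * p i * y i)"
  shows "\<exists>(m::nat) M. (\<forall>i<m. simple_lideal (M i)) \<and> indep {0} M {..<m} \<and> S \<subseteq> lsum {0} M {..<m}"
proof -
  define M where "M i = {z * (p i * y i) | z. z \<in> S}" for i
  define A where "A = {i. i < N \<and> M i \<noteq> {0}}"
  have xM: "x i * p i * y i \<in> M i" if "i < N" for i
    using P[OF that] by (auto simp: M_def mult.assoc)
  show ?thesis
  proof (rule simple_sum_direct[of A M "\<lambda>i. x i * p i * y i"])
    show "finite A" by (simp add: A_def)
    show "x i * p i * y i \<in> M i" if "i \<in> A" for i using that xM by (simp add: A_def)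
    show "u = (\<Sum>i\<in>A. x i * p i * y i)"
      unfolding u
    proof (rule sum.mono_neutral_right)
      show "\<forall>i\<in>{..<N} - A. x i * p i * y i = 0"
      proof
        fix i assume i: "i \<in> {..<N} - A"
        then have "x i * p i * y i \<in> {0}" using xM[of i] by (auto simp: A_def)
        then show "x i * p i * y i = 0" by simp
      qed
    qed (auto simp: A_def)
    fix i assume "i \<in> A"
    then have i: "i < N" "M i \<noteq> {0}" by (auto simp: A_def)
    show "simple_lideal (M i)"
      unfolding simple_lideal_def
    proof (intro conjI allI impI)
      show Ml: "lideal (M i)"
        unfolding M_def using P i by (intro lideal_principal mult_mem) auto
      show "M i \<noteq> {0}" by (rule i)
      fix K assume K: "lideal K \<and> K \<subseteq> M i"
      show "K = {0} \<or> K = M i"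
      proof (cases "K = {0}")
        case False
        have "0 \<in> K" using K lidealD by blast
        then obtain k where k: "k \<in> K" "k \<noteq> 0" using False by blast
        then obtain a where a: "k = a * (p i * y i)" "a \<in> S" using K by (auto simp: M_def)
        then have ap: "a * p i \<noteq> 0" using k by (auto simp flip: mult.assoc)
        \<comment> \<open>Inserting the expansion of \<open>u\<close> produces a nonzero term
          \<open>p j * (y j * a) * p i\<close>. Orthogonality gives \<open>p j = p i\<close>, and
          \<open>inv\<close> then recovers \<open>p i\<close> from a left multiple of
          \<open>a * p i\<close>.\<close>
        have "a * p i = u * (a * p i)" using unit_left[OF mult_mem] a P i by simp
        also have "\<dots> = (\<Sum>j<N. x j * (p j * (y j * a) * p i))"
          unfolding u sum_distrib_right by (simp add: mult.assoc)
        finally obtain j where j: "j < N" "x j * (p j * (y j * a) * p i) \<noteq> 0"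
          using ap by (metis (no_types, lifting) lessThan_iff sum.neutral)
        have ya: "y j * a \<in> S" using mult_mem P j a by simp
        have "p j = p i" using j orth[OF j(1) i(1) _ ya] by force
        then have "p i * (y j * a) * p i \<noteq> 0" using j by force
        then obtain z where z: "z \<in> S" "z * (p i * (y j * a) * p i) = p i" using inv i ya by blast
        have "p i * y i = z * p i * y j * k" unfolding a(1) by (subst (1) z(2)[symmetric]) (simp add: mult.assoc)
        also have "\<dots> \<in> K"
          using z P i j K k by (intro lidealD(4) mult_mem) auto
        finally have pyK: "p i * y i \<in> K" .
        have "z * (p i * y i) \<in> K" if "z \<in> S" for z
          using lidealD(4)[OF conjunct1[OF K] that pyK] .
        then have "M i \<subseteq> K" unfolding M_def by blast
        then show ?thesis using K by blast
      qed simp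
    qed
  qed
qed

end

section \<open>Transport of left ideals along an embedding\<close>

locale ring_embedding = unital_subset S u + ring R for S :: "'a::ring set" and u and R :: "('b, 'c) ring_scheme" (structure) +
  fixes h :: "'b \<Rightarrow> 'a"
  assumes bij: "bij_betw h (carrier R) S"
    and h_add: "x \<in> carrier R \<Longrightarrow> y \<in> carrier R \<Longrightarrow> h (x \<oplus> y) = h x + h y"
    and h_mult: "x \<in> carrier R \<Longrightarrow> y \<in> carrier R \<Longrightarrow> h (x \<otimes> y) = h x * h y"
begin

lemma h_zero: "h \<zero> = 0"
  using h_add[of \<zero> \<zero>] by simp

lemma h_finsum: "finite I \<Longrightarrow> f \<in> I \<rightarrow> carrier R \<Longrightarrow> h (finsum R f I) = (\<Sum>i\<in>I. h (f i))"
  by (induction I rule: finite_induct) (auto simp: h_zero h_add finsum_insert Pi_def)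

lemma h_mem: "x \<in> carrier R \<Longrightarrow> h x \<in> S"
  using bij by (auto simp: bij_betw_def)

lemma h_inj: "x \<in> carrier R \<Longrightarrow> y \<in> carrier R \<Longrightarrow> h x = h y \<longleftrightarrow> x = y"
  using bij by (auto simp: bij_betw_def inj_on_def)

lemma h_surj: "y \<in> S \<Longrightarrow> \<exists>x\<in>carrier R. h x = y"
  using bij by (auto simp: bij_betw_def)

lemma left_ideal_iff: "left_ideal R J \<longleftrightarrow> J \<subseteq> carrier R \<and> lideal (h ` J)"
proof
  assume J: "left_ideal R J"
  then interpret J: additive_subgroup J R by (simp add: left_ideal_def)
  have sub: "J \<subseteq> carrier R" by (rule J.a_subset)
  moreover have "lideal (h ` J)"
    unfolding lideal_def
  proof (intro conjI ballI subsetI)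
    show "x \<in> S" if "x \<in> h ` J" for x using that sub h_mem by auto
    show "0 \<in> h ` J" using h_zero J.zero_closed by (metis imageI)
    show "x + y \<in> h ` J" if xy: "x \<in> h ` J" "y \<in> h ` J" for x y
    proof -
      obtain x' y' where *: "x = h x'" "y = h y'" "x' \<in> J" "y' \<in> J" using xy by blast
      then have "x + y = h (x' \<oplus> y')" "x' \<oplus> y' \<in> J" using sub by (auto simp: h_add subset_iff)
      then show ?thesis by blast
    qed
    show "a * x \<in> h ` J" if ax: "a \<in> S" "x \<in> h ` J" for a x
    proof -
      obtain a' x' where *: "a = h a'" "x = h x'" "a' \<in> carrier R" "x' \<in> J" using ax h_surj by blast
      then have "a * x = h (a' \<otimes> x')" "a' \<otimes> x' \<in> J" using sub J by (auto simp: h_mult subset_iff left_ideal_def)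
      then show ?thesis by blast
    qed
  qed
  ultimately show "J \<subseteq> carrier R \<and> lideal (h ` J)" ..
next
  assume J: "J \<subseteq> carrier R \<and> lideal (h ` J)"
  have mem: "x \<in> J" if "x \<in> carrier R" "h x \<in> h ` J" for x
    using that J h_inj by (auto simp: subset_iff)
  have sub: "x \<in> carrier R" if "x \<in> J" for x using that J by auto
  have Jl: "lideal (h ` J)" using J by simp
  show "left_ideal R J"
    unfolding left_ideal_def
  proof (intro conjI ballI)
    show mult: "a \<otimes> x \<in> J" if "a \<in> carrier R" "x \<in> J" for a x
      using that sub lidealD(4)[OF Jl, of "h a" "h x"] by (intro mem) (auto simp: h_mult h_mem)
    show "additive_subgroup J R"
    proof (rule additive_subgroupI, rule add.subgroupI)
      show "J \<subseteq> carrier R" using J by simp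
      show "J \<noteq> {}" using lidealD(2)[OF Jl] by auto
      show "x \<oplus> y \<in> J" if "x \<in> J" "y \<in> J" for x y
        using that sub lidealD(3)[OF Jl, of "h x" "h y"] by (intro mem) (auto simp: h_add)
      show "\<ominus> x \<in> J" if "x \<in> J" for x
        using mult[of "\<ominus> \<one>" x] that sub by (simp add: l_minus)
    qed
  qed
qed

lemma lideal_preimage:
  assumes "lideal K"
  obtains J where "J \<subseteq> carrier R" "h ` J = K"
proof
  show "{x \<in> carrier R. h x \<in> K} \<subseteq> carrier R" by blast
  show "h ` {x \<in> carrier R. h x \<in> K} = K" using h_surj lidealD(1)[OF assms] by blast
qed

lemma image_inj: "J \<subseteq> carrier R \<Longrightarrow> K \<subseteq> carrier R \<Longrightarrow> h ` J = h ` K \<longleftrightarrow> J = K"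
  using bij inj_on_image_eq_iff[of h "carrier R" J K] by (simp add: bij_betw_def)

lemma image_sub: "J \<subseteq> carrier R \<Longrightarrow> K \<subseteq> carrier R \<Longrightarrow> h ` J \<subseteq> h ` K \<longleftrightarrow> J \<subseteq> K"
  using h_inj by (auto simp: subset_iff image_iff)

lemma simple_left_ideal_iff: "simple_left_ideal R J \<longleftrightarrow> J \<subseteq> carrier R \<and> simple_lideal (h ` J)"
proof (cases "J \<subseteq> carrier R")
  case J: True
  have z: "h ` {\<zero>} = {0}" "{\<zero>} \<subseteq> carrier R" by (auto simp: h_zero)
  have "(\<forall>K. left_ideal R K \<and> K \<subseteq> J \<longrightarrow> K = {\<zero>} \<or> K = J) \<longleftrightarrow>
    (\<forall>K. lideal K \<and> K \<subseteq> h ` J \<longrightarrow> K = {0} \<or> K = h ` J)" (is "?l \<longleftrightarrow> ?r")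
  proof
    assume l: ?l
    show ?r
    proof (intro allI impI)
      fix K assume K: "lideal K \<and> K \<subseteq> h ` J"
      then obtain K' where K': "K' \<subseteq> carrier R" "h ` K' = K" using lideal_preimage by blast
      then have "left_ideal R K'" "K' \<subseteq> J" using K J left_ideal_iff image_sub[of K' J] by auto
      then have "K' = {\<zero>} \<or> K' = J" using l by blast
      then show "K = {0} \<or> K = h ` J" using K' z by auto
    qed
  next
    assume r: ?r
    show ?l
    proof (intro allI impI)
      fix K assume K: "left_ideal R K \<and> K \<subseteq> J"
      then have K': "K \<subseteq> carrier R" "lideal (h ` K)" "h ` K \<subseteq> h ` J" using left_ideal_iff by auto
      then have "h ` K = h ` {\<zero>} \<or> h ` K = h ` J" using r z by auto
      then show "K = {\<zero>} \<or> K = J" using image_inj K' z J by blast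
    qed
  qed
  moreover have "J \<noteq> {\<zero>} \<longleftrightarrow> h ` J \<noteq> {0}" using image_inj[OF J z(2)] z by auto
  ultimately show ?thesis
    unfolding simple_left_ideal_def simple_lideal_def left_ideal_iff using J by blast
qed (auto simp: simple_left_ideal_def left_ideal_iff)

lemma semisimple_imp_regular:
  assumes "semisimple R" "a \<in> S"
  shows "\<exists>x\<in>S. a * x * a = a"
proof -
  obtain m :: nat and L where L: "\<forall>i<m. simple_left_ideal R (L i)"
    "\<forall>x\<in>carrier R. \<exists>!f. f \<in> (\<Pi>\<^sub>E i\<in>{..<m}. L i) \<and> x = (\<Oplus>i\<in>{..<m}. f i)"
    using assms(1) unfolding semisimple_def by (elim exE conjE) (rule that)
  obtain v where v: "v \<in> carrier R" "h v = u" using h_surj[OF unit_mem] by blast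
  obtain f where f: "f \<in> (\<Pi>\<^sub>E i\<in>{..<m}. L i) \<and> v = (\<Oplus>i\<in>{..<m}. f i)"
    using ex1_implies_ex[OF bspec[OF L(2) v(1)]] ..
  have sub: "L i \<subseteq> carrier R" "simple_lideal (h ` L i)" if "i < m" for i
    using L(1) that simple_left_ideal_iff[of "L i"] by auto
  have fL: "f i \<in> L i" if "i < m" for i using f that by (auto simp: PiE_def Pi_def)
  have "u = (\<Sum>i<m. h (f i))"
    using h_finsum[of "{..<m}" f] fL sub(1) conjunct2[OF f] v(2) by (auto simp: Pi_def)
  then show ?thesis
    using simple_sum_regular[of m "\<lambda>i. h ` L i" "\<lambda>i. h (f i)", OF sub(2) _ _ assms(2)] fL by auto
qed

lemma semisimpleI:
  fixes m :: nat
  assumes simple: "\<And>i. i < m \<Longrightarrow> simple_lideal (L i)" and ind: "indep {0} L {..<m}" and span: "S \<subseteq> lsum {0} L {..<m}"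
  shows "semisimple R"
proof -
  define L' where "L' i = {x \<in> carrier R. h x \<in> L i}" for i
  have Ll: "lideal (L i)" if "i < m" for i using simple[OF that] by (simp add: simple_lideal_def)
  have sub: "L' i \<subseteq> carrier R" for i by (auto simp: L'_def)
  have "h ` L' i = L i" if "i < m" for i
    using h_surj lidealD(1)[OF Ll[OF that]] unfolding L'_def by blast
  then have "\<forall>i<m. simple_left_ideal R (L' i)" using simple sub by (simp add: simple_left_ideal_iff)
  moreover have "\<exists>!f. f \<in> (\<Pi>\<^sub>E i\<in>{..<m}. L' i) \<and> x = (\<Oplus>i\<in>{..<m}. f i)" if x: "x \<in> carrier R" for x
  proof (rule ex_ex1I)
    have mem: "f i \<in> carrier R" "h (f i) \<in> L i" if "f \<in> (\<Pi>\<^sub>E i\<in>{..<m}. L' i)" "i < m" for f i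
      using PiE_mem[OF that(1), of i] that(2) by (auto simp: L'_def)
    have hsum: "h (\<Oplus>i\<in>{..<m}. f i) = (\<Sum>i<m. h (f i))" if "f \<in> (\<Pi>\<^sub>E i\<in>{..<m}. L' i)" for f
      using mem[OF that] by (intro h_finsum) auto
    obtain g where g: "h x = (\<Sum>i<m. g i)" "\<forall>i<m. g i \<in> L i"
      using span h_mem[OF x] unfolding lsum_def by auto
    have "\<forall>i. \<exists>y. i < m \<longrightarrow> y \<in> carrier R \<and> h y = g i"
      using g(2) h_surj lidealD(1)[OF Ll] by blast
    then obtain y where y: "\<And>i. i < m \<Longrightarrow> y i \<in> carrier R \<and> h (y i) = g i" by metis
    have yL: "restrict y {..<m} \<in> (\<Pi>\<^sub>E i\<in>{..<m}. L' i)" using y g(2) by (auto simp: L'_def)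
    have "(\<Oplus>i\<in>{..<m}. restrict y {..<m} i) \<in> carrier R" using y by (intro finsum_closed) auto
    moreover have "h (\<Oplus>i\<in>{..<m}. restrict y {..<m} i) = h x"
      unfolding hsum[OF yL] g(1) by (rule sum.cong) (use y in auto)
    ultimately have "x = (\<Oplus>i\<in>{..<m}. restrict y {..<m} i)"
      using h_inj[OF x] by metis
    then show "\<exists>f. f \<in> (\<Pi>\<^sub>E i\<in>{..<m}. L' i) \<and> x = (\<Oplus>i\<in>{..<m}. f i)" using yL by blast
    fix p q assume p: "p \<in> (\<Pi>\<^sub>E i\<in>{..<m}. L' i) \<and> x = (\<Oplus>i\<in>{..<m}. p i)"
      and q: "q \<in> (\<Pi>\<^sub>E i\<in>{..<m}. L' i) \<and> x = (\<Oplus>i\<in>{..<m}. q i)"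
    note p1 = conjunct1[OF p] and q1 = conjunct1[OF q]
    have "(\<Sum>i<m. h (p i)) = (\<Sum>i<m. h (q i))"
      using hsum[OF p1] hsum[OF q1] conjunct2[OF p] conjunct2[OF q] by metis
    then have sum0: "(\<Sum>i<m. h (p i) - h (q i)) = 0" by (simp add: sum_subtractf)
    have diff: "h (p i) - h (q i) \<in> L i" if "i < m" for i
      using lidealD(3)[OF Ll[OF that] mem(2)[OF p1 that] lidealD(5)[OF Ll[OF that] mem(2)[OF q1 that]]] by simp
    have "\<forall>i\<in>{..<m}. h (p i) - h (q i) = 0"
      by (rule conjunct2[OF indepD[OF ind singletonI]]) (use diff sum0 in simp_all)
    then have "p i = q i" if "i < m" for i using h_inj mem(1)[OF p1 that] mem(1)[OF q1 that] that by auto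
    then show "p = q" using p1 q1 by (intro PiE_ext) auto
  qed
  ultimately show ?thesis unfolding semisimple_def by (intro exI[of _ m] exI[of _ L']) simp
qed

end

section \<open>Realisation by endomorphisms\<close>

text \<open>
  A quotient ring in the sense of \<^theory>\<open>HOL-Algebra.QuotRing\<close> is not a type of class \<^class>\<open>ring\<close>. All
  computations are therefore carried out in endomorphism rings, in which the quotient is embedded.
\<close>

typedef (overloaded) 'a endo = "{f :: 'a::ab_group_add \<Rightarrow> 'a. \<forall>x y. f (x + y) = f x + f y}"
  morphisms apply_endo Endo
  by (rule exI[of _ id]) simp

setup_lifting type_definition_endo

instantiation endo :: (ab_group_add) ring
begin

lift_definition zero_endo :: "'a endo" is "\<lambda>_. 0" by simp
lift_definition plus_endo :: "'a endo \<Rightarrow> 'a endo \<Rightarrow> 'a endo" is "\<lambda>f g x. f x + g x" by simp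
lift_definition minus_endo :: "'a endo \<Rightarrow> 'a endo \<Rightarrow> 'a endo" is "\<lambda>f g x. f x - g x" by simp
lift_definition uminus_endo :: "'a endo \<Rightarrow> 'a endo" is "\<lambda>f x. - f x" by simp
lift_definition times_endo :: "'a endo \<Rightarrow> 'a endo \<Rightarrow> 'a endo" is "\<lambda>f g x. f (g x)" by simp

instance
  by standard (transfer; simp add: fun_eq_iff ac_simps)+

end

lemma apply_endo_mult [simp]: "apply_endo (f * g) x = apply_endo f (apply_endo g x)"
  by transfer simp

lemma apply_endo_plus [simp]: "apply_endo (f + g) x = apply_endo f x + apply_endo g x"
  by transfer simp

lemma apply_endo_zero [simp]: "apply_endo 0 x = 0"
  by transfer simp

lemma apply_Endo: "(\<And>x y. f (x + y) = f x + f y) \<Longrightarrow> apply_endo (Endo f) x = f x"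
  by (simp add: Endo_inverse)

lemma endo_eqI: "(\<And>x. apply_endo f x = apply_endo g x) \<Longrightarrow> f = g"
  by (simp add: apply_endo_inject[symmetric] fun_eq_iff)

section \<open>Quotients inside the type of noncommutative polynomials\<close>

lemma scalar_simps:
  "scalar (a + b) = scalar a + (scalar b :: ('g, 'r::comm_ring_1) ncpoly)"
  "scalar (a * b) = scalar a * (scalar b :: ('g, 'r::comm_ring_1) ncpoly)"
  "scalar 1 = (1 :: ('g, 'r::comm_ring_1) ncpoly)"
  by (simp_all add: scalar_def single_add mult_single)

lemma vector_space_ncpoly: "vector_space (\<lambda>c (p :: ('g, 'r::field) ncpoly). scalar c * p)"
  by standard (simp_all add: scalar_simps algebra_simps)

text \<open>The map \<open>g\<close> is the projection along \<open>J\<close> onto a linear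
  complement obtained by extending a basis of \<open>J\<close>. Its value is a normal form modulo
  \<open>J\<close>, so quotients need no new type.\<close>

lemma exists_projection:
  fixes J :: "('g, 'r::field) ncpoly set"
  assumes "0 \<in> J" "\<And>x y. x \<in> J \<Longrightarrow> y \<in> J \<Longrightarrow> x + y \<in> J" "\<And>c x. x \<in> J \<Longrightarrow> scalar c * x \<in> J"
  shows "\<exists>g. (\<forall>x y. g (x + y) = g x + g y) \<and> (\<forall>x. g x = 0 \<longleftrightarrow> x \<in> J) \<and> (\<forall>x. x - g x \<in> J)"
proof -
  let ?sc = "\<lambda>c (p :: ('g, 'r) ncpoly). scalar c * p"
  interpret VP: vector_space_pair ?sc ?sc
    by (intro vector_space_pair.intro vector_space_ncpoly)
  have sub: "VP.vs1.subspace J" using assms by (auto simp: VP.vs1.subspace_def)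
  obtain B where B: "B \<subseteq> J" "VP.vs1.independent B" "J \<subseteq> VP.vs1.span B"
    using VP.vs1.maximal_independent_subset[of J] by blast
  let ?C = "VP.vs1.extend_basis B"
  have C: "VP.vs1.independent ?C" "VP.vs1.span ?C = UNIV"
    using VP.vs1.independent_extend_basis[OF B(2)] VP.vs1.span_extend_basis[OF B(2)] by auto
  define g where "g = VP.construct ?C (\<lambda>b. if b \<in> B then 0 else b)"
  have lin: "Vector_Spaces.linear ?sc ?sc g"
    unfolding g_def by (rule VP.linear_construct[OF C(1)])
  have gb: "g b = (if b \<in> B then 0 else b)" if "b \<in> ?C" for b
    unfolding g_def by (rule VP.construct_basis[OF C(1) that])
  have BC: "B \<subseteq> ?C" by (rule VP.vs1.extend_basis_superset[OF B(2)])
  have add: "g (x + y) = g x + g y" for x y by (rule VP.linear_add[OF lin])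
  have scale: "g (scalar c * x) = scalar c * g x" for c x by (rule VP.linear_scale[OF lin])
  have zero: "g x = 0" if "x \<in> J" for x
  proof (rule VP.linear_eq_0_on_span[OF lin])
    show "g b = 0" if "b \<in> B" for b using gb[of b] BC that by auto
    show "x \<in> VP.vs1.span B" using B(3) that by blast
  qed
  have diff: "x - g x \<in> J" for x
  proof -
    have "x \<in> VP.vs1.span ?C" by (simp add: C)
    then show ?thesis
    proof (rule VP.vs1.span_induct)
      have *: "x + y - g (x + y) = (x - g x) + (y - g y)" "scalar c * x - g (scalar c * x) = scalar c * (x - g x)" for x y c
        by (simp_all add: add scale algebra_simps)
      show "VP.vs1.subspace {x. x - g x \<in> J}"
        unfolding VP.vs1.subspace_def mem_Collect_eq * using assms zero[OF assms(1)] by auto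
      show "x - g x \<in> J" if "x \<in> ?C" for x
        using gb[OF that] B(1) assms(1) by auto
    qed
  qed
  have "g x = 0 \<longleftrightarrow> x \<in> J" for x using zero[of x] diff[of x] by auto
  with add diff show ?thesis by blast
qed

lemma (in ring) quotient_embedding:
  fixes \<phi> :: "'a \<Rightarrow> 'd::ring"
  assumes J: "ideal J R"
    and add: "\<And>x y. x \<in> carrier R \<Longrightarrow> y \<in> carrier R \<Longrightarrow> \<phi> (x \<oplus> y) = \<phi> x + \<phi> y"
    and mult: "\<And>x y. x \<in> carrier R \<Longrightarrow> y \<in> carrier R \<Longrightarrow> \<phi> (x \<otimes> y) = \<phi> x * \<phi> y"
    and ker: "\<And>x. x \<in> carrier R \<Longrightarrow> \<phi> x = 0 \<longleftrightarrow> x \<in> J"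
  shows "ring_embedding (\<phi> ` carrier R) (\<phi> \<one>) (R Quot J) (\<lambda>X. \<phi> (SOME a. a \<in> carrier R \<and> X = J +> a))"
proof -
  interpret J: ideal J R by (rule J)
  interpret Q: ring "R Quot J" by (rule J.quotient_is_ring)
  let ?h = "\<lambda>X. \<phi> (SOME a. a \<in> carrier R \<and> X = J +> a)"
  have zero: "\<phi> \<zero> = 0" using add[of \<zero> \<zero>] by simp
  have neg: "\<phi> (\<ominus> x) = - \<phi> x" if "x \<in> carrier R" for x
    using add[of "\<ominus> x" x] that zero by (simp add: l_neg eq_neg_iff_add_eq_0)
  have eq: "\<phi> x = \<phi> y \<longleftrightarrow> J +> x = J +> y" if "x \<in> carrier R" "y \<in> carrier R" for x y
  proof -
    have "\<phi> (x \<ominus> y) = \<phi> x - \<phi> y" using that by (simp add: minus_eq add neg)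
    then show ?thesis
      using ker[of "x \<ominus> y"] quotient_eq_iff_same_a_r_cos[OF J that] that by simp
  qed
  have h: "?h (J +> x) = \<phi> x" if "x \<in> carrier R" for x
  proof -
    have "(SOME a. a \<in> carrier R \<and> J +> x = J +> a) \<in> carrier R \<and> J +> x = J +> (SOME a. a \<in> carrier R \<and> J +> x = J +> a)"
      by (rule someI[of _ x]) (use that in simp)
    then show ?thesis using eq that by metis
  qed
  have carr: "carrier (R Quot J) = (+>) J ` carrier R"
    by (auto simp: FactRing_def A_RCOSETS_def')
  note hom = ring_hom_add[OF J.rcos_ring_hom] ring_hom_mult[OF J.rcos_ring_hom]
  show ?thesis
  proof
    show "\<phi> \<one> \<in> \<phi> ` carrier R" by simp
    show "x + y \<in> \<phi> ` carrier R" if "x \<in> \<phi> ` carrier R" "y \<in> \<phi> ` carrier R" for x y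
      using that by (auto simp flip: add)
    show "x * y \<in> \<phi> ` carrier R" if "x \<in> \<phi> ` carrier R" "y \<in> \<phi> ` carrier R" for x y
      using that by (auto simp flip: mult)
    show "- x \<in> \<phi> ` carrier R" if "x \<in> \<phi> ` carrier R" for x
      using that by (auto simp flip: neg)
    show "\<phi> \<one> * x = x" "x * \<phi> \<one> = x" if "x \<in> \<phi> ` carrier R" for x
      using that by (auto simp flip: mult)
    show "bij_betw ?h (carrier (R Quot J)) (\<phi> ` carrier R)"
      unfolding bij_betw_def
    proof
      show "inj_on ?h (carrier (R Quot J))"
        unfolding inj_on_def carr using h eq by auto
      show "?h ` carrier (R Quot J) = \<phi> ` carrier R"
        unfolding carr image_image using h by auto
    qed
    fix X Y assume "X \<in> carrier (R Quot J)" "Y \<in> carrier (R Quot J)"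
    then obtain x y where xy: "x \<in> carrier R" "y \<in> carrier R" "X = J +> x" "Y = J +> y" using carr by auto
    show "?h (X \<oplus>\<^bsub>R Quot J\<^esub> Y) = ?h X + ?h Y" "?h (X \<otimes>\<^bsub>R Quot J\<^esub> Y) = ?h X * ?h Y"
      unfolding xy(3,4) hom[OF xy(1,2), symmetric] using xy(1,2) by (simp_all only: h add mult add.m_closed m_closed)
  qed
qed

lemma free_algebra_simps:
  "x \<oplus>\<^bsub>free_algebra V\<^esub> y = x + y" "x \<otimes>\<^bsub>free_algebra V\<^esub> y = x * y"
  "\<zero>\<^bsub>free_algebra V\<^esub> = 0" "\<one>\<^bsub>free_algebra V\<^esub> = 1"
  by (simp_all add: free_algebra_def)

lemma free_algebra_closed:
  fixes x y :: "('g, 'r::comm_ring_1) ncpoly"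
  shows "x \<in> carrier (free_algebra V) \<Longrightarrow> y \<in> carrier (free_algebra V) \<Longrightarrow> x + y \<in> carrier (free_algebra V)"
    "x \<in> carrier (free_algebra V) \<Longrightarrow> y \<in> carrier (free_algebra V) \<Longrightarrow> x - y \<in> carrier (free_algebra V)"
    "x \<in> carrier (free_algebra V) \<Longrightarrow> y \<in> carrier (free_algebra V) \<Longrightarrow> x * y \<in> carrier (free_algebra V)"
    "0 \<in> carrier (free_algebra V :: ('g, 'r) ncpoly ring)"
    "1 \<in> carrier (free_algebra V :: ('g, 'r) ncpoly ring)"
    "scalar c \<in> carrier (free_algebra V :: ('g, 'r) ncpoly ring)"
    "i \<in> V \<Longrightarrow> gen i \<in> carrier (free_algebra V :: ('g, 'r) ncpoly ring)"
  using keys_add[of x y] keys_diff[of x y] keys_mult[of x y]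
  by (fastforce simp: free_algebra_def gen_def scalar_def)+

lemma ncpoly_expand:
  fixes p :: "('g, 'r::comm_ring_1) ncpoly"
  shows "p = (\<Sum>w\<in>Poly_Mapping.keys p. Poly_Mapping.single w (Poly_Mapping.lookup p w))"
proof (rule poly_mapping_eqI)
  fix k
  show "Poly_Mapping.lookup p k = Poly_Mapping.lookup (\<Sum>w\<in>Poly_Mapping.keys p. Poly_Mapping.single w (Poly_Mapping.lookup p w)) k"
    by (cases "k \<in> Poly_Mapping.keys p")
      (auto simp: lookup_sum lookup_single when_def in_keys_iff intro!: sum.neutral[symmetric])
qed

section \<open>Homomorphisms out of the presented algebra\<close>

definition TLD_ideal :: "nat \<Rightarrow> 'r::comm_ring_1 \<Rightarrow> (nat, 'r) ncpoly set" where
  "TLD_ideal n \<delta> = genideal (free_algebra (D_vertices n)) (TLD_relators n \<delta>)"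

lemma D_vertices_eq: "1 \<le> n \<Longrightarrow> D_vertices n = {..<n}"
  by (auto simp: D_vertices_def)

lemma D_edges_iff:
  assumes "4 \<le> n" "i < n" "j < n"
  shows "{i, j} \<in> D_edges n \<longleftrightarrow> D_adj i j"
proof -
  have "{i, j} \<in> {{k, k + 1} |k. 2 \<le> k \<and> k \<le> n - 2} \<longleftrightarrow> 2 \<le> i \<and> j = Suc i \<or> 2 \<le> j \<and> i = Suc j"
    using assms by (force simp: doubleton_eq_iff)
  then show ?thesis
    unfolding D_edges_def D_adj_def by (auto simp: doubleton_eq_iff)
qed

locale TLD_hom =
  fixes \<phi> :: "(nat, 'r::field) ncpoly \<Rightarrow> 'b::ring" and n :: nat and \<delta> :: 'r
  assumes n4: "4 \<le> n"
    and add: "x \<in> carrier (free_algebra {..<n}) \<Longrightarrow> y \<in> carrier (free_algebra {..<n}) \<Longrightarrow> \<phi> (x + y) = \<phi> x + \<phi> y"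
    and mult: "x \<in> carrier (free_algebra {..<n}) \<Longrightarrow> y \<in> carrier (free_algebra {..<n}) \<Longrightarrow> \<phi> (x * y) = \<phi> x * \<phi> y"
    and ker: "x \<in> TLD_ideal n \<delta> \<Longrightarrow> \<phi> x = 0"
begin

abbreviation F :: "(nat, 'r) ncpoly set" where
  "F \<equiv> carrier (free_algebra {..<n})"

lemmas Fc = free_algebra_closed[where V = "{..<n}"]

lemma sub: "\<phi> (x - y) = \<phi> x - \<phi> y" if "x \<in> F" "y \<in> F" for x y
  using add[of "x - y" y] that Fc(2)[OF that] by simp

lemma relator: "x - y \<in> TLD_relators n \<delta> \<Longrightarrow> x \<in> F \<Longrightarrow> y \<in> F \<Longrightarrow> \<phi> x = \<phi> y"
  using ker[of "x - y"] ring.genideal_self[OF ring_free_algebra TLD_relators_carrier, of n \<delta>] sub[of x y]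
  by (auto simp: TLD_ideal_def)

abbreviation s :: "'r \<Rightarrow> 'b" where "s c \<equiv> \<phi> (scalar c)"
abbreviation e :: "nat \<Rightarrow> 'b" where "e i \<equiv> \<phi> (gen i)"

lemma scalar_commute: "scalar c * p = p * (scalar c :: (nat, 'r) ncpoly)"
proof -
  have "Poly_Mapping.single 0 c * Poly_Mapping.single w d = Poly_Mapping.single w d * Poly_Mapping.single 0 c" for w :: "nat free_monoid" and d
    by (simp add: mult_single mult.commute)
  then show ?thesis
    by (subst (1 2) ncpoly_expand[of p]) (simp add: scalar_def sum_distrib_left sum_distrib_right)
qed

sublocale TLD_rel s e n \<delta>
proof
  have V: "D_vertices n = {..<n}" using n4 by (intro D_vertices_eq) simp
  have g: "gen i \<in> F" if "i < n" for i using that Fc(7) by simp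
  show "s (c + d) = s c + s d" "s (c * d) = s c * s d" for c d
    using add[OF Fc(6) Fc(6)] mult[OF Fc(6) Fc(6)] by (simp_all add: scalar_simps)
  show "s 1 * e i = e i" "s c * e i = e i * s c" if "i < n" for i c
    using mult[OF Fc(6) g[OF that], of 1] mult[OF Fc(6) g[OF that], of c] mult[OF g[OF that] Fc(6), of c]
    by (simp_all add: scalar_simps scalar_commute)
  show "e i * e i = s \<delta> * e i" if "i < n" for i
  proof -
    have "gen i * gen i - scalar \<delta> * gen i \<in> TLD_relators n \<delta>"
      unfolding TLD_relators_def V using that by blast
    then show ?thesis using relator g[OF that] mult Fc(3,6) by metis
  qed
  show "e i * e j = e j * e i" if "i < n" "j < n" "i \<noteq> j" "\<not> D_adj i j" for i j
  proof -
    have "gen i * gen j - gen j * gen i \<in> TLD_relators n \<delta>"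
      unfolding TLD_relators_def V using that D_edges_iff[OF n4 that(1,2)] by blast
    then show ?thesis using relator g that mult Fc(3) by metis
  qed
  show "e i * e j * e i = e i" if "i < n" "j < n" "D_adj i j" for i j
  proof -
    have "gen i * gen j * gen i - gen i \<in> TLD_relators n \<delta>"
      unfolding TLD_relators_def V using that D_edges_iff[OF n4 that(1,2)] by blast
    then show ?thesis using relator g that mult Fc(3) by metis
  qed
qed (rule n4)

lemma image_F: "\<phi> ` F = S"
proof
  have zero: "\<phi> 0 = 0" using add[OF Fc(4) Fc(4)] by simp
  have mono: "\<phi> (Poly_Mapping.single (Word l) c) \<in> S" if "set l \<subseteq> {..<n}" for l c
    using that
  proof (induction l rule: rev_induct)
    case Nil
    then show ?case using alg_scal[of c] by (simp add: scalar_def zero_free_monoid_def)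
  next
    case (snoc i l)
    have eq: "Poly_Mapping.single (Word (l @ [i])) c = Poly_Mapping.single (Word l) c * gen i"
      by (simp add: gen_def mult_single plus_free_monoid_def)
    have F: "Poly_Mapping.single (Word l) c \<in> F" "gen i \<in> F"
      using snoc.prems Fc(7)[of i] by (auto simp: free_algebra_def)
    show ?case unfolding eq mult[OF F] using snoc by (intro alg_step) auto
  qed
  show "\<phi> ` F \<subseteq> S"
  proof
    fix y assume "y \<in> \<phi> ` F"
    then obtain p where p: "p \<in> F" "y = \<phi> p" by blast
    have "(\<Sum>w\<in>W. Poly_Mapping.single w (Poly_Mapping.lookup p w)) \<in> F \<and>
       \<phi> (\<Sum>w\<in>W. Poly_Mapping.single w (Poly_Mapping.lookup p w)) \<in> S"
      if "finite W" "W \<subseteq> Poly_Mapping.keys p" for W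
      using that
    proof induction
      case empty
      then show ?case using Fc(4) zero alg_zero by simp
    next
      case (insert w W)
      have l: "set (letters w) \<subseteq> {..<n}" using p insert by (auto simp: free_algebra_def)
      have 1: "Poly_Mapping.single w (Poly_Mapping.lookup p w) \<in> F" using l by (auto simp: free_algebra_def)
      have 2: "\<phi> (Poly_Mapping.single w (Poly_Mapping.lookup p w)) \<in> S" using mono[OF l] by simp
      show ?case using insert 1 2 Fc(1) by (auto simp: add intro: alg_add)
    qed
    from this[of "Poly_Mapping.keys p"] show "y \<in> S" using p ncpoly_expand[of p] by simp
  qed
  show "S \<subseteq> \<phi> ` F"
  proof
    fix y assume "y \<in> S"
    then show "y \<in> \<phi> ` F"
    proof (induction rule: alg.induct)
      case (alg_scal c)
      then show ?case using Fc(6) by blast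
    next
      case (alg_add x y)
      then obtain p q where pq: "p \<in> F" "q \<in> F" "x = \<phi> p" "y = \<phi> q" by blast
      then have "x + y = \<phi> (p + q)" "p + q \<in> F" using Fc(1) by (simp_all add: add)
      then show ?case by blast
    next
      case (alg_step x y)
      then obtain p i where p: "p \<in> F" "x = \<phi> p" "i < n" "y = e i" by auto
      have "gen i \<in> F" using p Fc(7) by simp
      then have "x * y = \<phi> (p * gen i)" "p * gen i \<in> F" using p Fc(3) by (simp_all add: mult)
      then show ?case by blast
    qed
  qed
qed

end

lemma ideal_TLD_ideal: "ideal (TLD_ideal n \<delta>) (free_algebra (D_vertices n))"
  unfolding TLD_ideal_def by (intro ring.genideal_ideal ring_free_algebra TLD_relators_carrier)

text \<open>
  The projections turn the quotient of the free algebra into a subspace of the type of all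
  noncommutative polynomials, on which \<open>a\<close> acts by \<open>x \<mapsto> g (a (r x))\<close>.
\<close>

lemma exists_faithful:
  fixes \<delta> :: "'r::field"
  assumes n: "4 \<le> n"
  obtains \<phi> :: "(nat, 'r) ncpoly \<Rightarrow> (nat, 'r) ncpoly endo" where "TLD_hom \<phi> n \<delta>"
    "\<And>x. x \<in> carrier (free_algebra {..<n}) \<Longrightarrow> \<phi> x = 0 \<longleftrightarrow> x \<in> TLD_ideal n \<delta>"
proof -
  let ?F = "carrier (free_algebra {..<n}) :: (nat, 'r) ncpoly set"
  let ?J = "TLD_ideal n \<delta>"
  have V: "D_vertices n = {..<n}" using n by (intro D_vertices_eq) simp
  interpret J: ideal ?J "free_algebra {..<n} :: (nat, 'r) ncpoly ring"
    using ideal_TLD_ideal[of n \<delta>] by (simp add: V)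
  note Fc = free_algebra_closed[where V = "{..<n}" and 'r = 'r]
  have JF: "x \<in> ?F" if "x \<in> ?J" for x using J.Icarr[OF that] .
  have Jadd: "x + y \<in> ?J" if "x \<in> ?J" "y \<in> ?J" for x y
    using additive_subgroup.a_closed[OF J.additive_subgroup_axioms that] by (simp add: free_algebra_simps)
  have Jl: "a * x \<in> ?J" if "a \<in> ?F" "x \<in> ?J" for a x
    using J.I_l_closed[OF that(2,1)] by (simp add: free_algebra_simps)
  have Jr: "x * a \<in> ?J" if "a \<in> ?F" "x \<in> ?J" for a x
    using J.I_r_closed[OF that(2,1)] by (simp add: free_algebra_simps)
  have J0: "0 \<in> ?J" using additive_subgroup.zero_closed[OF J.additive_subgroup_axioms] by (simp add: free_algebra_simps)
  obtain g where g: "\<And>x y. g (x + y) = g x + g y" "\<And>x. g x = 0 \<longleftrightarrow> x \<in> ?J" "\<And>x. x - g x \<in> ?J"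
    using exists_projection[OF J0 Jadd Jl[OF Fc(6)]] by blast
  obtain h where h: "\<And>x y. h (x + y) = h x + h y" "\<And>x. h x = 0 \<longleftrightarrow> x \<in> ?F" "\<And>x. x - h x \<in> ?F"
    using exists_projection[OF Fc(4) Fc(1) Fc(3)[OF Fc(6)]] by blast
  define r where "r x = x - h x" for x
  have r: "r (x + y) = r x + r y" "r x \<in> ?F" for x y using h by (auto simp: r_def)
  have rF: "r x = x" if "x \<in> ?F" for x using h(2)[of x] that by (simp add: r_def)
  have gF: "g x \<in> ?F" if "x \<in> ?F" for x
    using Fc(2)[OF that JF[OF g(3)[of x]]] by simp
  have gsub: "g (x - y) = g x - g y" for x y using g(1)[of "x - y" y] by simp
  define \<phi> where "\<phi> a = Endo (\<lambda>x. g (a * r x))" for a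
  have ap: "apply_endo (\<phi> a) x = g (a * r x)" for a x
    unfolding \<phi>_def by (rule apply_Endo) (simp add: r g distrib_left)
  have zero: "\<phi> x = 0" if "x \<in> ?J" for x
    using g(2) Jr[OF r(2) that] by (intro endo_eqI) (simp add: ap)
  \<comment> \<open>Faithfulness is tested on the vector 1, on which \<open>x\<close> acts with
    value \<open>g x\<close> because 1 lies in the free algebra.\<close>
  have zeroD: "x \<in> ?J" if "\<phi> x = 0" for x
    using ap[of x 1] rF[OF Fc(5)] g(2)[of x] that by simp
  have "TLD_hom \<phi> n \<delta>"
  proof
    show "\<phi> (x + y) = \<phi> x + \<phi> y" for x y
      by (rule endo_eqI) (simp add: ap g distrib_right)
    show "\<phi> (x * y) = \<phi> x * \<phi> y" if xy: "x \<in> ?F" "y \<in> ?F" for x y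
    proof (rule endo_eqI)
      fix z
      have y: "y * r z \<in> ?F" using Fc(3) xy r by auto
      \<comment> \<open>The inner normal form changes the argument by an element of the ideal only,
        and left multiplication keeps it there.\<close>
      have "x * (y * r z - g (y * r z)) \<in> ?J" by (rule Jl[OF xy(1) g(3)])
      then have "g (x * (y * r z) - x * g (y * r z)) = 0" using g(2) by (simp add: right_diff_distrib)
      then show "apply_endo (\<phi> (x * y)) z = apply_endo (\<phi> x * \<phi> y) z"
        by (simp add: ap gsub rF gF[OF y] mult.assoc)
    qed
  qed (use n zero in auto)
  then show thesis using that[of \<phi>] zero zeroD by blast
qed

lemma TLD_embedding:
  fixes \<phi> :: "(nat, 'r::field) ncpoly \<Rightarrow> 'b::ring"
  assumes "TLD_hom \<phi> n \<delta>"
    and ker: "\<And>x. x \<in> carrier (free_algebra {..<n}) \<Longrightarrow> \<phi> x = 0 \<longleftrightarrow> x \<in> TLD_ideal n \<delta>"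
  shows "\<exists>h. ring_embedding (\<phi> ` carrier (free_algebra {..<n})) (\<phi> 1) (TLD n \<delta>) h"
proof -
  interpret H: TLD_hom \<phi> n \<delta> by fact
  have V: "D_vertices n = {..<n}" using H.n4 by (intro D_vertices_eq) simp
  have T: "TLD n \<delta> = free_algebra {..<n} Quot TLD_ideal n \<delta>" by (simp add: TLD_def TLD_ideal_def V)
  interpret F: ring "free_algebra {..<n} :: (nat, 'r) ncpoly ring" by (rule ring_free_algebra)
  show ?thesis
    unfolding T using F.quotient_embedding[of "TLD_ideal n \<delta>" \<phi>] ideal_TLD_ideal[of n \<delta>] H.add H.mult ker
    by (auto simp: free_algebra_simps V)
qed

text \<open>Regularity holds in the faithful realisation and is pushed to an arbitrary target: the
  defect \<open>a * x * a - a\<close> lies in the ideal of relations, which every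
  \<open>TLD_hom\<close> kills.\<close>

lemma TLD_regular:
  fixes \<psi> :: "(nat, 'r::field) ncpoly \<Rightarrow> 'b::ring"
  assumes "semisimple (TLD n \<delta>)" "TLD_hom \<psi> n \<delta>" "b \<in> \<psi> ` carrier (free_algebra {..<n})"
  shows "\<exists>x\<in>\<psi> ` carrier (free_algebra {..<n}). b * x * b = b"
proof -
  interpret H: TLD_hom \<psi> n \<delta> by fact
  obtain \<phi> :: "(nat, 'r) ncpoly \<Rightarrow> (nat, 'r) ncpoly endo" where \<phi>: "TLD_hom \<phi> n \<delta>"
    "\<And>x. x \<in> carrier (free_algebra {..<n}) \<Longrightarrow> \<phi> x = 0 \<longleftrightarrow> x \<in> TLD_ideal n \<delta>"
    using exists_faithful[OF H.n4] by blast
  interpret P: TLD_hom \<phi> n \<delta> by fact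
  obtain h where "ring_embedding (\<phi> ` P.F) (\<phi> 1) (TLD n \<delta>) h" using TLD_embedding[OF \<phi>] by blast
  then interpret E: ring_embedding "\<phi> ` P.F" "\<phi> 1" "TLD n \<delta>" h .
  obtain a where a: "a \<in> P.F" "b = \<psi> a" using assms(3) by blast
  obtain x where x: "x \<in> P.F" "\<phi> a * \<phi> x * \<phi> a = \<phi> a"
    using E.semisimple_imp_regular[OF assms(1), of "\<phi> a"] a by auto
  have axa: "a * x * a \<in> P.F" "a * x \<in> P.F" using a x P.Fc(3) by auto
  have "\<phi> (a * x * a - a) = 0"
    using x a axa by (simp add: P.sub P.mult)
  then have "a * x * a - a \<in> TLD_ideal n \<delta>" using \<phi>(2) P.Fc(2)[OF axa(1) a(1)] by simp
  then have "\<psi> (a * x * a - a) = 0" by (rule H.ker)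
  then have "b * \<psi> x * b = b" using x a axa by (simp add: H.sub H.mult)
  then show ?thesis using x by blast
qed

lemma aspan_sumE:
  assumes "x \<in> aspan B"
  obtains N :: nat and f where "\<And>i. i < N \<Longrightarrow> f i \<in> B" "x = (\<Sum>i<N. f i)"
proof -
  have "\<exists>(N::nat) f. (\<forall>i<N. f i \<in> B) \<and> x = (\<Sum>i<N. f i)"
    using assms
  proof induction
    case aspan_zero
    then show ?case by (intro exI[of _ 0]) auto
  next
    case (aspan_base b)
    then show ?case by (intro exI[of _ 1] exI[of _ "\<lambda>_. b"]) auto
  next
    case (aspan_add x y)
    then obtain N M :: nat and f g where fg: "\<forall>i<N. f i \<in> B" "x = (\<Sum>i<N. f i)" "\<forall>i<M. g i \<in> B" "y = (\<Sum>i<M. g i)"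
      by blast
    define k where "k i = (if i < N then f i else g (i - N))" for i
    have "(\<Sum>i<N + M. k i) = (\<Sum>i<N. k i) + (\<Sum>i=N..<N + M. k i)"
      by (simp add: lessThan_atLeast0 sum.atLeastLessThan_concat)
    also have "(\<Sum>i=N..<N + M. k i) = (\<Sum>i<M. g i)"
      using sum.shift_bounds_nat_ivl[of k 0 N M] by (simp add: k_def lessThan_atLeast0 add.commute)
    also have "(\<Sum>i<N. k i) = (\<Sum>i<N. f i)" by (rule sum.cong) (auto simp: k_def)
    finally have "(\<Sum>i<N + M. k i) = x + y" by (simp add: fg)
    moreover have "\<forall>i<N + M. k i \<in> B" using fg by (auto simp: k_def)
    ultimately show ?case by metis
  qed
  then show thesis using that by blast
qed

lemma TLD_semisimple:
  fixes \<delta> :: "'r::field"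
  assumes n: "4 \<le> n" and nz: "\<And>j. 1 \<le> j \<Longrightarrow> j < n \<Longrightarrow> cheb 1 \<delta> j \<noteq> 0 \<and> cheb 2 \<delta> j \<noteq> 0"
  shows "semisimple (TLD n \<delta>)"
proof -
  obtain \<phi> :: "(nat, 'r) ncpoly \<Rightarrow> (nat, 'r) ncpoly endo" where \<phi>: "TLD_hom \<phi> n \<delta>"
    "\<And>x. x \<in> carrier (free_algebra {..<n}) \<Longrightarrow> \<phi> x = 0 \<longleftrightarrow> x \<in> TLD_ideal n \<delta>"
    using exists_faithful[OF n] by blast
  interpret P: TLD_hom \<phi> n \<delta> by fact
  obtain h where "ring_embedding (\<phi> ` P.F) (\<phi> 1) (TLD n \<delta>) h" using TLD_embedding[OF \<phi>] by blast
  then interpret E: ring_embedding P.S "P.s 1" "TLD n \<delta>" h by (simp add: P.image_F scalar_simps)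
  obtain Q where Q: "P.full_family Q (P.s 1)" using P.full_family_exists[OF nz] by blast
  have QS: "p \<in> P.S" if "p \<in> Q" for p using Q that by (auto simp: P.full_family_def)
  have "P.s 1 \<in> aspan {a * p * b |a b p. a \<in> P.S \<and> b \<in> P.S \<and> p \<in> Q}"
    using Q by (simp add: P.full_family_def)
  then obtain N :: nat and f where f: "\<And>i. i < N \<Longrightarrow> f i \<in> {a * p * b |a b p. a \<in> P.S \<and> b \<in> P.S \<and> p \<in> Q}"
    "P.s 1 = (\<Sum>i<N. f i)" using aspan_sumE by blast
  have "\<forall>i. \<exists>x p y. i < N \<longrightarrow> f i = x * p * y \<and> x \<in> P.S \<and> y \<in> P.S \<and> p \<in> Q" using f(1) by blast
  then obtain x p y where xpy: "\<And>i. i < N \<Longrightarrow> f i = x i * p i * y i \<and> x i \<in> P.S \<and> y i \<in> P.S \<and> p i \<in> Q"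
    by metis
  have "\<exists>(m::nat) M. (\<forall>i<m. E.simple_lideal (M i)) \<and> E.indep {0} M {..<m} \<and> P.S \<subseteq> E.lsum {0} M {..<m}"
  proof (rule E.orthogonal_family_direct[of N p x y])
    show "P.s 1 = (\<Sum>i<N. x i * p i * y i)" using f(2) xpy by simp
    show "p i * a * p j = 0" if "i < N" "j < N" "p i \<noteq> p j" "a \<in> P.S" for i j a
      using that xpy Q by (auto simp: P.full_family_def)
    show "\<exists>z\<in>P.S. z * (p i * a * p i) = p i" if i: "i < N" "a \<in> P.S" "p i * a * p i \<noteq> 0" for i a
    proof -
      have "\<forall>p\<in>Q. \<forall>x\<in>P.S. \<exists>c. p * x * p = P.s c * p" using Q by (simp add: P.full_family_def)
      then obtain c where c: "p i * a * p i = P.s c * p i" using i(2) xpy[OF i(1)] by blast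
      then have "c \<noteq> 0" using i(3) by auto
      then have "P.s (1 / c) * (p i * a * p i) = P.s 1 * p i" unfolding c by (simp add: P.s_s_left)
      then show ?thesis using P.S_unit(1)[of "p i"] QS xpy i by (intro bexI[of _ "P.s (1 / c)"] P.alg_scal) auto
    qed
  qed (use xpy QS in auto)
  then show ?thesis using E.semisimpleI by blast
qed

section \<open>Evaluation of noncommutative polynomials\<close>

context scalars
begin

text \<open>The coefficient starts the fold because the target need not have a unit to serve as the
  value of the empty word.\<close>

definition word_value :: "(nat \<Rightarrow> 'a) \<Rightarrow> 'r \<Rightarrow> nat list \<Rightarrow> 'a" where
  "word_value e c l = foldl (\<lambda>x i. x * e i) (s c) l"

definition poly_value :: "(nat \<Rightarrow> 'a) \<Rightarrow> (nat, 'r) ncpoly \<Rightarrow> 'a" where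
  "poly_value e p = (\<Sum>w\<in>Poly_Mapping.keys p. word_value e (Poly_Mapping.lookup p w) (letters w))"

lemma word_value_snoc: "word_value e c (l @ [i]) = word_value e c l * e i"
  by (simp add: word_value_def)

lemma word_value_add: "word_value e (c + d) l = word_value e c l + word_value e d l"
  by (induction l rule: rev_induct) (simp_all add: word_value_snoc distrib_right, simp add: word_value_def s_add)

lemma word_value_zero: "word_value e 0 l = 0"
  using word_value_add[of e 0 0 l] by simp

lemma poly_value_add: "poly_value e (p + q) = poly_value e p + poly_value e q"
  unfolding poly_value_def
  by (rule setsum_keys_plus_distrib) (simp_all add: word_value_zero word_value_add)

lemma poly_value_sum: "poly_value e (sum f I) = (\<Sum>i\<in>I. poly_value e (f i))"
  by (induction I rule: infinite_finite_induct) (simp_all add: poly_value_add, simp_all add: poly_value_def)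

lemma poly_value_single: "poly_value e (Poly_Mapping.single w c) = word_value e c (letters w)"
  by (cases "c = 0") (simp_all add: poly_value_def word_value_zero)

lemma word_value_mult:
  assumes "\<And>i c. s c * e i = e i * s c"
  shows "word_value e c l * word_value e d l' = word_value e (c * d) (l @ l')"
proof (induction l' rule: rev_induct)
  case Nil
  have "word_value e c l * s d = word_value e (c * d) l"
  proof (induction l rule: rev_induct)
    case (snoc i l)
    have "word_value e c (l @ [i]) * s d = word_value e c l * s d * e i"
      using assms[of d i] by (simp add: word_value_snoc mult.assoc)
    then show ?case using snoc by (simp add: word_value_snoc)
  qed (simp add: word_value_def s_mult)
  then show ?case by (simp add: word_value_def)
next
  case (snoc i l')
  then show ?case
    by (simp add: word_value_snoc mult.assoc[symmetric] del: append_assoc add: append_assoc[symmetric])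
qed

lemma poly_value_mult:
  assumes "\<And>i c. s c * e i = e i * s c"
  shows "poly_value e (p * q) = poly_value e p * poly_value e q"
proof -
  let ?m = "\<lambda>p w. Poly_Mapping.single w (Poly_Mapping.lookup p w)"
  have "p * q = (\<Sum>w\<in>Poly_Mapping.keys p. \<Sum>v\<in>Poly_Mapping.keys q. ?m p w * ?m q v)"
    by (subst (1) ncpoly_expand[of p], subst (1) ncpoly_expand[of q]) (rule sum_product)
  then have "poly_value e (p * q) = (\<Sum>w\<in>Poly_Mapping.keys p. \<Sum>v\<in>Poly_Mapping.keys q. poly_value e (?m p w * ?m q v))"
    by (simp add: poly_value_sum)
  also have "\<dots> = (\<Sum>w\<in>Poly_Mapping.keys p. \<Sum>v\<in>Poly_Mapping.keys q. poly_value e (?m p w) * poly_value e (?m q v))"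
    by (simp add: mult_single poly_value_single word_value_mult[OF assms])
  also have "\<dots> = poly_value e p * poly_value e q"
    by (simp add: poly_value_single sum_product[symmetric]) (simp add: poly_value_def)
  finally show ?thesis .
qed

text \<open>Universal property of the presentation: the kernel of the evaluation is an ideal
  containing the relators, hence contains the ideal generated by them.\<close>

lemma TLD_hom_value:
  assumes "TLD_rel s e n \<delta>" "\<And>i c. s c * e i = e i * s c"
  shows "TLD_hom (poly_value e) n \<delta>" "i < n \<Longrightarrow> poly_value e (gen i) = e i" "poly_value e (scalar c) = s c"
proof -
  interpret T: TLD_rel s e n \<delta> by fact
  have V: "D_vertices n = {..<n}" using T.n4 by (intro D_vertices_eq) simp
  note Fc = free_algebra_closed[where V = "{..<n}" and 'r = 'r]
  interpret F: ring "free_algebra {..<n} :: (nat, 'r) ncpoly ring" by (rule ring_free_algebra)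
  have g: "poly_value e (gen i) = e i" if "i < n" for i
    using T.unit[OF that] by (simp add: gen_def poly_value_single word_value_def)
  have sc: "poly_value e (scalar c) = s c" for c
    by (simp add: scalar_def poly_value_single word_value_def)
  show "i < n \<Longrightarrow> poly_value e (gen i) = e i" "poly_value e (scalar c) = s c" by (fact g sc)+
  note m = poly_value_mult[of e, OF assms(2)]
  have sub: "poly_value e (x - y) = poly_value e x - poly_value e y" for x y using poly_value_add[of e "x - y" y] by simp
  have zero: "poly_value e 0 = 0" by (simp add: poly_value_def)
  let ?K = "{p \<in> carrier (free_algebra {..<n}). poly_value e p = 0}"
  have "ideal ?K (free_algebra {..<n})"
  proof (rule idealI[OF F.ring_axioms])
    show "subgroup ?K (add_monoid (free_algebra {..<n}))"
    proof (rule F.add.subgroupI)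
      show "\<ominus>\<^bsub>free_algebra {..<n}\<^esub> x \<in> ?K" if "x \<in> ?K" for x
      proof -
        have x: "x \<in> carrier (free_algebra {..<n})" using that by simp
        have "x + \<ominus>\<^bsub>free_algebra {..<n}\<^esub> x = 0" using F.r_neg[OF x] by (simp add: free_algebra_simps)
        then have "poly_value e x + poly_value e (\<ominus>\<^bsub>free_algebra {..<n}\<^esub> x) = 0" by (metis poly_value_add zero)
        then show ?thesis using that F.a_inv_closed[OF x] by simp
      qed
    qed (use Fc(1) Fc(4) in \<open>auto simp: free_algebra_simps poly_value_add zero\<close>)
  qed (use Fc(3) in \<open>auto simp: free_algebra_simps m\<close>)
  moreover have "TLD_relators n \<delta> \<subseteq> ?K"
  proof
    fix x assume x: "x \<in> TLD_relators n \<delta>"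
    then have "x \<in> carrier (free_algebra {..<n})" using TLD_relators_carrier[of n \<delta>] by (auto simp: V)
    moreover have "poly_value e x = 0"
      using x D_edges_iff[OF T.n4] unfolding TLD_relators_def V
      by (auto simp: sub m g sc T.sq T.braid intro: T.far)
    ultimately show "x \<in> ?K" by simp
  qed
  ultimately have "TLD_ideal n \<delta> \<subseteq> ?K"
    unfolding TLD_ideal_def V by (rule F.genideal_minimal)
  then show "TLD_hom (poly_value e) n \<delta>"
    by unfold_locales (use T.n4 in \<open>auto simp: poly_value_add m\<close>)
qed

lemma semisimple_regular:
  assumes "semisimple (TLD n \<delta>)" "TLD_rel s e n \<delta>" "\<And>i c. s c * e i = e i * s c"
    and "b \<in> alg (e ` {..<n})"
  shows "\<exists>x\<in>alg (e ` {..<n}). b * x * b = b"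
proof -
  note h = TLD_hom_value[OF assms(2,3)]
  interpret H: TLD_hom "poly_value e" n \<delta> by (rule h(1))
  have "(\<lambda>i. poly_value e (gen i)) ` {..<n} = e ` {..<n}" "(\<lambda>c. poly_value e (scalar c)) = s" using h by auto
  then have "poly_value e ` carrier (free_algebra {..<n}) = alg (e ` {..<n})"
    using H.image_F by simp
  then show ?thesis using TLD_regular[OF assms(1) h(1), of b] assms(4) by simp
qed

end

section \<open>Representations on functions and the module for \<delta> = 0\<close>

definition scale_fun :: "'r::comm_ring_1 \<Rightarrow> ('x \<Rightarrow> 'r) endo" where
  "scale_fun c = Endo (\<lambda>f x. c * f x)"

lemma apply_scale_fun [simp]: "apply_endo (scale_fun c) f = (\<lambda>x. c * f x)"
  unfolding scale_fun_def by (subst apply_Endo) (auto simp: fun_eq_iff distrib_left)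

lemma scalars_scale_fun: "scalars (scale_fun :: 'r::field \<Rightarrow> ('x \<Rightarrow> 'r) endo)"
  by standard (auto intro!: endo_eqI simp: fun_eq_iff distrib_right)

text \<open>
  A module for \<open>\<delta> = 0\<close>. The vectors \<open>v\<^sub>i = (True, i)\<close> span the module with \<open>e\<^sub>i v\<^sub>j = v\<^sub>i\<close> for adjacent
  \<open>i, j\<close>, the vectors \<open>u\<^sub>k = (False, k)\<close> its type A analogue with the vertices \<open>0\<close> and \<open>1\<close> identified. The
  extension is nonsplit: \<open>e\<^sub>0 v\<^sub>1 = e\<^sub>1 v\<^sub>0 = u\<^sub>1\<close>, so that \<open>e\<^sub>0 e\<^sub>1 v\<^sub>2 = u\<^sub>1\<close>.
\<close>

fun nbr_D :: "nat \<Rightarrow> (nat \<Rightarrow> 'r::comm_ring_1) \<Rightarrow> 'r" where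
  "nbr_D 0 f = f 2"
| "nbr_D (Suc 0) f = f 2"
| "nbr_D (Suc (Suc 0)) f = f 0 + f 1 + f 3"
| "nbr_D (Suc (Suc (Suc k))) f = f (k + 2) + f (k + 4)"

fun nbr_A :: "nat \<Rightarrow> (nat \<Rightarrow> 'r::comm_ring_1) \<Rightarrow> 'r" where
  "nbr_A 0 f = 0"
| "nbr_A (Suc 0) f = f 2"
| "nbr_A (Suc (Suc k)) f = f (k + 1) + f (k + 3)"

text \<open>Vectors are given by their coefficient functions: the new coefficient at
  \<open>i\<close> is the sum of the old ones over the neighbours of \<open>i\<close>. In the second
  component \<open>max i 1\<close> identifies the fork vertices 0 and 1. The chain is not cut off,
  which does not disturb the relations.\<close>

definition refl_op :: "nat \<Rightarrow> (bool \<times> nat \<Rightarrow> 'r::comm_ring_1) \<Rightarrow> (bool \<times> nat \<Rightarrow> 'r)" where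
  "refl_op i f = (\<lambda>(b, k).
     if b then (if k = i then nbr_D i (\<lambda>j. f (True, j)) else 0)
     else (if k = max i 1 then nbr_A (max i 1) (\<lambda>j. f (False, j)) +
       (if i = 0 then f (True, 1) else if i = 1 then f (True, 0) else 0) else 0))"

lemma nbr_add: "nbr_D i (\<lambda>k. f k + g k) = nbr_D i f + nbr_D i g" "nbr_A i (\<lambda>k. f k + g k) = nbr_A i f + nbr_A i g"
  by (cases "(i, f)" rule: nbr_D.cases; simp) (cases "(i, f)" rule: nbr_A.cases; simp)

lemma nbr_scale: "nbr_D i (\<lambda>k. c * f k) = c * nbr_D i f" "nbr_A i (\<lambda>k. c * f k) = c * nbr_A i f"
  by (cases "(i, f)" rule: nbr_D.cases; simp add: distrib_left) (cases "(i, f)" rule: nbr_A.cases; simp add: distrib_left)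

lemma refl_op_add: "refl_op i (f + g) = refl_op i f + refl_op i g"
  by (auto simp: refl_op_def fun_eq_iff nbr_add)

lemma refl_op_scale: "refl_op i (\<lambda>x. c * f x) = (\<lambda>x. c * refl_op i f x)"
  by (auto simp: refl_op_def fun_eq_iff nbr_scale distrib_left)

lemma nbr_D_single: "nbr_D i (\<lambda>k. if k = j then x else 0) = (if D_adj i j then x else 0)"
  by (cases "(i, \<lambda>_::nat. x)" rule: nbr_D.cases) (auto simp: D_adj_def)

lemma nbr_A_single: "1 \<le> i \<Longrightarrow> nbr_A i (\<lambda>k. if k = j then x else 0) = (if j \<noteq> 0 \<and> (i = Suc j \<or> j = Suc i) then x else 0)"
  by (cases "(i, \<lambda>_::nat. x)" rule: nbr_A.cases) auto

lemma refl_op_apply: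
  "refl_op i f (True, k) = (if k = i then nbr_D i (\<lambda>l. f (True, l)) else 0)"
  "refl_op i f (False, k) = (if k = max i 1 then nbr_A (max i 1) (\<lambda>l. f (False, l)) +
     (if i = 0 then f (True, 1) else if i = 1 then f (True, 0) else 0) else 0)"
  by (simp_all add: refl_op_def)

lemma refl2_True:
  "refl_op i (refl_op j f) (True, k) = (if k = i \<and> D_adj i j then nbr_D j (\<lambda>l. f (True, l)) else 0)"
  unfolding refl_op_apply nbr_D_single by simp

text \<open>The condition \<open>i + j = 1\<close> says that \<open>i\<close> and \<open>j\<close>
  are the two ends of the fork; its term is the contribution of the nonsplit extension.\<close>

lemma refl2_False:
  "refl_op i (refl_op j f) (False, k) = (if k = max i 1 then
       (if max i 1 = Suc (max j 1) \<or> max j 1 = Suc (max i 1) then refl_op j f (False, max j 1) else 0) +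
       (if i + j = 1 then nbr_D j (\<lambda>l. f (True, l)) else 0) else 0)"
proof -
  define Y where "Y = refl_op j f (False, max j 1)"
  define X where "X = nbr_D j (\<lambda>l. f (True, l))"
  have "refl_op j f (False, l) = (if l = max j 1 then Y else 0)" for l
    unfolding Y_def by (cases "l = max j 1") (simp_all add: refl_op_apply(2))
  then have A: "nbr_A (max i 1) (\<lambda>l. refl_op j f (False, l)) =
      (if max i 1 = Suc (max j 1) \<or> max j 1 = Suc (max i 1) then Y else 0)"
    by (simp only: nbr_A_single[OF max.cobounded2]) simp
  have "refl_op j f (True, l) = (if l = j then X else 0)" for l
    unfolding X_def by (rule refl_op_apply(1))
  then have B: "(if i = 0 then refl_op j f (True, 1) else if i = 1 then refl_op j f (True, 0) else 0) = (if i + j = 1 then X else 0)"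
    by (cases "i = 0"; cases "i = 1"; cases "j = 0"; cases "j = 1") simp_all
  show ?thesis
    unfolding refl_op_apply(2)[of i "refl_op j f"] A B Y_def X_def ..
qed

definition refl_endo :: "nat \<Rightarrow> (bool \<times> nat \<Rightarrow> 'r::field) endo" where
  "refl_endo i = Endo (refl_op i)"

lemma apply_refl_endo [simp]: "apply_endo (refl_endo i) f = refl_op i f"
  unfolding refl_endo_def by (rule apply_Endo) (rule refl_op_add)

lemma refl_endo_scale: "scale_fun c * refl_endo i = refl_endo i * scale_fun c"
  by (rule endo_eqI) (simp add: refl_op_scale)

lemma refl_ext:
  assumes "\<And>k. f (True, k) = g (True, k)" "\<And>k. f (False, k) = g (False, k)"
  shows "f = (g :: bool \<times> nat \<Rightarrow> 'r)"
proof
  fix x show "f x = g x" using assms by (cases x; cases "fst x") simp_all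
qed

lemma refl_op_sq: "refl_op i (refl_op i f) = (\<lambda>x. 0 * refl_op i f x)"
proof (rule refl_ext)
  have "\<not> D_adj i i" by (auto simp: D_adj_def)
  then show "refl_op i (refl_op i f) (True, k) = 0 * refl_op i f (True, k)" for k
    unfolding refl2_True by simp
  have "i + i \<noteq> 1" by presburger
  then show "refl_op i (refl_op i f) (False, k) = 0 * refl_op i f (False, k)" for k
    unfolding refl2_False by simp
qed

lemma refl_op_far:
  assumes "i \<noteq> j" "\<not> D_adj i j"
  shows "refl_op i (refl_op j f) = refl_op j (refl_op i f)"
proof (rule refl_ext)
  have n: "\<not> D_adj j i" using assms by (auto simp: D_adj_def)
  show "refl_op i (refl_op j f) (True, k) = refl_op j (refl_op i f) (True, k)" for k
    unfolding refl2_True using n assms by simp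
  have "\<not> (max i 1 = Suc (max j 1) \<or> max j 1 = Suc (max i 1))"
    using assms by (auto simp: D_adj_def max_def split: if_splits)
  moreover have "i + j = 1 \<Longrightarrow> max i 1 = max j 1 \<and> nbr_D j (\<lambda>l. f (True, l)) = nbr_D i (\<lambda>l. f (True, l))"
    by (cases i; cases j) auto
  ultimately show "refl_op i (refl_op j f) (False, k) = refl_op j (refl_op i f) (False, k)" for k
    unfolding refl2_False by (cases "i + j = 1") (simp_all add: add.commute[of j i] del: max_Suc_Suc)
qed

lemma refl_op_braid:
  assumes "D_adj i j"
  shows "refl_op i (refl_op j (refl_op i f)) = refl_op i f"
proof (rule refl_ext)
  have a: "D_adj j i" "i + j \<noteq> 1" "max i 1 = Suc (max j 1) \<or> max j 1 = Suc (max i 1)"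
    using assms by (auto simp: D_adj_def max_def)
  have T: "refl_op i f (True, k) = (if k = i then nbr_D i (\<lambda>l. f (True, l)) else 0)" for k
    by (simp add: refl_op_def)
  have N: "nbr_D j (\<lambda>l. refl_op i f (True, l)) = nbr_D i (\<lambda>l. f (True, l))"
    unfolding T nbr_D_single using a by simp
  show "refl_op i (refl_op j (refl_op i f)) (True, k) = refl_op i f (True, k)" for k
    unfolding refl2_True N unfolding T using assms by simp
  have X: "refl_op j (refl_op i f) (False, max j 1) = refl_op i f (False, max i 1)"
    unfolding refl2_False using a by (simp only: add.commute[of j i] if_True if_False simp_thms add_0_right disj_commute)
  have Z: "refl_op i f (False, k) = 0" if "k \<noteq> max i 1" for k
    using that by (simp add: refl_op_def)
  show "refl_op i (refl_op j (refl_op i f)) (False, k) = refl_op i f (False, k)" for k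
    unfolding refl2_False[of i j "refl_op i f" k] X using a Z[of k] by (cases "k = max i 1") (simp_all only: if_True if_False simp_thms add_0_right)
qed

lemma TLD_rel_refl:
  assumes "4 \<le> n"
  shows "TLD_rel scale_fun (refl_endo :: nat \<Rightarrow> (bool \<times> nat \<Rightarrow> 'r::field) endo) n 0"
proof (intro TLD_rel.intro scalars_scale_fun TLD_rel_axioms.intro assms refl_endo_scale)
  show "scale_fun 1 * refl_endo i = (refl_endo i :: (bool \<times> nat \<Rightarrow> 'r) endo)" for i
    by (rule endo_eqI) simp
  show "refl_endo i * refl_endo i = scale_fun 0 * (refl_endo i :: (bool \<times> nat \<Rightarrow> 'r) endo)" for i
    by (rule endo_eqI) (simp only: apply_endo_mult apply_refl_endo apply_scale_fun refl_op_sq)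
  show "refl_endo i * refl_endo j = refl_endo j * (refl_endo i :: (bool \<times> nat \<Rightarrow> 'r) endo)"
    if "i \<noteq> j" "\<not> D_adj i j" for i j
    by (rule endo_eqI) (simp only: apply_endo_mult apply_refl_endo refl_op_far[OF that])
  show "refl_endo i * refl_endo j * refl_endo i = (refl_endo i :: (bool \<times> nat \<Rightarrow> 'r) endo)"
    if "D_adj i j" for i j
    by (rule endo_eqI) (simp only: apply_endo_mult apply_refl_endo refl_op_braid[OF that])
qed

lemma refl_endo_01: "refl_endo 0 * refl_endo 1 \<noteq> (0 :: (bool \<times> nat \<Rightarrow> 'r::field) endo)"
proof
  assume h: "refl_endo 0 * refl_endo 1 = (0 :: (bool \<times> nat \<Rightarrow> 'r) endo)"
  define f :: "bool \<times> nat \<Rightarrow> 'r" where "f = (\<lambda>_. 1)"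
  have "apply_endo (refl_endo 0 * refl_endo 1) f (False, 1) = apply_endo 0 f (False, 1)"
    unfolding h ..
  moreover have "apply_endo (refl_endo 0 * refl_endo 1) f (False, 1) = 1"
    unfolding apply_endo_mult apply_refl_endo refl2_False by (simp add: f_def)
  ultimately show False unfolding apply_endo_zero by simp
qed

section \<open>A tensor representation\<close>

type_synonym site = "bool \<times> bool"

lemma sum_site: "(\<Sum>a\<in>UNIV. f a) = f (False, False) + f (False, True) + (f (True, False) + f (True, True))"
  for f :: "site \<Rightarrow> 'r::comm_monoid_add"
proof -
  have "(\<Sum>a\<in>UNIV. f a) = (\<Sum>x\<in>UNIV. \<Sum>y\<in>UNIV. f (x, y))"
    by (simp add: sum.cartesian_product UNIV_Times_UNIV)
  then show ?thesis by (simp add: UNIV_bool ac_simps)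
qed

abbreviation site_sum :: "(site \<Rightarrow> 'r) \<Rightarrow> 'r::comm_monoid_add" (binder "\<Sum>\<^sub>s" 10) where
  "site_sum f \<equiv> sum f UNIV"

lemma sum_shuffle:
  fixes k :: "site \<Rightarrow> site \<Rightarrow> site \<Rightarrow> site \<Rightarrow> 'r::comm_monoid_add"
  shows "(\<Sum>\<^sub>s a b v. h a b v) = (\<Sum>\<^sub>s v a b. h a b v :: 'r)"
    "(\<Sum>\<^sub>s a b c v. k a b c v) = (\<Sum>\<^sub>s v a b c. k a b c v)"
    "(\<Sum>\<^sub>s a b c d. k a b c d) = (\<Sum>\<^sub>s c d a b. k a b c d)"
  using sum.swap[of "\<lambda>x v. h (fst x) (snd x) v" UNIV "UNIV \<times> UNIV"]
    sum.swap[of "\<lambda>x v. k (fst x) (fst (snd x)) (snd (snd x)) v" UNIV "UNIV \<times> UNIV \<times> UNIV"]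
    sum.swap[of "\<lambda>x y. k (fst x) (snd x) (fst y) (snd y)" "UNIV \<times> UNIV" "UNIV \<times> UNIV"]
  by (simp_all add: sum.cartesian_product' del: UNIV_Times_UNIV)

text \<open>
  Vectors are functions on strings of sites, and \<open>local_op \<alpha> \<beta> i\<close> contracts the tensor factors
  \<open>i, i + 1\<close> with the form \<open>\<beta>\<close> and inserts the tensor \<open>\<alpha>\<close> there.
\<close>

definition local_op :: "(site \<Rightarrow> site \<Rightarrow> 'r::comm_ring_1) \<Rightarrow> (site \<Rightarrow> site \<Rightarrow> 'r) \<Rightarrow> nat \<Rightarrow>
    ((nat \<Rightarrow> site) \<Rightarrow> 'r) \<Rightarrow> ((nat \<Rightarrow> site) \<Rightarrow> 'r)" where
  "local_op \<alpha> \<beta> i f = (\<lambda>s. \<alpha> (s i) (s (Suc i)) * (\<Sum>\<^sub>s a b. \<beta> a b * f (s(i := a, Suc i := b))))"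

lemma local_op_add: "local_op \<alpha> \<beta> i (f + g) = local_op \<alpha> \<beta> i f + local_op \<alpha> \<beta> i g"
  by (simp add: local_op_def fun_eq_iff distrib_left sum.distrib)

lemma local_op_scale: "local_op \<alpha> \<beta> i (\<lambda>x. c * f x) = (\<lambda>x. c * local_op \<alpha> \<beta> i f x)"
  by (simp add: local_op_def fun_eq_iff sum_distrib_left mult.left_commute)

lemma local_op_same:
  "local_op \<alpha> \<beta> i (local_op \<alpha>' \<beta>' i f) = (\<lambda>s. (\<Sum>\<^sub>s a b. \<beta> a b * \<alpha>' a b) * local_op \<alpha> \<beta>' i f s)"
proof
  fix s :: "nat \<Rightarrow> site"
  let ?X = "\<Sum>\<^sub>s a b. \<beta>' a b * f (s(i := a, Suc i := b))"
  have "local_op \<alpha> \<beta> i (local_op \<alpha>' \<beta>' i f) s = \<alpha> (s i) (s (Suc i)) * (\<Sum>\<^sub>s a b. \<beta> a b * \<alpha>' a b * ?X)"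
    by (simp add: local_op_def mult.assoc)
  also have "\<dots> = (\<Sum>\<^sub>s a b. \<beta> a b * \<alpha>' a b) * (\<alpha> (s i) (s (Suc i)) * ?X)"
    by (simp add: sum_distrib_right ac_simps)
  finally show "local_op \<alpha> \<beta> i (local_op \<alpha>' \<beta>' i f) s = (\<Sum>\<^sub>s a b. \<beta> a b * \<alpha>' a b) * local_op \<alpha> \<beta>' i f s"
    by (simp add: local_op_def)
qed

lemma local_op_far:
  fixes f :: "(nat \<Rightarrow> site) \<Rightarrow> 'a::comm_ring_1"
  assumes "i + 2 \<le> j"
  shows "local_op \<alpha> \<beta> i (local_op \<alpha>' \<beta>' j f) = local_op \<alpha>' \<beta>' j (local_op \<alpha> \<beta> i f)"
proof
  fix s :: "nat \<Rightarrow> site"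
  have ne: "i \<noteq> j" "Suc i \<noteq> j" "i \<noteq> Suc j" using assms by auto
  let ?t = "\<lambda>a b c d. s(i := a, Suc i := b, j := c, Suc j := d)"
  have swap: "s(j := c, Suc j := d, i := a, Suc i := b) = ?t a b c d" for a b c d
    using ne by (auto simp: fun_eq_iff)
  have 1: "local_op \<alpha> \<beta> i (local_op \<alpha>' \<beta>' j f) s = \<alpha> (s i) (s (Suc i)) * \<alpha>' (s j) (s (Suc j)) *
      (\<Sum>\<^sub>s a b c d. \<beta> a b * \<beta>' c d * f (?t a b c d))"
    using ne by (simp add: local_op_def sum_distrib_left ac_simps)
  have 2: "local_op \<alpha>' \<beta>' j (local_op \<alpha> \<beta> i f) s = \<alpha> (s i) (s (Suc i)) * \<alpha>' (s j) (s (Suc j)) *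
      (\<Sum>\<^sub>s c d a b. \<beta> a b * \<beta>' c d * f (?t a b c d))"
    using ne by (simp add: local_op_def sum_distrib_left ac_simps swap)
  show "local_op \<alpha> \<beta> i (local_op \<alpha>' \<beta>' j f) s = local_op \<alpha>' \<beta>' j (local_op \<alpha> \<beta> i f) s"
    unfolding 1 2 by (intro arg_cong2[where f = "(*)"] refl sum_shuffle(3))
qed

text \<open>The hypothesis is the zigzag identity: the two cups and two caps met in the middle
  compose to the identity of a single tensor factor.\<close>

lemma local_op_zigzag1:
  assumes "\<And>u v. (\<Sum>\<^sub>s a b c. \<beta> a b * \<alpha>' b u * (\<beta>' c v * \<alpha> a c)) = (if u = v then 1 else 0)"
  shows "local_op \<alpha> \<beta> i (local_op \<alpha>' \<beta>' (Suc i) (local_op \<alpha> \<beta> i f)) = local_op \<alpha> \<beta> i f"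
proof
  fix s :: "nat \<Rightarrow> site"
  let ?r = "s (Suc (Suc i))"
  \<comment> \<open>\<open>?g v\<close> is the first contraction with the third site holding
    \<open>v\<close>. The zigzag identity reduces the sum over \<open>v\<close> to the actual entry
    \<open>?r\<close>.\<close>
  let ?g = "\<lambda>v. \<Sum>\<^sub>s x y. \<beta> x y * f (s(i := x, Suc i := y, Suc (Suc i) := v))"
  have upd: "s(i := a, Suc i := c, Suc (Suc i) := v, i := x, Suc i := y) = s(i := x, Suc i := y, Suc (Suc i) := v)" for a c v x y
    by (auto simp: fun_eq_iff)
  have upd3: "s(Suc (Suc i) := v, i := x, Suc i := y) = s(i := x, Suc i := y, Suc (Suc i) := v)" for v x y
    by (auto simp: fun_eq_iff)
  have upd2: "s(i := a, Suc i := b, Suc i := c) = s(i := a, Suc i := c)" for a b c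
    by (auto simp: fun_eq_iff)
  have "local_op \<alpha> \<beta> i (local_op \<alpha>' \<beta>' (Suc i) (local_op \<alpha> \<beta> i f)) s =
     \<alpha> (s i) (s (Suc i)) * (\<Sum>\<^sub>s a b. \<beta> a b * (\<alpha>' b ?r * (\<Sum>\<^sub>s c v. \<beta>' c v * (\<alpha> a c * ?g v))))"
    by (simp add: local_op_def upd upd2 upd3)
  also have "(\<Sum>\<^sub>s a b. \<beta> a b * (\<alpha>' b ?r * (\<Sum>\<^sub>s c v. \<beta>' c v * (\<alpha> a c * ?g v))))
     = (\<Sum>\<^sub>s v. (\<Sum>\<^sub>s a b c. \<beta> a b * \<alpha>' b ?r * (\<beta>' c v * \<alpha> a c)) * ?g v)"
  proof -
    have "(\<Sum>\<^sub>s a b. \<beta> a b * (\<alpha>' b ?r * (\<Sum>\<^sub>s c v. \<beta>' c v * (\<alpha> a c * ?g v))))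
     = (\<Sum>\<^sub>s a b c v. \<beta> a b * \<alpha>' b ?r * (\<beta>' c v * \<alpha> a c) * ?g v)"
      by (simp only: sum_distrib_left mult.assoc)
    also have "\<dots> = (\<Sum>\<^sub>s v a b c. \<beta> a b * \<alpha>' b ?r * (\<beta>' c v * \<alpha> a c) * ?g v)"
      by (rule sum_shuffle(2))
    finally show ?thesis by (simp only: sum_distrib_right)
  qed
  also have "\<dots> = (\<Sum>\<^sub>s v. if v = ?r then ?g ?r else 0)"
    unfolding assms by (intro sum.cong) auto
  also have "\<dots> = ?g ?r" by simp
  also have "\<alpha> (s i) (s (Suc i)) * ?g ?r = local_op \<alpha> \<beta> i f s"
  proof -
    have "s(i := x, Suc i := y, Suc (Suc i) := ?r) = s(i := x, Suc i := y)" for x y by (auto simp: fun_eq_iff)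
    then show ?thesis by (simp add: local_op_def)
  qed
  finally show "local_op \<alpha> \<beta> i (local_op \<alpha>' \<beta>' (Suc i) (local_op \<alpha> \<beta> i f)) s = local_op \<alpha> \<beta> i f s" .
qed

lemma local_op_zigzag2:
  assumes "\<And>u v. (\<Sum>\<^sub>s b c d. \<beta>' b c * \<alpha> u b * (\<beta> v d * \<alpha>' d c)) = (if u = v then 1 else 0)"
  shows "local_op \<alpha>' \<beta>' (Suc i) (local_op \<alpha> \<beta> i (local_op \<alpha>' \<beta>' (Suc i) f)) = local_op \<alpha>' \<beta>' (Suc i) f"
proof
  fix s :: "nat \<Rightarrow> site"
  let ?r = "s i"
  let ?g = "\<lambda>v. \<Sum>\<^sub>s x y. \<beta>' x y * f (s(i := v, Suc i := x, Suc (Suc i) := y))"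
  have upd: "s(Suc i := b, Suc (Suc i) := c, i := v, Suc i := d, Suc i := x, Suc (Suc i) := y) = s(i := v, Suc i := x, Suc (Suc i) := y)" for b c d v x y
    by (auto simp: fun_eq_iff)
  have "local_op \<alpha>' \<beta>' (Suc i) (local_op \<alpha> \<beta> i (local_op \<alpha>' \<beta>' (Suc i) f)) s =
     \<alpha>' (s (Suc i)) (s (Suc (Suc i))) * (\<Sum>\<^sub>s b c. \<beta>' b c * (\<alpha> ?r b * (\<Sum>\<^sub>s v d. \<beta> v d * (\<alpha>' d c * ?g v))))"
    unfolding local_op_def using upd by (simp add: fun_upd_twist)
  also have "(\<Sum>\<^sub>s b c. \<beta>' b c * (\<alpha> ?r b * (\<Sum>\<^sub>s v d. \<beta> v d * (\<alpha>' d c * ?g v))))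
     = (\<Sum>\<^sub>s v. (\<Sum>\<^sub>s b c d. \<beta>' b c * \<alpha> ?r b * (\<beta> v d * \<alpha>' d c)) * ?g v)"
  proof -
    have "(\<Sum>\<^sub>s b c. \<beta>' b c * (\<alpha> ?r b * (\<Sum>\<^sub>s v d. \<beta> v d * (\<alpha>' d c * ?g v))))
     = (\<Sum>\<^sub>s b c v d. \<beta>' b c * \<alpha> ?r b * (\<beta> v d * \<alpha>' d c) * ?g v)"
      by (simp only: sum_distrib_left mult.assoc)
    also have "\<dots> = (\<Sum>\<^sub>s v b c d. \<beta>' b c * \<alpha> ?r b * (\<beta> v d * \<alpha>' d c) * ?g v)"
      by (rule sum_shuffle(1))
    finally show ?thesis by (simp only: sum_distrib_right)
  qed
  also have "\<dots> = (\<Sum>\<^sub>s v. if v = ?r then ?g ?r else 0)"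
    unfolding assms by (intro sum.cong) auto
  also have "\<dots> = ?g ?r" by simp
  finally show "local_op \<alpha>' \<beta>' (Suc i) (local_op \<alpha> \<beta> i (local_op \<alpha>' \<beta>' (Suc i) f)) s = local_op \<alpha>' \<beta>' (Suc i) f s"
    by (simp add: local_op_def)
qed

text \<open>
  The pivot has trace \<open>\<delta>\<close> and so has its inverse, which makes every loop evaluate to \<open>\<delta>\<close>. Its product
  with the permutation \<open>flip\<close> of the sites has trace \<open>0\<close>, which makes \<open>e\<^sub>0 e\<^sub>1 = 0\<close>. The block
  \<open>{True} \<times> bool\<close> is diagonal, so all cups vanish on pairs of distinct basis vectors of this block.
\<close>

fun pivot :: "'r::comm_ring_1 \<Rightarrow> site \<Rightarrow> site \<Rightarrow> 'r" where
  "pivot \<delta> (x, a) (y, b) = (if x \<noteq> y then 0 else if x then (if a \<noteq> b then 0 else if a then 1 else - 1)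
     else (if a then (if b then 0 else 1) else (if b then - 1 else \<delta>)))"

text \<open>On the block marked \<open>False\<close> the pivot is the matrix with rows (\<delta>,
  -1) and (1, 0), of determinant 1 and trace \<delta>, so its inverse has trace \<delta> as well.
  The other block is diag(-1, 1), of trace 0 and its own inverse.\<close>

fun pivot_inv :: "'r::comm_ring_1 \<Rightarrow> site \<Rightarrow> site \<Rightarrow> 'r" where
  "pivot_inv \<delta> (x, a) (y, b) = (if x \<noteq> y then 0 else if x then (if a \<noteq> b then 0 else if a then 1 else - 1)
     else (if a then (if b then \<delta> else - 1) else (if b then 1 else 0)))"

definition flip :: "site \<Rightarrow> site" where
  "flip a = (fst a, if fst a then snd a else \<not> snd a)"

text \<open>Odd operators insert the identity and contract with \<open>pivot\<close>; even ones
  insert \<open>pivot_inv\<close> and contract with the identity. A zigzag of neighbours thus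
  composes \<open>pivot\<close> with its inverse. Index 0 counts as odd and acts on the sites of
  \<open>e 1\<close>, twisted by \<open>d\<close>: \<open>id\<close> makes it equal to
  \<open>e 1\<close>, \<open>flip\<close> orthogonal to it.\<close>

definition cup :: "(site \<Rightarrow> site) \<Rightarrow> 'r::comm_ring_1 \<Rightarrow> nat \<Rightarrow> site \<Rightarrow> site \<Rightarrow> 'r" where
  "cup d \<delta> i a b = (if i = 0 then of_bool (d a = b) else if odd i then of_bool (a = b) else pivot_inv \<delta> a b)"

definition cap :: "(site \<Rightarrow> site) \<Rightarrow> 'r::comm_ring_1 \<Rightarrow> nat \<Rightarrow> site \<Rightarrow> site \<Rightarrow> 'r" where
  "cap d \<delta> i a b = (if i = 0 then pivot \<delta> (d a) b else if odd i then pivot \<delta> a b else of_bool (a = b))"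

definition tensor_op :: "(site \<Rightarrow> site) \<Rightarrow> 'r::comm_ring_1 \<Rightarrow> nat \<Rightarrow> ((nat \<Rightarrow> site) \<Rightarrow> 'r) \<Rightarrow> ((nat \<Rightarrow> site) \<Rightarrow> 'r)" where
  "tensor_op d \<delta> i = local_op (cup d \<delta> i) (cap d \<delta> i) (max i 1)"

definition tensor_endo :: "(site \<Rightarrow> site) \<Rightarrow> 'r::field \<Rightarrow> nat \<Rightarrow> ((nat \<Rightarrow> site) \<Rightarrow> 'r) endo" where
  "tensor_endo d \<delta> i = Endo (tensor_op d \<delta> i)"

lemma apply_tensor_endo [simp]: "apply_endo (tensor_endo d \<delta> i) f = tensor_op d \<delta> i f"
  unfolding tensor_endo_def by (rule apply_Endo) (simp add: tensor_op_def local_op_add)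

lemma tensor_endo_scale: "scale_fun c * tensor_endo d \<delta> i = tensor_endo d \<delta> i * scale_fun c"
  by (rule endo_eqI) (simp add: tensor_op_def local_op_scale)

lemma site_all: "(\<forall>a::site. P a) \<longleftrightarrow> P (False, False) \<and> P (False, True) \<and> P (True, False) \<and> P (True, True)"
  by (auto simp: all_bool_eq)

lemma sum_pick:
  fixes f :: "site \<Rightarrow> 'r::comm_monoid_add"
  assumes "\<And>c. c \<noteq> v \<Longrightarrow> f c = 0"
  shows "(\<Sum>\<^sub>s c. f c) = f v"
proof -
  have "(\<Sum>\<^sub>s c. f c) = sum f {v}" by (rule sum.mono_neutral_right) (use assms in auto)
  then show ?thesis by simp
qed

lemma pivot_pivot_inv: "(\<Sum>\<^sub>s b. pivot \<delta> v b * pivot_inv \<delta> b u) = (if u = v then 1 else 0)"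
proof -
  have "\<forall>u v. (\<Sum>\<^sub>s b. pivot \<delta> v b * pivot_inv \<delta> b u) = (if u = v then 1 else 0)"
    unfolding site_all sum_site by simp
  then show ?thesis by blast
qed

lemma pivot_inv_pivot: "(\<Sum>\<^sub>s b. pivot_inv \<delta> u b * pivot \<delta> b v) = (if u = v then 1 else 0)"
proof -
  have "\<forall>u v. (\<Sum>\<^sub>s b. pivot_inv \<delta> u b * pivot \<delta> b v) = (if u = v then 1 else 0)"
    unfolding site_all sum_site by simp
  then show ?thesis by blast
qed

lemma flip_flip [simp]: "flip (flip a) = a"
  by (simp add: flip_def prod_eq_iff)

definition twist :: "(site \<Rightarrow> site) \<Rightarrow> nat \<Rightarrow> site \<Rightarrow> site" where
  "twist d i = (if i = 0 then d else id)"

lemma cup_cap_odd: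
  assumes "i = 0 \<or> odd i"
  shows "cup d \<delta> i a b = of_bool (twist d i a = b)" "cap d \<delta> i a b = pivot \<delta> (twist d i a) b"
  using assms by (auto simp: cup_def cap_def twist_def)

lemma cup_cap_even:
  assumes "i \<noteq> 0" "even i"
  shows "cup d \<delta> i a b = pivot_inv \<delta> a b" "cap d \<delta> i a b = of_bool (a = b)"
  using assms by (auto simp: cup_def cap_def)

lemma twist_twist:
  assumes "d = id \<or> d = flip"
  shows "twist d i (twist d i a) = a"
  using assms by (auto simp: twist_def)

lemma loop_value:
  assumes "d = id \<or> d = flip"
  shows "(\<Sum>\<^sub>s a b. cap d \<delta> i a b * cup d \<delta> i a b) = \<delta>"
proof (cases "i = 0 \<or> odd i")
  case True
  have "(\<Sum>\<^sub>s b. cap d \<delta> i a b * cup d \<delta> i a b) = pivot \<delta> (twist d i a) (twist d i a)" for a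
    unfolding cup_cap_odd[OF True] by (subst sum_pick[of "twist d i a"]) auto
  then have "(\<Sum>\<^sub>s a b. cap d \<delta> i a b * cup d \<delta> i a b) = (\<Sum>\<^sub>s a. pivot \<delta> (twist d i a) (twist d i a))"
    by simp
  also have "\<dots> = \<delta>" using assms unfolding sum_site twist_def flip_def by auto
  finally show ?thesis .
next
  case False
  then have "i \<noteq> 0" "even i" by auto
  note c = cup_cap_even[OF this]
  have "(\<Sum>\<^sub>s b. cap d \<delta> i a b * cup d \<delta> i a b) = pivot_inv \<delta> a a" for a
    unfolding c by (subst sum_pick[of a]) auto
  then show ?thesis by (simp add: sum_site)
qed

lemma loop_value_01:
  "(\<Sum>\<^sub>s a b. cap flip \<delta> 0 a b * cup flip \<delta> 1 a b) = 0"
  "(\<Sum>\<^sub>s a b. cap flip \<delta> 1 a b * cup flip \<delta> 0 a b) = 0"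
proof -
  have "(\<Sum>\<^sub>s b. cap flip \<delta> 0 a b * cup flip \<delta> 1 a b) = pivot \<delta> (flip a) a"
    "(\<Sum>\<^sub>s b. cap flip \<delta> 1 a b * cup flip \<delta> 0 a b) = pivot \<delta> a (flip a)" for a
    unfolding cup_def cap_def by (subst sum_pick[of a]; simp) (subst sum_pick[of "flip a"]; simp)
  then show "(\<Sum>\<^sub>s a b. cap flip \<delta> 0 a b * cup flip \<delta> 1 a b) = 0"
    "(\<Sum>\<^sub>s a b. cap flip \<delta> 1 a b * cup flip \<delta> 0 a b) = 0"
    by (simp_all add: sum_site flip_def)
qed

text \<open>Neighbours have opposite parity, with 0 counted as odd, so the remaining tensors are
  Kronecker deltas up to the twist. They collapse the triple sum to a matrix product of the pivot
  and its inverse.\<close>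

lemma zigzag1:
  assumes d: "d = id \<or> d = flip" and ij: "i = 0 \<and> j = 2 \<or> 1 \<le> i \<and> j = Suc i"
  shows "(\<Sum>\<^sub>s a b c. cap d \<delta> i a b * cup d \<delta> j b u * (cap d \<delta> j c v * cup d \<delta> i a c)) = (if u = v then 1 else 0)"
    (is "(\<Sum>\<^sub>s a. ?F a) = _")
proof (cases "i = 0 \<or> odd i")
  case True
  then have "j \<noteq> 0" "even j" using ij by auto
  note c = cup_cap_even[OF this] cup_cap_odd[OF True]
  note t = twist_twist[OF d]
  let ?w = "twist d i v"
  have ne: "twist d i a \<noteq> v" if "a \<noteq> ?w" for a using that t by metis
  have "(\<Sum>\<^sub>s a. ?F a) = ?F ?w"
  proof (rule sum_pick)
    show "?F a = 0" if "a \<noteq> ?w" for a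
      using ne[OF that] by (intro sum.neutral ballI) (simp add: c)
  qed
  also have "\<dots> = (\<Sum>\<^sub>s b. pivot \<delta> v b * pivot_inv \<delta> b u)"
    unfolding c t by (rule sum.cong[OF refl], subst sum_pick[of v]) auto
  finally show ?thesis unfolding pivot_pivot_inv .
next
  case False
  then have i: "i \<noteq> 0" "even i" and j: "j = 0 \<or> odd j" "j \<noteq> 0" using ij by auto
  note c = cup_cap_even[OF i] cup_cap_odd[OF j(1)]
  have t: "twist d j a = a" for a using j by (simp add: twist_def)
  have "(\<Sum>\<^sub>s a. ?F a) = ?F u"
    by (rule sum_pick) (auto intro!: sum.neutral simp: c t)
  also have "\<dots> = (\<Sum>\<^sub>s c. cap d \<delta> i u u * cup d \<delta> j u u * (cap d \<delta> j c v * cup d \<delta> i u c))"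
    by (rule sum_pick) (auto intro!: sum.neutral simp: c t)
  also have "\<dots> = (\<Sum>\<^sub>s c. pivot_inv \<delta> u c * pivot \<delta> c v)"
    unfolding c t by (simp add: mult.commute)
  finally show ?thesis unfolding pivot_inv_pivot .
qed

lemma zigzag2:
  assumes d: "d = id \<or> d = flip" and ij: "i = 0 \<and> j = 2 \<or> 1 \<le> i \<and> j = Suc i"
  shows "(\<Sum>\<^sub>s a b c. cap d \<delta> j a b * cup d \<delta> i u a * (cap d \<delta> i v c * cup d \<delta> j c b)) = (if u = v then 1 else 0)"
    (is "(\<Sum>\<^sub>s a. ?F a) = _")
proof (cases "i = 0 \<or> odd i")
  case True
  then have "j \<noteq> 0" "even j" using ij by auto
  note c = cup_cap_even[OF this] cup_cap_odd[OF True]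
  let ?w = "twist d i u"
  have "(\<Sum>\<^sub>s a. ?F a) = ?F ?w"
    by (rule sum_pick) (auto intro!: sum.neutral simp: c)
  also have "\<dots> = (\<Sum>\<^sub>s c. cap d \<delta> j ?w ?w * cup d \<delta> i u ?w * (cap d \<delta> i v c * cup d \<delta> j c ?w))"
    by (rule sum_pick) (auto intro!: sum.neutral simp: c)
  also have "\<dots> = (\<Sum>\<^sub>s c. pivot \<delta> (twist d i v) c * pivot_inv \<delta> c (twist d i u))"
    unfolding c by simp
  also have "\<dots> = (if u = v then 1 else 0)"
    unfolding pivot_pivot_inv using twist_twist[OF d, of i] by metis
  finally show ?thesis .
next
  case False
  then have i: "i \<noteq> 0" "even i" and j: "j = 0 \<or> odd j" "j \<noteq> 0" using ij by auto
  note c = cup_cap_even[OF i] cup_cap_odd[OF j(1)]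
  have t: "twist d j a = a" for a using j by (simp add: twist_def)
  have "?F a = pivot_inv \<delta> u a * pivot \<delta> a v" for a
  proof -
    have "?F a = (\<Sum>\<^sub>s c. cap d \<delta> j a v * cup d \<delta> i u a * (cap d \<delta> i v c * cup d \<delta> j c v))"
      by (rule sum_pick) (auto intro!: sum.neutral simp: c t)
    also have "\<dots> = cap d \<delta> j a v * cup d \<delta> i u a * (cap d \<delta> i v v * cup d \<delta> j v v)"
      by (rule sum_pick) (auto simp: c t)
    finally show ?thesis by (simp add: c t mult.commute)
  qed
  then show ?thesis by (simp add: pivot_inv_pivot)
qed

lemma tensor_01:
  "tensor_endo flip \<delta> 0 * tensor_endo flip \<delta> 1 = 0"
  "tensor_endo flip \<delta> 1 * tensor_endo flip \<delta> 0 = 0"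
  using loop_value_01[of \<delta>] by (auto intro!: endo_eqI simp: tensor_op_def local_op_same fun_eq_iff)

lemma tensor_id: "tensor_endo id \<delta> 0 = tensor_endo id \<delta> 1"
proof -
  have "cup id \<delta> 0 = cup id \<delta> 1" "cap id \<delta> 0 = cap id \<delta> 1"
    by (simp_all add: cup_def cap_def fun_eq_iff)
  then show ?thesis by (simp add: tensor_endo_def tensor_op_def)
qed

lemma tensor_braid:
  assumes "d = id \<or> d = flip" "i = 0 \<and> j = 2 \<or> 1 \<le> i \<and> j = Suc i"
  shows "tensor_endo d \<delta> i * tensor_endo d \<delta> j * tensor_endo d \<delta> i = tensor_endo d \<delta> i"
    "tensor_endo d \<delta> j * tensor_endo d \<delta> i * tensor_endo d \<delta> j = tensor_endo d \<delta> j"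
proof -
  have "max j 1 = Suc (max i 1)" using assms by auto
  then show "tensor_endo d \<delta> i * tensor_endo d \<delta> j * tensor_endo d \<delta> i = tensor_endo d \<delta> i"
    "tensor_endo d \<delta> j * tensor_endo d \<delta> i * tensor_endo d \<delta> j = tensor_endo d \<delta> j"
    using local_op_zigzag1[OF zigzag1[OF assms]] local_op_zigzag2[OF zigzag2[OF assms]]
    by (auto intro!: endo_eqI simp: tensor_op_def)
qed

lemma tensor_far:
  assumes "d = id \<or> d = flip" "max i 1 + 2 \<le> max j 1"
  shows "tensor_endo d \<delta> i * tensor_endo d \<delta> j = tensor_endo d \<delta> j * tensor_endo d \<delta> i"
  using local_op_far[OF assms(2)] by (auto intro!: endo_eqI simp: tensor_op_def)

lemma TLD_rel_tensor:
  fixes \<delta> :: "'r::field"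
  assumes "4 \<le> n" and d: "d = id \<or> d = flip"
  shows "TLD_rel scale_fun (tensor_endo d \<delta>) n \<delta>"
proof (intro TLD_rel.intro scalars_scale_fun TLD_rel_axioms.intro assms tensor_endo_scale)
  show "scale_fun 1 * tensor_endo d \<delta> i = tensor_endo d \<delta> i" for i
    by (rule endo_eqI) simp
  show "tensor_endo d \<delta> i * tensor_endo d \<delta> i = scale_fun \<delta> * tensor_endo d \<delta> i" for i
    by (rule endo_eqI) (simp add: tensor_op_def local_op_same loop_value[OF d])
  show "tensor_endo d \<delta> i * tensor_endo d \<delta> j = tensor_endo d \<delta> j * tensor_endo d \<delta> i"
    if "i \<noteq> j" "\<not> D_adj i j" for i j
  proof -
    \<comment> \<open>Distinct nonadjacent vertices act on disjoint pairs of sites, except 0 and 1,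
      which share a pair.\<close>
    have "max i 1 + 2 \<le> max j 1 \<or> max j 1 + 2 \<le> max i 1 \<or> i = 0 \<and> j = 1 \<or> i = 1 \<and> j = 0"
      using that by (cases "i < 2"; cases "j < 2") (simp_all add: D_adj_def max_def; linarith)+
    then consider "max i 1 + 2 \<le> max j 1" | "max j 1 + 2 \<le> max i 1" | "i = 0" "j = 1" | "i = 1" "j = 0"
      by blast
    then show ?thesis
    proof cases
      case 1
      then show ?thesis using tensor_far[OF d] by blast
    next
      case 2
      then show ?thesis using tensor_far[OF d] by metis
    qed (use d in \<open>auto simp: tensor_01[simplified] tensor_id[simplified]\<close>)
  qed
  show "tensor_endo d \<delta> i * tensor_endo d \<delta> j * tensor_endo d \<delta> i = tensor_endo d \<delta> i"
    if "D_adj i j" for i j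
  proof -
    have "i = 0 \<and> j = 2 \<or> 1 \<le> i \<and> j = Suc i \<or> j = 0 \<and> i = 2 \<or> 1 \<le> j \<and> i = Suc j"
      using that by (auto simp: D_adj_def)
    then show ?thesis using tensor_braid[OF d] by blast
  qed
qed

section \<open>The first vanishing coefficient\<close>

context TL_rel begin

fun nested_cups :: "nat \<Rightarrow> 'a" where
  "nested_cups 0 = s 1"
| "nested_cups (Suc k) = nested_cups k * e (n - 2 * k - 1)"

lemma Corner_nested_cups: "2 * k + 1 \<le> n \<Longrightarrow> Corner (nested_cups k) (n - 2 * k)"
proof (induction k)
  case 0
  then show ?case using Corner_one by simp
next
  case (Suc k)
  then have "Corner (nested_cups k * e (n - 2 * k - 1)) (n - 2 * k - 2)"
    by (intro Corner_step) auto
  then show ?case by simp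
qed

text \<open>Compression replaces \<open>x\<close> by some \<open>t\<close> in \<open>A M\<close>,
  which acts on \<open>b\<close> as a scalar; what remains contains \<open>b * b\<close>.\<close>

lemma nilpotent_corner:
  assumes q: "Corner q M" and M: "M \<le> n" and b: "b \<in> A M" "\<And>i. i \<in> V M \<Longrightarrow> e i * b = 0" "b * b = 0" and x: "x \<in> A n"
  shows "(b * q) * x * (b * q) = 0"
proof -
  obtain t where t: "t \<in> A M" "q * x * q = q * t" using q x by (auto simp: Corner_def)
  have qb: "q * b = b * q" using q b by (simp add: Corner_def)
  obtain c where c: "t * b = s c * b" using alg_scalar_left[of "e ` V M" b t] b t by auto
  have "(b * q) * x * (b * q) = (b * q) * x * (q * b)" unfolding qb ..
  also have "\<dots> = b * (q * x * q) * b" by (simp add: mult.assoc)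
  also have "\<dots> = b * q * (t * b)" unfolding t by (simp add: mult.assoc)
  also have "\<dots> = q * (b * b) * s c" unfolding c A_cent[OF M b(1)] by (simp add: mult.assoc comm_left[OF qb])
  finally show ?thesis by (simp add: b)
qed

text \<open>The vanishing of \<open>D m\<close> makes \<open>e m * jw m * e m\<close> zero, so
  \<open>e m\<close> joins the generators annihilating \<open>b\<close> from the left. As
  \<open>jw m\<close> annihilates the earlier ones, all of \<open>V (Suc m)\<close> is
  covered.\<close>

lemma nilpotent_one_cup:
  assumes m: "2 \<le> m" "m < n" "D m = 0" "\<And>j. 1 \<le> j \<Longrightarrow> j < m \<Longrightarrow> D j \<noteq> 0" and b: "b = jw m * e m"
  shows "b \<in> A (Suc m)" "\<And>i. i \<in> V (Suc m) \<Longrightarrow> e i * b = 0" "b * b = 0"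
proof -
  have mn: "m \<le> n" using m by simp
  have "jw m \<in> A (Suc m)" using jw_mem[OF mn] A_mono[of m "Suc m"] by auto
  then show "b \<in> A (Suc m)" unfolding b using m by (intro A_mult A_e in_V) auto
  note k = jw_kill[OF mn m(4)]
  have top: "e m * b = 0" using k(3) m by (simp add: b mult.assoc[symmetric])
  show "e i * b = 0" if "i \<in> V (Suc m)" for i
    using that k(1)[of i] top V_Suc[OF m(1)] by (auto simp: b simp flip: mult.assoc)
  show "b * b = 0" using top by (metis b mult.assoc mult_zero_right)
qed

text \<open>With two extra strands \<open>e (m + 1)\<close> has to kill \<open>b\<close> too. This
  is the purpose of the factor \<open>e (m - 1)\<close>: the braid relation removes
  \<open>e m\<close> between two copies of \<open>e (m + 1)\<close>, after which \<open>jw m\<close>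
  meets \<open>e (m - 1)\<close>.\<close>

lemma nilpotent_two_cups:
  assumes m: "2 \<le> m" "Suc m < n" "D m = 0" "\<And>j. 1 \<le> j \<Longrightarrow> j < m \<Longrightarrow> D j \<noteq> 0" and "Suc 0 \<in> G"
    and b: "b = jw m * e m * e (m - 1) * e (Suc m)"
  shows "b \<in> A (Suc (Suc m))" "\<And>i. i \<in> V (Suc (Suc m)) \<Longrightarrow> e i * b = 0" "b * b = 0"
proof -
  have mn: "m \<le> n" using m by simp
  \<comment> \<open>For \<open>m = 2\<close> the vertex \<open>m - 1\<close> belongs to the fork,
    whence the condition \<open>Suc 0 \<in> G\<close>.\<close>
  have V1: "m - 1 \<in> V m" using m \<open>Suc 0 \<in> G\<close> by (cases "m = 2") (auto simp: gen_index_def)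
  have V2: "m - 1 \<in> V n" using V1 V_mono[OF mn] by auto
  have z: "jw m \<in> A m" by (rule jw_mem[OF mn])
  have "jw m \<in> A (Suc (Suc m))" using z A_mono[of m "Suc (Suc m)"] by auto
  moreover have "m - 1 \<in> V (Suc (Suc m))" using V1 V_mono[of m "Suc (Suc m)"] by auto
  moreover have "e m \<in> A (Suc (Suc m))" "e (Suc m) \<in> A (Suc (Suc m))" using m by (auto intro!: A_e in_V)
  ultimately show "b \<in> A (Suc (Suc m))" unfolding b using m A_e[of "Suc (Suc m)" "m - 1"] by (intro A_mult) auto
  note k = jw_kill[OF mn m(4)]
  have top: "e m * jw m * e m = 0" using k(3) m by simp
  have comm: "e (m - 1) * e (Suc m) = e (Suc m) * e (m - 1)"
    using m V1 by (intro far) auto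
  have zc: "jw m * e (Suc m) = e (Suc m) * jw m" using A_far[OF _ _ _ z, of "Suc m"] m by auto
  have br: "e (Suc m) * e m * e (Suc m) = e (Suc m)"
    using m G_sub by (intro braid2) (auto simp: gen_index_def)
  have top2: "e (Suc m) * b = 0"
  proof -
    have "e (Suc m) * b = jw m * (e (Suc m) * e m * e (Suc m)) * e (m - 1)"
      unfolding b by (simp add: mult.assoc comm comm_left[OF zc[symmetric]] del: One_nat_def)
    also have "\<dots> = jw m * e (m - 1) * e (Suc m)" unfolding br by (simp add: mult.assoc comm del: One_nat_def)
    finally show ?thesis using k(2)[of "m - 1"] V1 by simp
  qed
  show "e i * b = 0" if i: "i \<in> V (Suc (Suc m))" for i
  proof -
    consider "i \<in> V m" | "i = m" | "i = Suc m" using i V_Suc[of "Suc m"] V_Suc[of m] m by auto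
    then show ?thesis
    proof cases
      case 1
      then show ?thesis using k(1)[of i] by (simp add: b flip: mult.assoc)
    next
      case 2
      then show ?thesis using top by (simp add: b flip: mult.assoc)
    qed (use top2 in simp)
  qed
  show "b * b = 0" using top2 by (metis b mult.assoc mult_zero_right)
qed

end

section \<open>Nonvanishing in the tensor representation\<close>

definition cap_total :: "(site \<Rightarrow> site) \<Rightarrow> 'r::comm_ring_1 \<Rightarrow> nat \<Rightarrow> 'r" where
  "cap_total d \<delta> p = (\<Sum>\<^sub>s a b. cap d \<delta> p a b)"

text \<open>The total is the value of a cap on the constant vector: the entries of the pivot add up
  to \<delta>, those of the 4 by 4 identity to 4. The latter needs 2 to be nonzero.\<close>

lemma cap_total_nonzero:
  assumes "1 \<le> p" "\<delta> \<noteq> 0" "(2 :: 'r::field) \<noteq> 0"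
  shows "cap_total d \<delta> p \<noteq> (0 :: 'r)"
proof (cases "odd p")
  case True
  then have "cap_total d \<delta> p = \<delta>" using assms by (simp add: cap_total_def cap_def sum_site)
  then show ?thesis using assms by simp
next
  case False
  have "(\<Sum>\<^sub>s b. cap d \<delta> p a b) = 1" for a
    using False assms by (subst sum_pick[of a]) (auto simp: cap_def)
  then have "cap_total d \<delta> p = 2 * 2" by (simp only: cap_total_def sum_site) simp
  then show ?thesis using assms(3) by (metis mult_eq_0_iff)
qed

lemma tensor_op_indep:
  assumes "1 \<le> p" "\<And>s a b. g (s(p := a, Suc p := b)) = g s"
  shows "tensor_op d \<delta> p g = (\<lambda>s. cup d \<delta> p (s p) (s (Suc p)) * cap_total d \<delta> p * g s)"
  using assms by (simp add: tensor_op_def local_op_def cap_total_def max_def fun_eq_iff sum_distrib_right mult.assoc)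

lemma TL_rel_tensor:
  fixes \<delta> :: "'r::field"
  assumes n: "4 \<le> n" and dG: "d = id \<and> G = {1} \<or> d = flip \<and> G = {0, 1}"
  shows "TL_rel scale_fun (tensor_endo d \<delta>) G n \<delta>"
proof -
  interpret T: TLD_rel scale_fun "tensor_endo d \<delta>" n \<delta>
    using n dG by (intro TLD_rel_tensor) auto
  have one: "x * scale_fun 1 = x" for x :: "((nat \<Rightarrow> site) \<Rightarrow> 'r) endo"
    by (rule endo_eqI) simp
  have one': "scale_fun 1 * x = x" for x :: "((nat \<Rightarrow> site) \<Rightarrow> 'r) endo"
    by (rule endo_eqI) simp
  have "T.central_idem (scale_fun 1)"
    unfolding T.central_idem_def one one' by (simp add: T.alg_scal)
  then have "TL_rel (\<lambda>x. scale_fun x * scale_fun 1) (\<lambda>i. tensor_endo d \<delta> i * scale_fun 1) G n \<delta>"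
  proof (rule T.summand_TL_rel)
    show "tensor_endo d \<delta> i * tensor_endo d \<delta> j * scale_fun 1 = 0" if "i \<in> G" "j \<in> G" "i \<noteq> j" for i j
      using that dG by (auto simp: tensor_01[simplified])
  qed (use dG in auto)
  then show ?thesis unfolding one .
qed

lemma TL_tensor_alg:
  assumes "4 \<le> n" "d = id \<and> G = {1} \<or> d = flip \<and> G = {0, 1}"
  shows "tensor_endo d \<delta> ` gen_index G n = tensor_endo d \<delta> ` {..<n}"
proof (rule antisym)
  show "tensor_endo d \<delta> ` gen_index G n \<subseteq> tensor_endo d \<delta> ` {..<n}"
    using assms by (auto simp: gen_index_def)
  show "tensor_endo d \<delta> ` {..<n} \<subseteq> tensor_endo d \<delta> ` gen_index G n"
  proof
    fix x assume "x \<in> tensor_endo d \<delta> ` {..<n}"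
    then obtain i where i: "i < n" "x = tensor_endo d \<delta> i" by auto
    show "x \<in> tensor_endo d \<delta> ` gen_index G n"
    proof (cases "i = 0 \<and> d = id")
      case True
      then have "x = tensor_endo d \<delta> 1" using i tensor_id by blast
      then show ?thesis using assms by (auto simp: gen_index_def)
    next
      case False
      moreover have "id \<noteq> flip" by (auto simp: fun_eq_iff flip_def)
      ultimately have "i \<in> gen_index G n" using i assms by (auto simp: gen_index_def)
      then show ?thesis using i by blast
    qed
  qed
qed

locale tensor_rep =
  fixes d :: "site \<Rightarrow> site" and G :: "nat set" and n :: nat and \<delta> :: "'r::field"
  assumes n4: "4 \<le> n" and dG: "d = id \<and> G = {1} \<or> d = flip \<and> G = {0, 1}"
    and \<delta>0: "\<delta> \<noteq> 0" and two: "(2 :: 'r) \<noteq> 0"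
begin

sublocale TL_rel scale_fun "tensor_endo d \<delta>" G n \<delta>
  by (rule TL_rel_tensor[OF n4 dG])

abbreviation E :: "nat \<Rightarrow> ((nat \<Rightarrow> site) \<Rightarrow> 'r) endo" where
  "E \<equiv> tensor_endo d \<delta>"

definition depends_below :: "nat \<Rightarrow> ((nat \<Rightarrow> site) \<Rightarrow> 'r) \<Rightarrow> bool" where
  "depends_below m g \<longleftrightarrow> (\<forall>s t. (\<forall>j\<le>m. s j = t j) \<longrightarrow> g s = g t)"

lemma jw_apply:
  assumes "k \<le> n" "\<And>i. i \<in> V k \<Longrightarrow> cup d \<delta> i (s0 (max i 1)) (s0 (Suc (max i 1))) = 0"
  shows "apply_endo (jw k * y) g s0 = apply_endo y g s0"
proof -
  have "apply_endo (jw k * y) g s0 = apply_endo (scale_fun 1 * y) g s0"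
  proof (rule jw_functional[OF assms(1), of "\<lambda>x. apply_endo x g s0"])
    show "apply_endo (E i * x) g s0 = 0" if "i \<in> V k" for i x
      using assms(2)[OF that] by (simp add: tensor_op_def local_op_def)
  qed simp
  then show ?thesis by simp
qed

text \<open>Each cup contributes its entry at \<open>s0\<close> times the total weight of its cap,
  as long as the vector does not depend on the sites it contracts. The factors are peeled off from
  the right, the one acting first being nearest to the remaining strands.\<close>

lemma nested_cups_apply:
  assumes "2 * k + 1 \<le> n" "\<And>p. n - 2 * k < p \<Longrightarrow> cup d \<delta> p (s0 p) (s0 (Suc p)) \<noteq> 0"
  shows "\<exists>K. K \<noteq> 0 \<and> (\<forall>g. depends_below (n - 2 * k) g \<longrightarrow>
    apply_endo (nested_cups k) g s0 = K * g s0)"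
  using assms
proof (induction k)
  case 0
  then show ?case by (intro exI[of _ 1]) simp
next
  case (Suc k)
  have "\<exists>K. K \<noteq> 0 \<and> (\<forall>g. depends_below (n - 2 * k) g \<longrightarrow>
    apply_endo (nested_cups k) g s0 = K * g s0)"
    using Suc.prems by (intro Suc.IH) auto
  then obtain K where K: "K \<noteq> 0"
    "\<And>g. depends_below (n - 2 * k) g \<Longrightarrow> apply_endo (nested_cups k) g s0 = K * g s0"
    by blast
  let ?p = "n - 2 * k - 1"
  have p: "1 \<le> ?p" "Suc ?p = n - 2 * k" "n - 2 * Suc k < ?p" using Suc.prems by auto
  let ?c = "cup d \<delta> ?p (s0 ?p) (s0 (Suc ?p)) * cap_total d \<delta> ?p"
  have "?c \<noteq> 0" using Suc.prems(2)[OF p(3)] cap_total_nonzero[OF p(1) \<delta>0 two] by simp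
  moreover have "apply_endo (nested_cups (Suc k)) g s0 = K * ?c * g s0"
    if g: "depends_below (n - 2 * Suc k) g" for g
  proof -
    have "g (s(?p := a, Suc ?p := b)) = g s" for s a b
      using p by (intro g[unfolded depends_below_def, rule_format]) auto
    then have op: "tensor_op d \<delta> ?p g = (\<lambda>s. cup d \<delta> ?p (s ?p) (s (Suc ?p)) * cap_total d \<delta> ?p * g s)"
      by (rule tensor_op_indep[OF p(1)])
    have "apply_endo (nested_cups (Suc k)) g s0 = apply_endo (nested_cups k) (tensor_op d \<delta> ?p g) s0" by simp
    also have "\<dots> = K * tensor_op d \<delta> ?p g s0"
    proof (rule K(2), unfold depends_below_def, intro allI impI)
      fix s t :: "nat \<Rightarrow> site" assume st: "\<forall>j\<le>n - 2 * k. s j = t j"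
      then have "s ?p = t ?p" "s (Suc ?p) = t (Suc ?p)" "g s = g t"
        using p by (auto intro!: g[unfolded depends_below_def, rule_format])
      then show "tensor_op d \<delta> ?p g s = tensor_op d \<delta> ?p g t" unfolding op by simp
    qed
    finally show ?thesis unfolding op by (simp add: mult.assoc)
  qed
  ultimately show ?case using K(1) by (intro exI[of _ "K * ?c"]) auto
qed

lemma cup_V2: "1 \<le> i \<Longrightarrow> cup d \<delta> i (True, x) (True, x) \<noteq> 0"
  "x \<noteq> y \<Longrightarrow> cup d \<delta> i (True, x) (True, y) = 0"
  using dG by (auto simp: cup_def flip_def)

lemma indep_nontrivial:
  assumes "2 \<le> m" "m < n" "\<And>i. i \<le> m \<Longrightarrow> s0 i = (True, odd i)" "i \<in> V m"
  shows "cup d \<delta> i (s0 (max i 1)) (s0 (Suc (max i 1))) = 0"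
proof -
  have "Suc (max i 1) \<le> m" using assms(1,4) dG by (auto simp: gen_index_def)
  then have "s0 (max i 1) = (True, odd (max i 1))" "s0 (Suc (max i 1)) = (True, odd (Suc (max i 1)))"
    using assms(3) by auto
  then show ?thesis using cup_V2(2) by simp
qed

lemma one_cup_nonzero:
  assumes m: "2 \<le> m" "m < n" and k: "n = Suc m + 2 * k"
  shows "jw m * E m * nested_cups k \<noteq> 0"
proof
  assume 0: "jw m * E m * nested_cups k = 0"
  \<comment> \<open>Labels alternate up to \<open>m\<close> to make \<open>jw m\<close> trivial;
    site \<open>m + 1\<close> repeats the label of \<open>m\<close> for the cup of
    \<open>E m\<close>, and the constant rest serves the nested cups.\<close>
  define s0 where "s0 j = (True, if j \<le> m then odd j else if j = Suc m then odd m else True)" for j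
  let ?g = "\<lambda>_ :: nat \<Rightarrow> site. 1 :: 'r"
  have nk: "n - 2 * k = Suc m" "2 * k + 1 \<le> n" using k by auto
  have "\<exists>K. K \<noteq> 0 \<and> (\<forall>g. depends_below (n - 2 * k) g \<longrightarrow>
    apply_endo (nested_cups k) g s0 = K * g s0)"
    using cup_V2(1) by (intro nested_cups_apply nk) (auto simp: nk s0_def)
  then obtain K where K: "K \<noteq> 0"
    "\<And>g. depends_below (Suc m) g \<Longrightarrow> apply_endo (nested_cups k) g s0 = K * g s0"
    unfolding nk by blast
  have op: "tensor_op d \<delta> m ?g = (\<lambda>s. cup d \<delta> m (s m) (s (Suc m)) * cap_total d \<delta> m * 1)"
    using m by (intro tensor_op_indep) auto
  \<comment> \<open>After the exchange \<open>E m\<close> acts first, on the constant vector; its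
    output depends only on sites up to \<open>m + 1\<close>, as \<open>K\<close> requires.\<close>
  have "nested_cups k * E m = E m * nested_cups k"
    using Corner_nested_cups[OF nk(2)] A_e[of "Suc m" m] m nk by (auto simp: Corner_def in_V)
  then have "apply_endo (jw m * E m * nested_cups k) ?g s0
     = apply_endo (jw m * (nested_cups k * E m)) ?g s0" by (simp only: mult.assoc)
  also have "\<dots> = apply_endo (nested_cups k * E m) ?g s0"
    using m by (intro jw_apply indep_nontrivial) (auto simp: s0_def)
  also have "\<dots> = apply_endo (nested_cups k) (tensor_op d \<delta> m ?g) s0" by simp
  also have "\<dots> = K * tensor_op d \<delta> m ?g s0" by (rule K(2)) (simp add: op depends_below_def)
  finally have "K * (cup d \<delta> m (s0 m) (s0 (Suc m)) * cap_total d \<delta> m) = 0" unfolding 0 op by simp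
  moreover have "s0 m = (True, odd m)" "s0 (Suc m) = (True, odd m)" by (auto simp: s0_def)
  ultimately show False using K(1) cup_V2(1)[of m "odd m"] cap_total_nonzero[of m \<delta> d] \<delta>0 two m by simp
qed

lemma two_cups_nonzero:
  assumes m: "2 \<le> m" "Suc m < n" and k: "n = Suc (Suc m) + 2 * k"
  shows "jw m * E m * E (m - 1) * E (Suc m) * nested_cups k \<noteq> 0"
    (is "?b * nested_cups k \<noteq> 0")
proof
  assume 0: "?b * nested_cups k = 0"
  \<comment> \<open>The product of the three generators carries a cup on \<open>m, m + 1\<close>
    inside an arc joining \<open>m - 1\<close> and \<open>m + 2\<close>; the labels agree along
    both.\<close>
  define s0 where "s0 j = (True, if j \<le> m then odd j else if j = Suc m then odd m else
    if j = Suc (Suc m) then even m else True)" for j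
  let ?g = "\<lambda>_ :: nat \<Rightarrow> site. 1 :: 'r"
  let ?y = "E m * E (m - 1) * E (Suc m)"
  have nk: "n - 2 * k = Suc (Suc m)" "2 * k + 1 \<le> n" using k by auto
  have "\<exists>K. K \<noteq> 0 \<and> (\<forall>g. depends_below (n - 2 * k) g \<longrightarrow>
    apply_endo (nested_cups k) g s0 = K * g s0)"
    using cup_V2(1) by (intro nested_cups_apply nk) (auto simp: nk s0_def)
  then obtain K where K: "K \<noteq> 0"
    "\<And>g. depends_below (Suc (Suc m)) g \<Longrightarrow> apply_endo (nested_cups k) g s0 = K * g s0"
    unfolding nk by blast
  let ?C = "cap_total d \<delta> (m - 1) * cap_total d \<delta> (Suc m)"
  have op1: "tensor_op d \<delta> (Suc m) ?g = (\<lambda>s. cup d \<delta> (Suc m) (s (Suc m)) (s (Suc (Suc m))) * cap_total d \<delta> (Suc m) * 1)"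
    by (intro tensor_op_indep) auto
  have op2: "tensor_op d \<delta> (m - 1) (tensor_op d \<delta> (Suc m) ?g) =
    (\<lambda>s. cup d \<delta> (m - 1) (s (m - 1)) (s (Suc (m - 1))) * cap_total d \<delta> (m - 1) * tensor_op d \<delta> (Suc m) ?g s)"
    using m by (intro tensor_op_indep) (auto simp: op1)
  have ne: "m - Suc 0 \<noteq> m" "m - Suc 0 \<noteq> Suc m" using m by auto
  define h where "h = tensor_op d \<delta> m (tensor_op d \<delta> (m - 1) (tensor_op d \<delta> (Suc m) ?g))"
  have h: "h s = cup d \<delta> m (s m) (s (Suc m)) * (\<Sum>\<^sub>s a b. cap d \<delta> m a b *
      (cup d \<delta> (m - 1) (s (m - 1)) a * cap_total d \<delta> (m - 1) * (cup d \<delta> (Suc m) b (s (Suc (Suc m))) * cap_total d \<delta> (Suc m))))" for s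
    unfolding h_def op1 op2[unfolded op1] using m ne by (simp add: tensor_op_def[of d \<delta> m] local_op_def max_def)
  have y: "?y \<in> A (Suc (Suc m))"
  proof -
    have "m - 1 \<in> V (Suc (Suc m))" using m dG by (auto simp: gen_index_def)
    moreover have "E m \<in> A (Suc (Suc m))" "E (Suc m) \<in> A (Suc (Suc m))"
      using m by (auto intro!: A_e in_V)
    ultimately show ?thesis using m A_e[of "Suc (Suc m)" "m - 1"] by (intro A_mult) auto
  qed
  have "nested_cups k * ?y = ?y * nested_cups k"
    using Corner_nested_cups[OF nk(2)] y nk by (simp add: Corner_def)
  then have "apply_endo (?b * nested_cups k) ?g s0 = apply_endo (jw m * (nested_cups k * ?y)) ?g s0"
    by (simp only: mult.assoc)
  also have "\<dots> = apply_endo (nested_cups k * ?y) ?g s0"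
    using m by (intro jw_apply indep_nontrivial) (auto simp: s0_def)
  also have "\<dots> = apply_endo (nested_cups k) h s0" by (simp add: h_def)
  also have "\<dots> = K * h s0"
  proof (rule K(2), unfold depends_below_def, intro allI impI)
    fix s t :: "nat \<Rightarrow> site" assume "\<forall>j\<le>Suc (Suc m). s j = t j"
    then have "s (m - 1) = t (m - 1)" "s m = t m" "s (Suc m) = t (Suc m)" "s (Suc (Suc m)) = t (Suc (Suc m))" by auto
    then show "h s = h t" unfolding h by simp
  qed
  finally have hz: "h s0 = 0" unfolding 0 using K(1) by simp
  have s0: "s0 m = (True, odd m)" "s0 (Suc m) = (True, odd m)" "s0 (m - 1) = (True, even m)" "s0 (Suc (Suc m)) = (True, even m)"
    using m by (auto simp: s0_def)
  let ?v = "(True, even m)"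
  \<comment> \<open>\<open>X\<close> is the weight of the outer arc, composed of two cups and the
    cap between them. On the diagonal block only the label \<open>?v\<close> contributes, so it is 1
    or -1.\<close>
  define X where "X = (\<Sum>\<^sub>s a b. cap d \<delta> m a b * (cup d \<delta> (m - 1) ?v a * cup d \<delta> (Suc m) b ?v))"
  have "h s0 = cup d \<delta> m (True, odd m) (True, odd m) * (X * ?C)"
    unfolding h s0 X_def sum_distrib_right
    by (rule arg_cong2[where f = "(*)"], rule refl, intro sum.cong refl) (simp add: ac_simps)
  moreover have "X \<noteq> 0"
  proof (cases "odd m")
    case True
    then have "X = - 1" unfolding X_def using m by (simp add: cap_def cup_def sum_site)
    then show ?thesis by simp
  next
    case False
    then have "X = 1" unfolding X_def using m by (simp add: cap_def cup_def sum_site)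
    then show ?thesis by simp
  qed
  moreover have "?C \<noteq> 0" using cap_total_nonzero[of "m - 1" \<delta> d] cap_total_nonzero[of "Suc m" \<delta> d] \<delta>0 two m by simp
  ultimately show False using hz cup_V2(1)[of m "odd m"] m by simp
qed

lemma semisimple_cheb:
  assumes ss: "semisimple (TLD n \<delta>)" and j: "1 \<le> j" "j < n"
  shows "cheb (card G) \<delta> j \<noteq> 0"
proof
  assume "cheb (card G) \<delta> j = 0"
  with j have "\<exists>m. 1 \<le> m \<and> m < n \<and> D m = 0" by blast
  then obtain m where m: "1 \<le> m" "m < n" "D m = 0" and least: "\<And>j. 1 \<le> j \<Longrightarrow> j < m \<Longrightarrow> D j \<noteq> 0"
    using exists_least_iff[of "\<lambda>m. 1 \<le> m \<and> m < n \<and> D m = 0"] by (metis less_trans)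
  have m2: "2 \<le> m" using m \<delta>0 by (cases "m = 1") auto
  have S: "alg (E ` {..<n}) = A n" by (simp only: TL_tensor_alg[OF n4 dG])
  have reg: "\<exists>x\<in>A n. b * x * b = b" if "b \<in> A n" for b
    using semisimple_regular[OF ss TLD_rel_tensor[OF n4] tensor_endo_scale, of d b] that dG S by auto
  have no: False if "Corner q M" "M \<le> n" "c \<in> A M" "\<And>i. i \<in> V M \<Longrightarrow> E i * c = 0" "c * c = 0" "c * q \<noteq> 0" for q M c
  proof -
    have "q \<in> A n" using that(1) by (simp add: Corner_def)
    moreover have "c \<in> A n" using that(2,3) A_mono by blast
    ultimately have "c * q \<in> A n" by (intro A_mult) auto
    then obtain x where "x \<in> A n" "(c * q) * x * (c * q) = c * q" using reg by blast
    then show False using nilpotent_corner[OF that(1-5)] that(6) by simp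
  qed
  txt \<open>Nested cups use up the strands in pairs, so one or two strands beyond the first \<open>m\<close> remain.\<close>
  show False
  proof (cases "odd (n - m)")
    case True
    then obtain k where "n - m = 2 * k + 1" by (rule oddE)
    then have k: "n = Suc m + 2 * k" using m by simp
    have C: "Corner (nested_cups k) (Suc m)" using Corner_nested_cups[of k] k by simp
    note nil = nilpotent_one_cup[OF m2 m(2,3) least refl]
    show False by (rule no[OF C _ nil one_cup_nonzero[OF m2 m(2) k]]) (use m in auto)
  next
    case False
    then have "even (n - m)" by simp
    then obtain l where l: "n - m = 2 * l" by (rule evenE)
    then have "l \<noteq> 0" using m by auto
    then obtain k where "l = Suc k" using not0_implies_Suc by blast
    then have k: "n = Suc (Suc m) + 2 * k" using l m by simp
    then have mn: "Suc m < n" by simp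
    have C: "Corner (nested_cups k) (Suc (Suc m))" using Corner_nested_cups[of k] k by simp
    have "Suc 0 \<in> G" using dG by auto
    note nil = nilpotent_two_cups[OF m2 mn m(3) least this refl]
    show False by (rule no[OF C _ nil two_cups_nonzero[OF m2 mn k]]) (use mn in auto)
  qed
qed

end

lemma semisimple_delta_nonzero:
  assumes "4 \<le> n" "semisimple (TLD n (\<delta> :: 'r::field))"
  shows "\<delta> \<noteq> 0"
proof
  assume \<delta>: "\<delta> = 0"
  interpret T: TLD_rel scale_fun "refl_endo :: nat \<Rightarrow> (bool \<times> nat \<Rightarrow> 'r) endo" n 0
    by (rule TLD_rel_refl[OF assms(1)])
  have w: "T.w \<in> T.S" using assms(1) by (intro T.S_mult T.S_e) auto
  obtain x where x: "x \<in> T.S" "T.w * x * T.w = T.w"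
    using T.semisimple_regular[OF assms(2)[unfolded \<delta>] T.TLD_rel_axioms refl_endo_scale w] by blast
  then show False using T.w_S_w[OF refl x(1)] refl_endo_01 by metis
qed

section \<open>Values of the Chebychev polynomials\<close>

lemma eval_int_poly_diff: "eval_int_poly (p - q) x = eval_int_poly p x - eval_int_poly q x"
proof -
  have "map_poly of_int (p - q) = map_poly of_int p - (map_poly of_int q :: 'a poly)"
    by (rule poly_eqI) (simp add: coeff_map_poly)
  then show ?thesis by (simp add: eval_int_poly_def)
qed

lemma eval_int_poly_shift: "eval_int_poly ([:0, 1:] * p) x = x * eval_int_poly p x"
  by (simp add: eval_int_poly_def map_poly_pCons)

lemma eval_chebyshev_P: "eval_int_poly (chebyshev_P (Suc j)) \<delta> = cheb 1 \<delta> j"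
proof (induction j rule: less_induct)
  case (less j)
  consider "j = 0" | "j = 1" | i where "j = Suc (Suc i)" by (metis One_nat_def not0_implies_Suc)
  then show ?case
  proof cases
    case 3
    then show ?thesis using less[of i] less[of "Suc i"]
      by (simp add: eval_int_poly_diff eval_int_poly_shift del: mult_pCons_left)
  qed (simp_all add: eval_int_poly_def map_poly_pCons)
qed

lemma eval_chebyshev_Q: "1 \<le> j \<Longrightarrow> eval_int_poly (chebyshev_Q (Suc j)) \<delta> = \<delta> * cheb 2 \<delta> j"
proof (induction j rule: less_induct)
  case (less j)
  have "j = 1 \<or> j = 2 \<or> (\<exists>i. j = Suc (Suc (Suc i)))" using less.prems by presburger
  then consider "j = 1" | "j = 2" | i where "j = Suc (Suc (Suc i))" by blast
  then show ?case
  proof cases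
    case 1
    then show ?thesis by (simp add: eval_int_poly_def map_poly_pCons power2_eq_square)
  next
    case 2
    have "[:0, 1:] ^ 3 - 2 * [:0, 1:] = [:0, - 2, 0, 1 :: int:]"
      by (simp add: numeral_3_eq_3 numeral_poly)
    then show ?thesis using 2 by (simp add: numeral_2_eq_2 eval_int_poly_def map_poly_pCons algebra_simps)
  next
    case 3
    then have IH: "eval_int_poly (chebyshev_Q (Suc (Suc i))) \<delta> = \<delta> * cheb 2 \<delta> (Suc i)"
      "eval_int_poly (chebyshev_Q (Suc (Suc (Suc i)))) \<delta> = \<delta> * cheb 2 \<delta> (Suc (Suc i))"
      using less.IH[of "Suc i"] less.IH[of "Suc (Suc i)"] by auto
    have "eval_int_poly (chebyshev_Q (Suc j)) \<delta> =
        \<delta> * eval_int_poly (chebyshev_Q (Suc (Suc (Suc i)))) \<delta> - eval_int_poly (chebyshev_Q (Suc (Suc i))) \<delta>"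
      by (simp only: 3 chebyshev_Q.simps eval_int_poly_diff eval_int_poly_shift)
    then show ?thesis unfolding IH by (simp add: 3 algebra_simps)
  qed
qed

theorem theorem6p20:
  fixes \<delta> :: "'r::field" and n :: nat
  assumes "CHAR('r) \<noteq> 2" and "n \<ge> 4"
  shows "semisimple (TLD n \<delta>) \<longleftrightarrow>
    (\<forall>s. 1 < s \<and> s \<le> n \<longrightarrow> eval_int_poly (chebyshev_P s) \<delta> \<noteq> 0) \<and>
    (\<forall>t. 2 < t \<and> t \<le> n \<longrightarrow> eval_int_poly (chebyshev_Q t) \<delta> \<noteq> 0)"
    (is "?S \<longleftrightarrow> ?P \<and> ?Q")
proof -
  have two: "(2 :: 'r) \<noteq> 0"
  proof
    assume "(2 :: 'r) = 0"
    then have "CHAR('r) dvd 2" using of_nat_eq_0_iff_char_dvd[of 2, where 'a = 'r] by simp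
    then have "CHAR('r) = 1 \<or> CHAR('r) = 2" using prime_nat_iff[of 2] two_is_prime_nat by blast
    then show False using assms CHAR_not_1 by auto
  qed
  show ?thesis
  proof
    assume ss: ?S
    have \<delta>: "\<delta> \<noteq> 0" by (rule semisimple_delta_nonzero[OF assms(2) ss])
    \<comment> \<open>Identifying \<open>e 0\<close> with \<open>e 1\<close> yields the conditions
      on \<open>P\<close>, making them orthogonal those on \<open>Q\<close>. Both representations
      require \<delta> to be nonzero, so that case was settled beforehand.\<close>
    interpret P: tensor_rep id "{1}" n \<delta> using assms \<delta> two by unfold_locales auto
    interpret Q: tensor_rep flip "{0, 1}" n \<delta> using assms \<delta> two by unfold_locales auto
    have "eval_int_poly (chebyshev_P s) \<delta> \<noteq> 0" if "1 < s" "s \<le> n" for s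
      using P.semisimple_cheb[OF ss, of "s - 1"] eval_chebyshev_P[of "s - 1" \<delta>] that by simp
    moreover have "eval_int_poly (chebyshev_Q t) \<delta> \<noteq> 0" if "2 < t" "t \<le> n" for t
      using Q.semisimple_cheb[OF ss, of "t - 1"] eval_chebyshev_Q[of "t - 1" \<delta>] that \<delta>
      by (simp add: numeral_2_eq_2)
    ultimately show "?P \<and> ?Q" by blast
  next
    assume PQ: "?P \<and> ?Q"
    have \<delta>: "\<delta> \<noteq> 0" using PQ eval_chebyshev_P[of 1 \<delta>] assms by (auto simp: numeral_2_eq_2)
    show ?S
    proof (rule TLD_semisimple[OF assms(2)], rule conjI)
      fix j assume j: "1 \<le> j" "j < n"
      show "cheb 1 \<delta> j \<noteq> 0" using PQ j eval_chebyshev_P[of j \<delta>] by auto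
      show "cheb 2 \<delta> j \<noteq> 0"
      \<comment> \<open>The index \<open>j = 1\<close> would correspond to \<open>t = 2\<close>,
        outside the range for \<open>Q\<close>; there the coefficient is \<delta>, which is nonzero
        by the condition on \<open>P\<close> at 2.\<close>
      proof (cases "j = 1")
        case False
        then show ?thesis using PQ j eval_chebyshev_Q[of j \<delta>] by auto
      qed (use \<delta> in auto)
    qed
  qed
qed

end
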